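(* Let $\mathscr V\subset\mathbb C^3$ be a complex two-dimensional subspace to which $\langle\ ,\ \rangle$ restricts to be nondegenerate, let $\mathbf v$ be orthogonal to $\mathscr V$ with $\langle\mathbf v,\mathbf v\rangle=\tilde\epsilon=\pm1$, and let $\boldsymbol\delta:I\to\mathscr V$ be a smooth curve on a real interval $I$ with $\langle\boldsymbol\delta(s),\boldsymbol\delta(s)\rangle=\epsilon\tilde\epsilon r^2$ for all $s\in I$. Let $f,\sigma,b,\mathbf e,\rho,\mathbf R$ be as in the context. Then, near points where $\rho\neq0$, the projection $M=\pi(M')$ to $\mathscr X$ of the image $M'$ of $f$ is a ruled hypersurface of $\mathscr X$, whose rulings (given by $s=$ constant) lie in the complex projective lines perpendicular to $\pi(\mathscr V)$ at the points $\pi(\boldsymbol\delta(s))$. Moreover, where $\rho\ne0$ and $w\neq0$, $M$ has unit normal $\xi=\pi_*(\mathrm i\mathbf e/\rho)$ and structure vector $W=-J\xi=\pi_*(\mathbf e/\rho)$, and with respect to the orthonormal basis $(W,E_1,E_2)$ with $E_1=\pi_*(\mathrm i\mathbf R/|\mathbf R|)$, $E_2=\pi_*(\mathbf R/|\mathbf R|)$, the shape operator of $M$ is $$A=\begin{pmatrix}\alpha&\beta&0\\ \beta&0&0\\0&0&0\end{pmatrix},$$ where $$\beta=-\tilde\epsilon\epsilon\,\frac{|w|}{r},\qquad \alpha=\frac1\rho\left(\frac{\langle\boldsymbol\delta_{ss},\mathrm i\boldsymbol\delta_s\rangle-\tilde\epsilon\epsilon\, b\,\langle\boldsymbol\delta_s,\boldsymbol\delta_s\rangle}{\langle\boldsymbol\delta_s,\boldsymbol\delta_s\rangle-\tilde\epsilon\epsilon\,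 b^2r^2}-2\tilde\epsilon\epsilon\, b\right).$$
   Context: Let $r>0$, $\epsilon\in\{1,-1\}$. On $\mathbb C^3\cong\mathbb R^6$ let $\langle\ ,\ \rangle$ be the real part of a Hermitian form, positive definite if $\epsilon=1$ and of real signature $(-,-,+,+,+,+)$ if $\epsilon=-1$ (so $\tilde\epsilon=1$ necessarily when $\epsilon=1$). Let $\mathscr X'=\{\langle\mathbf z,\mathbf z\rangle=\epsilon r^2\}$, let $\pi$ be projectivization, and $\mathscr X=\pi(\mathscr X')$ with the metric making $\pi|_{\mathscr X'}$ a (semi-)Riemannian submersion; $\mathscr X$ is $\mathbb{CP}^2$ ($\epsilon=1$) or $\mathbb{CH}^2$ ($\epsilon=-1$), of constant holomorphic curvature $4c$ with $c=\epsilon/r^2$. When $\tilde\epsilon=\epsilon=-1$, the points $\pi(\boldsymbol\delta(s))$ lie in the indefinite Kähler manifold $\mathbb{CP}^2_1=\{\pi\mathbf z:\langle\mathbf z,\mathbf z\rangle>0\}$ (metric induced from $\{\langle\mathbf z,\mathbf z\rangle=r^2\}$), and perpendicularity there is with respect to its metric. For $\theta\in\mathbb R$, $s\in I$, and $w\in\mathbb C$ with $\tilde\epsilon(1+\epsilon|w|^2)>0$, define $$\mathbf z=f(\theta,s,w)=e^{\mathrm i\theta}\sigma(\boldsymbol\delta(s)+wr\mathbf v),$$ where $\sigma>0$ is determined by $\tilde\epsilon\sigma^2(1+\epsilon|w|^2)=1$, so $f$ takes values in $\mathscr X'$. Subscripts denote partial derivatives. Put $b=\langle\boldsymbol\delta_s,\mathrm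 i\boldsymbol\delta\rangle/r^2$, $\mathbf e=e^{\mathrm i\theta}\sigma(\boldsymbol\delta_s-\tilde\epsilon\epsilon\, b\,\mathrm i\boldsymbol\delta)$, and $\rho=|\mathbf e|$, so that $\rho^2=\sigma^2(\langle\boldsymbol\delta_s,\boldsymbol\delta_s\rangle-\tilde\epsilon\epsilon b^2r^2)\ge0$. Writing $w=w_1+\mathrm iw_2$, put $\mathbf R=w_1\,\partial\mathbf z/\partial w_1+w_2\,\partial\mathbf z/\partial w_2$, which has length $|\mathbf R|=\sigma^2|w|r$. For a real hypersurface with unit normal $\xi$, the shape operator is $AX=-\widetilde\nabla_X\xi$ and $W=-J\xi$. The hypersurface is ruled if $A(W^\perp)\subseteq\operatorname{span}W$, and its rulings are the leaves of $W^\perp$. (In this statement $\beta$ is a signed function.) *)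

theory Defs
  imports "HOL-Analysis.Analysis"
begin

section \<open>Smooth maps\<close>

text \<open>\<open>Ck_on n S f\<close>: the iterated directional derivatives of \<open>f\<close> up to order \<open>n\<close> exist and are
  continuous on \<open>S\<close>. It is used for open sets \<open>S\<close>, and for intervals \<open>S\<close> of the real line, where
  the derivatives at end points are one-sided.\<close>

primrec Ck_on :: "nat \<Rightarrow> 'a::real_normed_vector set \<Rightarrow> ('a \<Rightarrow> 'b::real_normed_vector) \<Rightarrow> bool" where
  "Ck_on 0 S f \<longleftrightarrow> continuous_on S f"
| "Ck_on (Suc n) S f \<longleftrightarrow>
     f differentiable_on S \<and> (\<forall>v. Ck_on n S (\<lambda>x. frechet_derivative f (at x within S) v))"

definition smooth_on :: "'a::real_normed_vector set \<Rightarrow> ('a \<Rightarrow> 'b::real_normed_vector) \<Rightarrow> bool" where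
  "smooth_on S f \<longleftrightarrow> (\<forall>n. Ck_on n S f)"

section \<open>Semi-Riemannian metrics on open subsets of a Euclidean space\<close>

text \<open>A metric is given by its coefficients \<open>g u x y\<close>, the product at the point \<open>u\<close> of the vectors
  \<open>x\<close> and \<open>y\<close>. The next two functions are the Christoffel symbols of the first and second kind,
  written without indices.\<close>

definition christoffel1 ::
  "('a::euclidean_space \<Rightarrow> 'a \<Rightarrow> 'a \<Rightarrow> real) \<Rightarrow> 'a \<Rightarrow> 'a \<Rightarrow> 'a \<Rightarrow> 'a \<Rightarrow> real" where
  "christoffel1 g u x y z =
     (frechet_derivative (\<lambda>p. g p y z) (at u) x
      + frechet_derivative (\<lambda>p. g p x z) (at u) y
      - frechet_derivative (\<lambda>p. g p x y) (at u) z) / 2"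

definition christoffel ::
  "('a::euclidean_space \<Rightarrow> 'a \<Rightarrow> 'a \<Rightarrow> real) \<Rightarrow> 'a \<Rightarrow> 'a \<Rightarrow> 'a \<Rightarrow> 'a" where
  "christoffel g u x y = (THE t. \<forall>z. g u t z = christoffel1 g u x y z)"

text \<open>Levi-Civita covariant derivative at time \<open>t\<close> of a vector field \<open>Y\<close> along a curve \<open>\<gamma>\<close>.\<close>

definition cov_deriv ::
  "('a::euclidean_space \<Rightarrow> 'a \<Rightarrow> 'a \<Rightarrow> real) \<Rightarrow> (real \<Rightarrow> 'a) \<Rightarrow> (real \<Rightarrow> 'a) \<Rightarrow> real \<Rightarrow> 'a" where
  "cov_deriv g \<gamma> Y t =
     vector_derivative Y (at t) + christoffel g (\<gamma> t) (vector_derivative \<gamma> (at t)) (Y t)"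

section \<open>Embedded submanifolds\<close>

text \<open>\<open>F\<close> is a regular parametrization, with parameter domain \<open>V\<close>, of a relatively open part of \<open>M\<close>.\<close>

definition regular_param ::
  "'a::euclidean_space set \<Rightarrow> 'b::euclidean_space set \<Rightarrow> ('b \<Rightarrow> 'a) \<Rightarrow> bool" where
  "regular_param M V F \<longleftrightarrow>
     open V \<and> smooth_on V F \<and> (\<forall>x\<in>V. inj (frechet_derivative F (at x))) \<and>
     openin (top_of_set M) (F ` V) \<and> (\<exists>G. homeomorphism V (F ` V) F G)"

definition curve_in :: "'a::euclidean_space set \<Rightarrow> 'a \<Rightarrow> 'a \<Rightarrow> (real \<Rightarrow> 'a) \<Rightarrow> bool" where
  "curve_in M p X \<gamma> \<longleftrightarrow>
     (\<exists>a>0. \<forall>t. \<bar>t\<bar> < a \<longrightarrow> \<gamma> t \<in> M) \<and> \<gamma> 0 = p \<and> (\<gamma> has_vector_derivative X) (at 0)"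

definition tangent_space :: "'a::euclidean_space set \<Rightarrow> 'a \<Rightarrow> 'a set" where
  "tangent_space M p = {X. \<exists>\<gamma>. curve_in M p X \<gamma>}"

section \<open>Real hypersurfaces of complex surfaces\<close>

text \<open>Holomorphic coordinates of a complex surface take values in the following space; the complex
  structure is then multiplication by \<open>\<i>\<close>. Hypersurfaces are parametrized by open subsets of the
  three-dimensional real vector space \<open>real \<times> complex\<close>, surfaces by open subsets of \<open>complex\<close>.\<close>

type_synonym C2 = "complex \<times> complex"

definition J :: "C2 \<Rightarrow> C2" where
  "J x = (\<i> * fst x, \<i> * snd x)"

definition real_hypersurface :: "C2 set \<Rightarrow> bool" where
  "real_hypersurface M \<longleftrightarrow> (\<forall>p\<in>M. \<exists>V. \<exists>F :: real \<times> complex \<Rightarrow> C2. regular_param M V F \<and> p \<in> F ` V)"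

definition real_surface :: "C2 set \<Rightarrow> bool" where
  "real_surface L \<longleftrightarrow> (\<forall>p\<in>L. \<exists>V. \<exists>F :: complex \<Rightarrow> C2. regular_param L V F \<and> p \<in> F ` V)"

definition smooth_field :: "C2 set \<Rightarrow> (C2 \<Rightarrow> C2) \<Rightarrow> bool" where
  "smooth_field M \<xi> \<longleftrightarrow>
     (\<forall>p\<in>M. \<exists>V. \<exists>F :: real \<times> complex \<Rightarrow> C2.
        regular_param M V F \<and> p \<in> F ` V \<and> smooth_on V (\<lambda>x. \<xi> (F x)))"

definition unit_normal :: "(C2 \<Rightarrow> C2 \<Rightarrow> C2 \<Rightarrow> real) \<Rightarrow> C2 set \<Rightarrow> (C2 \<Rightarrow> C2) \<Rightarrow> bool" where
  "unit_normal g M \<xi> \<longleftrightarrow>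
     smooth_field M \<xi> \<and> (\<forall>p\<in>M. g p (\<xi> p) (\<xi> p) = 1 \<and> (\<forall>X\<in>tangent_space M p. g p (\<xi> p) X = 0))"

definition structure_vector :: "(C2 \<Rightarrow> C2) \<Rightarrow> C2 \<Rightarrow> C2" where
  "structure_vector \<xi> p = - J (\<xi> p)"

text \<open>\<open>A X\<close> is minus the covariant derivative of \<open>\<xi>\<close> along any curve in \<open>M\<close> with velocity \<open>X\<close>.\<close>

definition shape_op ::
  "(C2 \<Rightarrow> C2 \<Rightarrow> C2 \<Rightarrow> real) \<Rightarrow> C2 set \<Rightarrow> (C2 \<Rightarrow> C2) \<Rightarrow> C2 \<Rightarrow> C2 \<Rightarrow> C2" where
  "shape_op g M \<xi> p X =
     (THE Y. \<exists>\<gamma>. curve_in M p X \<gamma> \<and> Y = - cov_deriv g \<gamma> (\<lambda>t. \<xi> (\<gamma> t)) 0)"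

definition W_perp ::
  "(C2 \<Rightarrow> C2 \<Rightarrow> C2 \<Rightarrow> real) \<Rightarrow> C2 set \<Rightarrow> (C2 \<Rightarrow> C2) \<Rightarrow> C2 \<Rightarrow> C2 set" where
  "W_perp g M \<xi> p = {X \<in> tangent_space M p. g p X (structure_vector \<xi> p) = 0}"

text \<open>\<open>M\<close> is a ruled hypersurface, with unit normal \<open>\<xi>\<close>, of the open set \<open>D\<close> with metric \<open>g\<close>.\<close>

definition ruled_hypersurface ::
  "C2 set \<Rightarrow> (C2 \<Rightarrow> C2 \<Rightarrow> C2 \<Rightarrow> real) \<Rightarrow> C2 set \<Rightarrow> (C2 \<Rightarrow> C2) \<Rightarrow> bool" where
  "ruled_hypersurface D g M \<xi> \<longleftrightarrow>
     M \<subseteq> D \<and> real_hypersurface M \<and> unit_normal g M \<xi> \<and>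
     (\<forall>p\<in>M. shape_op g M \<xi> p ` W_perp g M \<xi> p \<subseteq> span {structure_vector \<xi> p})"

text \<open>Leaves are maximal connected integral manifolds. The integral manifolds considered are
  embedded, which suffices for the small pieces of hypersurface to which the notion is applied: on
  them the leaves are the level sets of a submersion.\<close>

definition integral_surface :: "C2 set \<Rightarrow> (C2 \<Rightarrow> C2 set) \<Rightarrow> C2 set \<Rightarrow> bool" where
  "integral_surface M \<Delta> L \<longleftrightarrow>
     L \<subseteq> M \<and> L \<noteq> {} \<and> connected L \<and> real_surface L \<and> (\<forall>p\<in>L. tangent_space L p = \<Delta> p)"

definition leaf :: "C2 set \<Rightarrow> (C2 \<Rightarrow> C2 set) \<Rightarrow> C2 set \<Rightarrow> bool" where
  "leaf M \<Delta> L \<longleftrightarrow>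
     integral_surface M \<Delta> L \<and> (\<forall>L'. integral_surface M \<Delta> L' \<and> L \<subseteq> L' \<longrightarrow> L' = L)"

definition orthonormal_basis :: "(C2 \<Rightarrow> C2 \<Rightarrow> real) \<Rightarrow> C2 set \<Rightarrow> C2^3 \<Rightarrow> bool" where
  "orthonormal_basis q T B \<longleftrightarrow>
     (\<forall>i j. q (B $ i) (B $ j) = (if i = j then 1 else 0)) \<and> span (range (\<lambda>i. B $ i)) = T"

definition has_matrix :: "(C2 \<Rightarrow> C2) \<Rightarrow> C2^3 \<Rightarrow> real^3^3 \<Rightarrow> bool" where
  "has_matrix A B N \<longleftrightarrow>
     (\<forall>x. A (\<Sum>i\<in>UNIV. (x $ i) *\<^sub>R (B $ i)) = (\<Sum>i\<in>UNIV. ((N *v x) $ i) *\<^sub>R (B $ i)))"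

section \<open>Hermitian forms\<close>

definition hermitian_form :: "(complex^3 \<Rightarrow> complex^3 \<Rightarrow> complex) \<Rightarrow> bool" where
  "hermitian_form h \<longleftrightarrow>
     (\<forall>x y z. h (x + y) z = h x z + h y z) \<and> (\<forall>c x y. h (c *s x) y = c * h x y) \<and>
     (\<forall>x y. h y x = cnj (h x y))"

definition ip :: "(complex^3 \<Rightarrow> complex^3 \<Rightarrow> complex) \<Rightarrow> complex^3 \<Rightarrow> complex^3 \<Rightarrow> real" where
  "ip h x y = Re (h x y)"

definition len :: "(complex^3 \<Rightarrow> complex^3 \<Rightarrow> complex) \<Rightarrow> complex^3 \<Rightarrow> real" where
  "len h x = sqrt (ip h x x)"

definition positive_definite :: "('a::real_vector \<Rightarrow> 'a \<Rightarrow> real) \<Rightarrow> bool" where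
  "positive_definite B \<longleftrightarrow> (\<forall>x. x \<noteq> 0 \<longrightarrow> B x x > 0)"

text \<open>\<open>p\<close> minus signs and \<open>q\<close> plus signs in a (pseudo-)orthonormal basis of the real vector space;
  such a family \<open>u\<close> is automatically linearly independent.\<close>

definition has_signature :: "('a::euclidean_space \<Rightarrow> 'a \<Rightarrow> real) \<Rightarrow> nat \<Rightarrow> nat \<Rightarrow> bool" where
  "has_signature B p q \<longleftrightarrow>
     p + q = DIM('a) \<and>
     (\<exists>u :: nat \<Rightarrow> 'a. \<forall>i<p+q. \<forall>j<p+q.
        B (u i) (u j) = (if i \<noteq> j then 0 else if i < p then - 1 else 1))"

section \<open>The complex projective plane and the submersion metrics\<close>

definition proj :: "complex^3 \<Rightarrow> (complex^3) set" where
  "proj z = vec.span {z}"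

text \<open>The affine chart on the complex lines not contained in the plane where the \<open>k\<close>-th coordinate
  vanishes. Arithmetic in the index type \<open>3\<close> is modulo 3, so that \<open>k + 1\<close> and \<open>k + 2\<close> are the two
  indices different from \<open>k\<close>.\<close>

definition chart :: "3 \<Rightarrow> (complex^3) set \<Rightarrow> C2" where
  "chart k l = (THE u. \<exists>z\<in>l. z $ k \<noteq> 0 \<and> u = (z $ (k + 1) / z $ k, z $ (k + 2) / z $ k))"

text \<open>The push-forward by \<open>proj\<close> of the vector \<open>X\<close> at \<open>z\<close>, expressed in the chart \<open>k\<close>.\<close>

definition push :: "3 \<Rightarrow> complex^3 \<Rightarrow> complex^3 \<Rightarrow> C2" where
  "push k z X = frechet_derivative (\<lambda>y. chart k (proj y)) (at z) X"

definition quadric :: "(complex^3 \<Rightarrow> complex^3 \<Rightarrow> complex) \<Rightarrow> real \<Rightarrow> (complex^3) set" where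
  "quadric h c = {z. ip h z z = c}"

definition chart_domain :: "(complex^3 \<Rightarrow> complex^3 \<Rightarrow> complex) \<Rightarrow> real \<Rightarrow> 3 \<Rightarrow> C2 set" where
  "chart_domain h c k = chart k ` proj ` {z \<in> quadric h c. z $ k \<noteq> 0}"

text \<open>Vectors tangent to the quadric at \<open>z\<close> and orthogonal to the fibre of \<open>proj\<close>, which is the
  circle orbit of \<open>z\<close>.\<close>

definition horizontal :: "(complex^3 \<Rightarrow> complex^3 \<Rightarrow> complex) \<Rightarrow> complex^3 \<Rightarrow> complex^3 \<Rightarrow> bool" where
  "horizontal h z X \<longleftrightarrow> ip h X z = 0 \<and> ip h X (\<i> *s z) = 0"

text \<open>The metric on \<open>proj ` quadric h c\<close>, in the chart \<open>k\<close>, for which \<open>proj\<close> is a semi-Riemannian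
  submersion: \<open>proj\<close> is isometric on horizontal vectors.\<close>

definition submersion_metric ::
  "(complex^3 \<Rightarrow> complex^3 \<Rightarrow> complex) \<Rightarrow> real \<Rightarrow> 3 \<Rightarrow> C2 \<Rightarrow> C2 \<Rightarrow> C2 \<Rightarrow> real" where
  "submersion_metric h c k u x y =
     (THE a. \<exists>z X Y. z \<in> quadric h c \<and> z $ k \<noteq> 0 \<and> chart k (proj z) = u \<and>
        horizontal h z X \<and> horizontal h z Y \<and> push k z X = x \<and> push k z Y = y \<and> a = ip h X Y)"

text \<open>The projectivization of the complex plane \<open>P\<close> is a projective line that passes through
  \<open>proj z\<close> and is there perpendicular to the projectivization of \<open>V\<close>, for the metric on
  \<open>proj ` quadric h c\<close>.\<close>

definition perp_line ::
  "(complex^3 \<Rightarrow> complex^3 \<Rightarrow> complex) \<Rightarrow> real \<Rightarrow> (complex^3) set \<Rightarrow> complex^3 \<Rightarrow> (complex^3) set \<Rightarrow> bool"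
  where
  "perp_line h c V z P \<longleftrightarrow>
     vec.subspace P \<and> vec.dim P = 2 \<and> z \<in> P \<and>
     (\<forall>k. z $ k \<noteq> 0 \<longrightarrow>
        (\<forall>x\<in>P. \<forall>y\<in>V. submersion_metric h c k (chart k (proj z)) (push k z x) (push k z y) = 0))"

end

theory Submission
  imports Defs
begin

text \<open>
  In an affine chart \<open>M\<close> is the image of \<open>(s, w) \<mapsto> [Z(s, w)]\<close> with \<open>Z = \<delta>(s) + w r v\<close>, because neither \<open>\<theta>\<close>
  nor \<open>\<sigma>\<close> affects the complex line. If a horizontal field \<open>X(t)\<close> along \<open>Z(t)\<close> represents a vector field
  on the projective plane, then its covariant derivative is represented by \<open>X' - h(Z', Z)/h(Z, Z) X\<close>;
  this formula is insensitive to the choice of the representatives and makes it unnecessary to lift curves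
  horizontally to the quadric. Let \<open>E\<close> be the component of \<open>\<delta>'\<close> orthogonal to \<open>\<complex>\<delta>\<close>. The vectors \<open>\<delta>\<close>, \<open>E\<close>, \<open>v\<close>
  form an orthogonal basis, so \<open>E'\<close> is a combination of \<open>E\<close> and \<open>\<delta>\<close>, and \<open>\<delta> = Z - w r v\<close> projects to a
  vector tangent to the ruling. Applied to \<open>X = i E/\<rho>\<close> this gives the shape operator. The distribution
  \<open>W\<^sup>\<bottom>\<close> is the kernel of \<open>ds\<close>, hence the leaves are the slices \<open>s = const\<close>.
\<close>

text \<open>\<open>tangent_space\<close> and \<open>shape_op\<close> admit every curve in
  \<open>M\<close> that is differentiable at 0 alone, and \<open>shape_op\<close> is a definite
  description, so its value has to be found for all of them. This is why local pieces are described
  by an inequality \<open>m * norm (x - y) \<le> norm (F x - F y)\<close>: it lifts such curves to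
  parameter curves that have a velocity.

  In \<open>h(Z', Z)/h(Z, Z)\<close> the real part compensates for the changing length of
  \<open>Z\<close>, the imaginary part \<open>\<mu>\<close> for its rotation in the fibre. The real
  part cancels against the derivative of the normalizing factor \<open>1/\<rho>\<close>;
  \<open>\<mu>\<close> alone gives the values on the rulings, hence \<beta> in the first row. In the
  first column \<beta> comes from \<open>h(E', \<delta>) = - h(E, \<delta>')\<close>. The summand
  with the factor 2 in \<alpha> collects two equal terms, one from \<open>h(E', E)\<close> and one
  from \<open>\<mu>\<close>.

  For \<epsilon> = -1 one of \<delta> and \<open>v\<close> is timelike; its complex line uses up
  both minus signs of the form, so that \<open>E\<close> has nonnegative square and \<rho> is
  real.\<close>

section \<open>Smooth maps on open sets\<close>

text \<open>The congruence is a hypothesis because \<open>Ck_on_cong\<close> below is proved with this rule.\<close>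

lemma Ck_on_SucI:
  fixes f :: "'a::real_normed_vector \<Rightarrow> 'b::real_normed_vector"
  assumes "open S" "\<And>x. x \<in> S \<Longrightarrow> (f has_derivative f' x) (at x)"
    and "\<And>v. Ck_on n S (\<lambda>x. f' x v)"
    and cong: "\<And>f g :: 'a \<Rightarrow> 'b. (\<And>x. x \<in> S \<Longrightarrow> f x = g x) \<Longrightarrow> Ck_on n S f \<Longrightarrow> Ck_on n S g"
  shows "Ck_on (Suc n) S f"
proof -
  have deriv: "frechet_derivative f (at x within S) = f' x" if "x \<in> S" for x
    using assms that by (metis at_within_open frechet_derivative_at)
  have "Ck_on n S (\<lambda>x. frechet_derivative f (at x within S) v)" for v
    by (rule cong[OF _ assms(3)[of v]]) (simp add: deriv)
  moreover have "f differentiable_on S"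
    using assms by (meson differentiableI differentiable_at_imp_differentiable_on)
  ultimately show ?thesis by simp
qed

text \<open>\<open>Ck_on_SucI\<close> is applied with the derivative of \<open>f\<close> as the
  derivative of \<open>g\<close>; the congruence that it demands one order lower is the induction
  hypothesis.\<close>

lemma Ck_on_cong:
  assumes "open S" "\<And>x. x \<in> S \<Longrightarrow> f x = g x" "Ck_on n S f"
  shows "Ck_on n S g"
  using assms(2,3)
proof (induction n arbitrary: f g)
  case 0
  then show ?case using continuous_on_eq by auto
next
  case (Suc n)
  then have d: "f differentiable_on S" by simp
  show ?case
  proof (rule Ck_on_SucI[OF assms(1), where f' = "\<lambda>x. frechet_derivative f (at x within S)"])
    fix x assume x: "x \<in> S"
    then have "(f has_derivative frechet_derivative f (at x within S)) (at x)"
      using d assms(1) by (metis at_within_open differentiable_on_def frechet_derivative_works)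
    then show "(g has_derivative frechet_derivative f (at x within S)) (at x)"
      using has_derivative_transform_within_open[OF _ assms(1) x] Suc.prems(1) by blast
  next
    show "Ck_on n S (\<lambda>x. frechet_derivative f (at x within S) v)" for v
      using Suc.prems(2) by simp
  next
    show "Ck_on n S g'" if "\<And>x. x \<in> S \<Longrightarrow> f' x = g' x" "Ck_on n S f'" for f' g' :: "'a \<Rightarrow> 'b"
      using Suc.IH[OF that] .
  qed
qed

lemma Ck_on_Suc_derivI:
  fixes f :: "'a::real_normed_vector \<Rightarrow> 'b::real_normed_vector"
  assumes "open S" "\<And>x. x \<in> S \<Longrightarrow> (f has_derivative f' x) (at x)"
    and "\<And>v. Ck_on n S (\<lambda>x. f' x v)"
  shows "Ck_on (Suc n) S f"
proof (rule Ck_on_SucI[where f' = f'])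
  show "Ck_on n S k" if "\<And>x. x \<in> S \<Longrightarrow> h x = k x" "Ck_on n S h" for h k :: "'a \<Rightarrow> 'b"
    by (rule Ck_on_cong[OF assms(1) that])
qed (fact assms)+

lemma Ck_on_Suc_derivD:
  assumes "open S" "Ck_on (Suc n) S f"
  shows "\<And>x. x \<in> S \<Longrightarrow> (f has_derivative frechet_derivative f (at x)) (at x)"
    and "Ck_on n S (\<lambda>x. frechet_derivative f (at x) v)"
proof -
  show "(f has_derivative frechet_derivative f (at x)) (at x)" if "x \<in> S" for x
    using assms that by (metis Ck_on.simps(2) at_within_open differentiable_on_def frechet_derivative_works)
  have "Ck_on n S (\<lambda>x. frechet_derivative f (at x within S) v)" using assms by simp
  then show "Ck_on n S (\<lambda>x. frechet_derivative f (at x) v)"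
    by (rule Ck_on_cong[OF assms(1), rotated]) (simp add: at_within_open[OF _ assms(1)])
qed

lemma Ck_on_Suc_imp: "Ck_on (Suc n) S f \<Longrightarrow> Ck_on n S f"
proof (induction n arbitrary: f)
  case 0
  then show ?case by (simp add: differentiable_imp_continuous_on)
next
  case (Suc n)
  from Suc.prems have "f differentiable_on S"
    and "\<And>v. Ck_on (Suc n) S (\<lambda>x. frechet_derivative f (at x within S) v)" by simp_all
  with Suc.IH show ?case unfolding Ck_on.simps(2)[of n] by blast
qed

text \<open>At points of an open subset the derivative within \<open>T\<close> is the two-sided one.
  This leads from the interval of the curve to its interior, and later from the open set of
  admissible parameters to small boxes.\<close>

lemma Ck_on_interior:
  assumes "Ck_on n T f" "open S" "S \<subseteq> T"
  shows "Ck_on n S f"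
  using assms(1)
proof (induction n arbitrary: f)
  case 0
  then show ?case using assms(3) continuous_on_subset by auto
next
  case (Suc n)
  have at: "at x within T = at x" if "x \<in> S" for x
    using assms that at_within_interior interior_maximal by blast
  show ?case
  proof (rule Ck_on_Suc_derivI[where f' = "\<lambda>x. frechet_derivative f (at x within T)"])
    fix x assume "x \<in> S"
    then show "(f has_derivative frechet_derivative f (at x within T)) (at x)"
      using Suc.prems at[of x] assms(3)
      by (metis Ck_on.simps(2) differentiable_on_def frechet_derivative_works subsetD)
  qed (use Suc assms in auto)
qed

lemma Ck_on_const: "open S \<Longrightarrow> Ck_on n S (\<lambda>x. c)"
proof (induction n arbitrary: c)
  case (Suc n)
  then show ?case by (intro Ck_on_Suc_derivI[where f' = "\<lambda>x v. 0"]) auto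
qed simp

lemma Ck_on_linear:
  assumes "open S" "bounded_linear L"
  shows "Ck_on n S (\<lambda>x. L x)"
proof (cases n)
  case 0
  then show ?thesis using assms by (simp add: linear_continuous_on)
next
  case (Suc m)
  show ?thesis unfolding Suc
    by (rule Ck_on_Suc_derivI[where f' = "\<lambda>x. L"])
       (use assms in \<open>auto intro: bounded_linear_imp_has_derivative Ck_on_const\<close>)
qed

lemma Ck_on_add:
  assumes "open S" "Ck_on n S f" "Ck_on n S g"
  shows "Ck_on n S (\<lambda>x. f x + g x)"
  using assms(2,3)
proof (induction n arbitrary: f g)
  case 0
  then show ?case by (simp add: continuous_on_add)
next
  case (Suc n)
  note d = Ck_on_Suc_derivD[OF assms(1)]
  show ?case
  proof (rule Ck_on_Suc_derivI[OF assms(1)])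
    fix x assume x: "x \<in> S"
    show "((\<lambda>x. f x + g x) has_derivative
        (\<lambda>v. frechet_derivative f (at x) v + frechet_derivative g (at x) v)) (at x)"
      by (rule has_derivative_add[OF d(1)[OF Suc.prems(1) x] d(1)[OF Suc.prems(2) x]])
  next
    fix v
    show "Ck_on n S (\<lambda>x. frechet_derivative f (at x) v + frechet_derivative g (at x) v)"
      by (rule Suc.IH[OF d(2)[OF Suc.prems(1)] d(2)[OF Suc.prems(2)]])
  qed
qed

text \<open>One product rule that serves multiplication, scaling and the Hermitian form.\<close>

lemma Ck_on_bilinear:
  assumes "open S" "bounded_bilinear B" "Ck_on n S f" "Ck_on n S g"
  shows "Ck_on n S (\<lambda>x. B (f x) (g x))"
  using assms(3,4)
proof (induction n arbitrary: f g)
  case 0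
  then show ?case using bounded_bilinear.continuous_on[OF assms(2), of S f g] by simp
next
  case (Suc n)
  note d = Ck_on_Suc_derivD[OF assms(1)]
  show ?case
  proof (rule Ck_on_Suc_derivI[OF assms(1)])
    fix x assume x: "x \<in> S"
    show "((\<lambda>x. B (f x) (g x)) has_derivative
        (\<lambda>v. B (f x) (frechet_derivative g (at x) v) + B (frechet_derivative f (at x) v) (g x))) (at x)"
      by (rule bounded_bilinear.FDERIV[OF assms(2) d(1)[OF Suc.prems(1) x] d(1)[OF Suc.prems(2) x]])
  next
    fix v
    show "Ck_on n S (\<lambda>x. B (f x) (frechet_derivative g (at x) v) + B (frechet_derivative f (at x) v) (g x))"
      by (rule Ck_on_add[OF assms(1)
            Suc.IH[OF Ck_on_Suc_imp[OF Suc.prems(1)] d(2)[OF Suc.prems(2)]]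
            Suc.IH[OF d(2)[OF Suc.prems(1)] Ck_on_Suc_imp[OF Suc.prems(2)]]])
  qed
qed

text \<open>The inner maps that occur are the projection to \<open>s\<close> and the inclusion of a
  slice. An affine map has constant derivative, so the derivative of the composition is again a
  composition with the same inner map and the induction closes.\<close>

lemma Ck_on_compose_linear:
  assumes "open S" "open T" "bounded_linear L" "\<And>x. x \<in> S \<Longrightarrow> L x + c \<in> T" "Ck_on n T g"
  shows "Ck_on n S (\<lambda>x. g (L x + c))"
  using assms(5)
proof (induction n arbitrary: g)
  case 0
  have "continuous_on S (\<lambda>x. L x + c)"
    using assms(3) by (intro continuous_intros linear_continuous_on)
  with 0 show ?case using assms(4) by (auto intro: continuous_on_compose2)
next
  case (Suc n)
  show ?case
  proof (rule Ck_on_Suc_derivI[OF assms(1)])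
    fix x assume x: "x \<in> S"
    have "((\<lambda>x. L x + c) has_derivative L) (at x)"
      using assms(3) by (auto intro!: derivative_eq_intros bounded_linear_imp_has_derivative)
    from has_derivative_compose[OF this Ck_on_Suc_derivD(1)[OF assms(2) Suc.prems assms(4)[OF x]]]
    show "((\<lambda>x. g (L x + c)) has_derivative (\<lambda>v. frechet_derivative g (at (L x + c)) (L v))) (at x)" .
  next
    fix v
    show "Ck_on n S (\<lambda>x. frechet_derivative g (at (L x + c)) (L v))"
      using Suc.IH[OF Ck_on_Suc_derivD(2)[OF assms(2) Suc.prems]] .
  qed
qed

lemma Ck_on_inverse:
  fixes f :: "'a::real_normed_vector \<Rightarrow> 'b::real_normed_field"
  assumes "open S" "Ck_on n S f" "\<And>x. x \<in> S \<Longrightarrow> f x \<noteq> 0"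
  shows "Ck_on n S (\<lambda>x. inverse (f x))"
  using assms(2)
proof (induction n)
  case 0
  then show ?case using assms(3) continuous_on_inverse[of S f] by simp
next
  case (Suc n)
  note m = Ck_on_bilinear[OF assms(1) bounded_bilinear_mult]
  have i: "Ck_on n S (\<lambda>x. inverse (f x))" by (rule Suc.IH[OF Ck_on_Suc_imp[OF Suc.prems]])
  show ?case
  proof (rule Ck_on_Suc_derivI[OF assms(1)])
    fix x assume x: "x \<in> S"
    show "((\<lambda>x. inverse (f x)) has_derivative
       (\<lambda>v. - 1 * (inverse (f x) * frechet_derivative f (at x) v * inverse (f x)))) (at x)"
      using Deriv.has_derivative_inverse[OF assms(3)[OF x] Ck_on_Suc_derivD(1)[OF assms(1) Suc.prems x]]
      by (simp only: mult_minus1)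
  next
    fix v
    show "Ck_on n S (\<lambda>x. - 1 * (inverse (f x) * frechet_derivative f (at x) v * inverse (f x)))"
      by (intro m Ck_on_const[OF assms(1)] i Ck_on_Suc_derivD(2)[OF assms(1) Suc.prems])
  qed
qed

text \<open>The derivative of f^(-1/2) is -(1/2) (f^(-1/2))^3 f', a product of the function itself
  with the derivative of \<open>f\<close>. Treating root and reciprocal together therefore closes
  the induction. The factor 1/\<rho> has this form.\<close>

lemma Ck_on_inverse_sqrt:
  fixes f :: "'a::real_normed_vector \<Rightarrow> real"
  assumes "open S" "Ck_on n S f" "\<And>x. x \<in> S \<Longrightarrow> f x > 0"
  shows "Ck_on n S (\<lambda>x. inverse (sqrt (f x)))"
  using assms(2)
proof (induction n)
  case 0
  have "\<And>x. x \<in> S \<Longrightarrow> f x \<noteq> 0" using assms(3) by force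
  with 0 show ?case
    using continuous_on_inverse[of S "\<lambda>x. sqrt (f x)"] continuous_on_real_sqrt[of S f] by simp
next
  case (Suc n)
  note m = Ck_on_bilinear[OF assms(1) bounded_bilinear_mult]
  let ?i = "\<lambda>x. inverse (sqrt (f x))"
  have i: "Ck_on n S ?i" by (rule Suc.IH[OF Ck_on_Suc_imp[OF Suc.prems]])
  show ?case
  proof (rule Ck_on_Suc_derivI[OF assms(1)])
    fix x assume x: "x \<in> S"
    have p: "f x > 0" using assms(3)[OF x] .
    have s: "((\<lambda>x. sqrt (f x)) has_derivative (\<lambda>v. frechet_derivative f (at x) v * (inverse (sqrt (f x)) / 2))) (at x)"
      using p by (intro DERIV_compose_FDERIV[OF DERIV_real_sqrt Ck_on_Suc_derivD(1)[OF assms(1) Suc.prems x]])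
    have "sqrt (f x) \<noteq> 0" using p by simp
    from Deriv.has_derivative_inverse[OF this s]
    show "(?i has_derivative
       (\<lambda>v. - (1/2) * (?i x * ?i x * ?i x * frechet_derivative f (at x) v))) (at x)"
      by (simp add: ac_simps)
  next
    fix v
    show "Ck_on n S (\<lambda>x. - (1/2) * (?i x * ?i x * ?i x * frechet_derivative f (at x) v))"
      by (intro m Ck_on_const[OF assms(1)] i Ck_on_Suc_derivD(2)[OF assms(1) Suc.prems])
  qed
qed

lemma Ck_on_bounded_linear:
  assumes "open S" "bounded_linear L" "Ck_on n S f"
  shows "Ck_on n S (\<lambda>x. L (f x))"
proof -
  have "bounded_bilinear (\<lambda>(c::real) x. c *\<^sub>R L x)"
    by (intro bounded_bilinear.comp[OF bounded_bilinear_scaleR bounded_linear_ident assms(2)])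
  from Ck_on_bilinear[OF assms(1) this Ck_on_const[OF assms(1), of _ 1] assms(3)]
  show ?thesis by simp
qed

lemma Ck_on_Pair:
  assumes "open S" "Ck_on n S f" "Ck_on n S g"
  shows "Ck_on n S (\<lambda>x. (f x, g x))"
proof -
  have "bounded_linear (\<lambda>x::'b. (x, 0::'c))" "bounded_linear (\<lambda>x::'c. (0::'b, x))"
    by (auto intro: bounded_linear_Pair bounded_linear_ident bounded_linear_zero)
  from Ck_on_add[OF assms(1) Ck_on_bounded_linear[OF assms(1) this(1) assms(2)]
      Ck_on_bounded_linear[OF assms(1) this(2) assms(3)]]
  show ?thesis by simp
qed

lemma has_vector_derivative_eventually_eq:
  assumes "(f has_vector_derivative D) (at x)" "eventually (\<lambda>t. f t = g t) (nhds x)"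
  shows "(g has_vector_derivative D) (at x)"
proof -
  obtain S where "open S" "x \<in> S" "\<And>t. t \<in> S \<Longrightarrow> f t = g t"
    using assms(2) unfolding eventually_nhds by blast
  with assms(1) show ?thesis by (rule has_vector_derivative_transform_within_open)
qed

section \<open>Immersions and tangent spaces\<close>

lemma has_vector_derivative_at_0_alt:
  "(\<gamma> has_vector_derivative X) (at 0) \<longleftrightarrow>
     (\<forall>e>0. \<exists>d>0. \<forall>t. \<bar>t\<bar> < d \<longrightarrow> norm (\<gamma> t - \<gamma> 0 - t *\<^sub>R X) \<le> e * \<bar>t\<bar>)"
  unfolding has_vector_derivative_def has_derivative_at_alt
  by (simp add: bounded_linear_scaleR_left)

lemma has_vector_derivative_line: "((\<lambda>t. x + t *\<^sub>R y) has_vector_derivative y) (at 0)"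
  for x y :: "'a::real_normed_vector"
  by (auto intro!: derivative_eq_intros simp: has_vector_derivative_def)

text \<open>The estimate \<open>expanding\<close> is a quantitative injectivity: it yields an
  injective derivative, a Lipschitz inverse, and a bound for a parameter curve in terms of its
  image.\<close>

locale embedded_param =
  fixes V :: "'b::euclidean_space set" and F :: "'b \<Rightarrow> 'a::euclidean_space"
    and F' :: "'b \<Rightarrow> 'b \<Rightarrow> 'a" and m :: real
  assumes open_V: "open V"
    and smooth: "smooth_on V F"
    and deriv: "\<And>x. x \<in> V \<Longrightarrow> (F has_derivative F' x) (at x)"
    and m_pos: "m > 0"
    and expanding: "\<And>x y. x \<in> V \<Longrightarrow> y \<in> V \<Longrightarrow> m * norm (x - y) \<le> norm (F x - F y)"
begin

lemma linear_deriv: "x \<in> V \<Longrightarrow> linear (F' x)"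
  using deriv has_derivative_linear by blast

lemma frechet_eq: "x \<in> V \<Longrightarrow> frechet_derivative F (at x) = F' x"
  using deriv frechet_derivative_at by metis

text \<open>Divide the estimate for \<open>x + t v\<close> and \<open>x\<close> by \<open>t\<close>;
  as \<open>t\<close> tends to 0 only an arbitrarily small error \<open>e\<close> is left.\<close>

lemma deriv_expanding:
  assumes x: "x \<in> V"
  shows "m * norm v \<le> norm (F' x v)"
proof (cases "v = 0")
  case False
  have "m * norm v \<le> norm (F' x v) + e" if "e > 0" for e
  proof -
    define k where "k = e / norm v"
    have k: "k > 0" "k * norm v = e" using that False by (auto simp: k_def)
    obtain d where d: "d > 0" "\<And>y. norm (y - x) < d \<Longrightarrow> norm (F y - F x - F' x (y - x)) \<le> k * norm (y - x)"
      using deriv[OF x] k(1) unfolding has_derivative_at_alt by meson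
    obtain d' where d': "d' > 0" "ball x d' \<subseteq> V" using open_V x open_contains_ball by blast
    define t where "t = min d d' / (2 * norm v)"
    have t: "t > 0" "t * norm v < d" "t * norm v < d'"
      using d(1) d'(1) False by (auto simp: t_def min_def)
    have "x + t *\<^sub>R v \<in> V" using d'(2) t by (auto simp: dist_norm subset_iff)
    from expanding[OF this x] have "m * (t * norm v) \<le> norm (F (x + t *\<^sub>R v) - F x)"
      using t(1) by simp
    also have "\<dots> \<le> norm (F' x (t *\<^sub>R v)) + norm (F (x + t *\<^sub>R v) - F x - F' x (t *\<^sub>R v))"
      by (metis add.commute diff_add_cancel norm_triangle_ineq)
    also have "\<dots> \<le> t * norm (F' x v) + k * (t * norm v)"
      using d(2)[of "x + t *\<^sub>R v"] t linear_scale[OF linear_deriv[OF x]] by simp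
    finally have "t * (m * norm v) \<le> t * (norm (F' x v) + e)"
      unfolding k(2)[symmetric] by (simp add: algebra_simps)
    then show ?thesis using t(1) by simp
  qed
  then show ?thesis by (rule field_le_epsilon)
qed simp

lemma inj_deriv: "x \<in> V \<Longrightarrow> inj (F' x)"
  unfolding linear_injective_0[OF linear_deriv]
  using deriv_expanding m_pos by (metis mult_le_0_iff norm_le_zero_iff norm_zero not_less)

lemma inj_F: "inj_on F V"
  using expanding m_pos by (intro inj_onI) (metis eq_iff_diff_eq_0 mult_le_0_iff norm_le_zero_iff norm_zero not_less)

lemma homeomorphism_F: "homeomorphism V (F ` V) F (inv_into V F)"
proof -
  have "continuous_on V F"
    using smooth unfolding smooth_on_def by (metis Ck_on.simps(1))
  moreover have "continuous_on (F ` V) (inv_into V F)"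
  proof (rule continuous_on_iff[THEN iffD2], intro ballI allI impI)
    fix p e :: real and q assume "q \<in> F ` V" and e: "e > 0"
    then obtain x where x: "x \<in> V" "q = F x" by blast
    show "\<exists>d>0. \<forall>q'\<in>F ` V. dist q' q < d \<longrightarrow> dist (inv_into V F q') (inv_into V F q) < e"
    proof (intro exI[of _ "m * e"] conjI ballI impI)
      fix q' assume "q' \<in> F ` V" and d: "dist q' q < m * e"
      then obtain y where y: "y \<in> V" "q' = F y" by blast
      have "m * norm (y - x) < m * e" using expanding[OF y(1) x(1)] d x y by (simp add: dist_norm)
      then show "dist (inv_into V F q') (inv_into V F q) < e"
        using x y m_pos inj_F by (simp add: dist_norm)
    qed (use m_pos e in simp)
  qed
  ultimately show ?thesis
    using inj_F by (auto simp: homeomorphism_def)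
qed

lemma regular: "regular_param (F ` V) V F"
  unfolding regular_param_def
  using open_V smooth inj_deriv homeomorphism_F by (auto simp: frechet_eq)

text \<open>The inverse of \<open>F\<close> is known to be Lipschitz on the image, not to be
  differentiable. The Lipschitz bound makes the lift \<open>c\<close> move at most linearly in
  \<open>t\<close>, so the remainder of \<open>F\<close> at \<open>x\<close> is small of higher
  order along \<open>c\<close>, and the expansion of the derivative carries differentiability over
  from \<open>\<gamma>\<close>.\<close>

lemma curve_lift:
  assumes x: "x \<in> V" and \<gamma>: "curve_in (F ` V) (F x) X \<gamma>"
  obtains c y where "c 0 = x" "(c has_vector_derivative y) (at 0)" "F' x y = X"
    "eventually (\<lambda>t. c t \<in> V \<and> \<gamma> t = F (c t)) (nhds 0)"
proof -
  define c where "c = (\<lambda>t. inv_into V F (\<gamma> t))"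
  let ?L = "F' x"
  have lin: "linear ?L" using linear_deriv[OF x] .
  obtain a where a: "a > 0" "\<And>t. \<bar>t\<bar> < a \<Longrightarrow> \<gamma> t \<in> F ` V" and \<gamma>0: "\<gamma> 0 = F x"
    and \<gamma>': "(\<gamma> has_vector_derivative X) (at 0)"
    using \<gamma> by (auto simp: curve_in_def)
  have cV: "c t \<in> V" "\<gamma> t = F (c t)" if "\<bar>t\<bar> < a" for t
    using a(2)[OF that] by (auto simp: c_def inv_into_into f_inv_into_f)
  have c0: "c 0 = x" using x \<gamma>0 inj_F by (simp add: c_def)
  have key: "\<exists>d>0. \<forall>t. \<bar>t\<bar> < d \<longrightarrow> norm (t *\<^sub>R X - ?L (c t - x)) \<le> e * \<bar>t\<bar>" if e: "e > 0" for e
  proof -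
    \<comment> \<open>The bound \<open>norm (c t - x) \<le> K |t|\<close>: with the error tolerance
      capped at 1, \<open>\<gamma>\<close> moves by at most \<open>(norm X + 1) |t|\<close>, and
      \<open>expanding\<close> costs the factor \<open>1 / m\<close>.\<close>
    define K where "K = (norm X + 1) / m"
    have K: "K > 0" using m_pos by (auto simp: K_def add_nonneg_pos)
    obtain d1 where d1: "d1 > 0" "\<And>t. \<bar>t\<bar> < d1 \<Longrightarrow> norm (\<gamma> t - \<gamma> 0 - t *\<^sub>R X) \<le> min 1 (e/2) * \<bar>t\<bar>"
      using \<gamma>'[unfolded has_vector_derivative_at_0_alt, rule_format, of "min 1 (e/2)"] e by auto
    have eK: "e / (2*K) > 0" using e K by simp
    obtain d2 where d2: "d2 > 0" "\<And>y. norm (y - x) < d2 \<Longrightarrow> norm (F y - F x - ?L (y - x)) \<le> e / (2*K) * norm (y - x)"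
      using deriv[OF x] eK unfolding has_derivative_at_alt by meson
    define d where "d = min a (min d1 (d2 / K))"
    have "d > 0" using a d1 d2 K by (simp add: d_def)
    moreover have "norm (t *\<^sub>R X - ?L (c t - x)) \<le> e * \<bar>t\<bar>" if "\<bar>t\<bar> < d" for t
    proof -
      have t: "\<bar>t\<bar> < a" "\<bar>t\<bar> < d1" "\<bar>t\<bar> < d2 / K" using that by (auto simp: d_def)
      have 1: "norm (\<gamma> t - \<gamma> 0 - t *\<^sub>R X) \<le> min 1 (e/2) * \<bar>t\<bar>" by (rule d1(2)[OF t(2)])
      have 2: "min 1 (e/2) * \<bar>t\<bar> \<le> 1 * \<bar>t\<bar>" "min 1 (e/2) * \<bar>t\<bar> \<le> (e/2) * \<bar>t\<bar>"
        by (intro mult_right_mono; simp)+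
      have "m * norm (c t - x) \<le> norm (\<gamma> t - \<gamma> 0)"
        using expanding[OF cV(1)[OF t(1)] x] cV(2)[OF t(1)] \<gamma>0 by simp
      also have "\<dots> \<le> norm (t *\<^sub>R X) + norm (\<gamma> t - \<gamma> 0 - t *\<^sub>R X)"
        by (metis add.commute diff_add_cancel norm_triangle_ineq)
      also have "\<dots> \<le> (norm X + 1) * \<bar>t\<bar>"
        using 1 2 by (simp add: algebra_simps)
      finally have ct: "norm (c t - x) \<le> K * \<bar>t\<bar>"
        using m_pos by (simp add: K_def field_simps)
      also have "\<dots> < d2" using t(3) K by (simp add: field_simps)
      finally have 3: "norm (F (c t) - F x - ?L (c t - x)) \<le> e / (2*K) * norm (c t - x)"
        by (rule d2(2))
      also have "\<dots> \<le> e / (2*K) * (K * \<bar>t\<bar>)" using ct eK by (intro mult_left_mono) auto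
      also have "\<dots> = e/2 * \<bar>t\<bar>" using K by simp
      finally have 4: "norm (\<gamma> t - \<gamma> 0 - ?L (c t - x)) \<le> e/2 * \<bar>t\<bar>"
        using cV(2)[OF t(1)] \<gamma>0 by simp
      have "norm (t *\<^sub>R X - ?L (c t - x)) =
          norm ((\<gamma> t - \<gamma> 0 - ?L (c t - x)) - (\<gamma> t - \<gamma> 0 - t *\<^sub>R X))"
        by (simp add: algebra_simps)
      also have "\<dots> \<le> e/2 * \<bar>t\<bar> + e/2 * \<bar>t\<bar>"
        using norm_triangle_ineq4 4 1 2(2) by (metis (no_types, lifting) add_mono order_trans)
      finally show ?thesis by simp
    qed
    ultimately show ?thesis by blast
  qed
  \<comment> \<open>By \<open>key\<close>, \<open>X\<close> is a limit of values of
    \<open>?L\<close> at difference quotients of \<open>c\<close>. A subspace of a Euclidean space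
    is closed, so \<open>X\<close> is itself such a value, and its preimage is the candidate for the
    velocity of \<open>c\<close>.\<close>
  have "X \<in> closure (range ?L)"
    unfolding closure_approachable
  proof (intro allI impI)
    fix e :: real assume e: "e > 0"
    obtain d where d: "d > 0" "\<And>t. \<bar>t\<bar> < d \<Longrightarrow> norm (t *\<^sub>R X - ?L (c t - x)) \<le> e/2 * \<bar>t\<bar>"
      using key[of "e/2"] e by auto
    define t where "t = d/2"
    have t: "t > 0" "\<bar>t\<bar> < d" using d by (auto simp: t_def)
    have "t *\<^sub>R ?L ((c t - x) /\<^sub>R t) = ?L (c t - x)"
      using t(1) linear_scale[OF lin, of t "(c t - x) /\<^sub>R t"] by simp
    then have "norm (t *\<^sub>R (X - ?L ((c t - x) /\<^sub>R t))) \<le> e/2 * t"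
      using d(2)[OF t(2)] t(1) by (simp add: scaleR_diff_right)
    then have "norm (X - ?L ((c t - x) /\<^sub>R t)) \<le> e/2" using t(1) by simp
    then have "dist (?L ((c t - x) /\<^sub>R t)) X < e" using e by (simp add: dist_norm norm_minus_commute)
    then show "\<exists>y\<in>range ?L. dist y X < e" by blast
  qed
  then have "X \<in> range ?L"
    using closed_subspace[OF linear_subspace_image[OF lin subspace_UNIV]] by simp
  then obtain y where y: "X = ?L y" by blast
  have "(c has_vector_derivative y) (at 0)"
    unfolding has_vector_derivative_at_0_alt
  proof (intro allI impI)
    fix e :: real assume e: "e > 0"
    obtain d where d: "d > 0" "\<And>t. \<bar>t\<bar> < d \<Longrightarrow> norm (t *\<^sub>R X - ?L (c t - x)) \<le> e * m * \<bar>t\<bar>"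
      using key[of "e * m"] e m_pos by auto
    have "norm (c t - c 0 - t *\<^sub>R y) \<le> e * \<bar>t\<bar>" if "\<bar>t\<bar> < d" for t
    proof -
      have "m * norm (t *\<^sub>R y - (c t - x)) \<le> norm (?L (t *\<^sub>R y - (c t - x)))"
        by (rule deriv_expanding[OF x])
      also have "\<dots> = norm (t *\<^sub>R X - ?L (c t - x))"
        by (simp add: linear_diff[OF lin] linear_scale[OF lin] y)
      also have "\<dots> \<le> e * m * \<bar>t\<bar>" by (rule d(2)[OF that])
      finally have "m * norm (t *\<^sub>R y - (c t - x)) \<le> m * (e * \<bar>t\<bar>)" by (simp add: ac_simps)
      then show ?thesis using m_pos c0 by (simp add: norm_minus_commute)
    qed
    then show "\<exists>d>0. \<forall>t. \<bar>t\<bar> < d \<longrightarrow> norm (c t - c 0 - t *\<^sub>R y) \<le> e * \<bar>t\<bar>" using d(1) by blast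
  qed
  moreover have "eventually (\<lambda>t. c t \<in> V \<and> \<gamma> t = F (c t)) (nhds 0)"
    unfolding eventually_nhds_metric using a(1) cV by (auto simp: dist_norm)
  ultimately show ?thesis using that c0 y by blast
qed

lemma curve_in_compose:
  assumes x: "x \<in> V" and c: "c 0 = x" "(c has_vector_derivative y) (at 0)"
  shows "curve_in (F ` V) (F x) (F' x y) (\<lambda>t. F (c t))"
proof -
  have "isCont c 0"
    using c(2) has_vector_derivative_continuous by blast
  then have "eventually (\<lambda>t. c t \<in> V) (nhds 0)"
    using open_V x c(1) unfolding continuous_at_open eventually_nhds by metis
  then have "\<exists>a>0. \<forall>t. \<bar>t\<bar> < a \<longrightarrow> F (c t) \<in> F ` V"
    unfolding eventually_nhds_metric by (auto simp: dist_norm)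
  moreover have "((\<lambda>t. F (c t)) has_vector_derivative F' x y) (at 0)"
    using has_derivative_compose[of c "\<lambda>t. t *\<^sub>R y" 0 UNIV F "F' x"] c deriv[OF x]
    by (simp add: has_vector_derivative_def linear_scale[OF linear_deriv[OF x]])
  ultimately show ?thesis using c(1) by (simp add: curve_in_def)
qed

lemma tangent_space_image: "x \<in> V \<Longrightarrow> tangent_space (F ` V) (F x) = range (F' x)"
proof
  assume x: "x \<in> V"
  show "tangent_space (F ` V) (F x) \<subseteq> range (F' x)"
    using curve_lift[OF x] by (auto simp: tangent_space_def) (metis rangeI)
  show "range (F' x) \<subseteq> tangent_space (F ` V) (F x)"
    using curve_in_compose[OF x _ has_vector_derivative_line[of x]] by (fastforce simp: tangent_space_def)
qed

end

text \<open>Near \<open>x0\<close> the derivative of \<open>F\<close> minus its linear part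
  \<open>D x0\<close> has norm at most \<open>B/2\<close>, where \<open>D x0\<close> expands by
  \<open>B\<close>. The mean value inequality bounds the difference, and expansion by
  \<open>B/2\<close> remains.\<close>

lemma immersion_locally_expanding:
  fixes F :: "'b::euclidean_space \<Rightarrow> 'a::euclidean_space"
  assumes S: "open S" "x0 \<in> S" and C1: "Ck_on 1 S F"
    and inj: "inj (frechet_derivative F (at x0))"
  obtains d m where "d > 0" "m > 0" "ball x0 d \<subseteq> S"
    "\<And>x y. x \<in> ball x0 d \<Longrightarrow> y \<in> ball x0 d \<Longrightarrow> m * norm (x - y) \<le> norm (F x - F y)"
proof -
  define D where "D = (\<lambda>x. frechet_derivative F (at x))"
  have D: "(F has_derivative D x) (at x)" if "x \<in> S" for x
    using Ck_on_Suc_derivD(1)[OF S(1) C1[unfolded One_nat_def] that] by (simp add: D_def)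
  have contD: "continuous_on S (\<lambda>x. D x v)" for v
    using Ck_on_Suc_derivD(2)[OF S(1) C1[unfolded One_nat_def]] by (simp add: D_def)
  have lin: "linear (D x)" if "x \<in> S" for x using D[OF that] has_derivative_linear by blast
  obtain B where B: "B > 0" "\<And>v. B * norm v \<le> norm (D x0 v)"
    using linear_inj_bounded_below_pos[OF lin[OF S(2)]] inj D_def by metis
  \<comment> \<open>Continuity is available for one direction at a time. Summing errors below
    \<open>e\<close> over the \<open>DIM('b)\<close> basis vectors gives the operator norm bound
    \<open>B/2\<close>.\<close>
  define e where "e = B / (2 * DIM('b))"
  have e: "e > 0" using B(1) by (simp add: e_def)
  have "eventually (\<lambda>x. norm (D x b - D x0 b) < e) (nhds x0)" for b
  proof -
    have "isCont (\<lambda>x. D x b) x0" using contD S continuous_on_eq_continuous_at by blast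
    then show ?thesis
      using e unfolding continuous_at tendsto_iff eventually_at_filter
      by (auto simp: dist_norm dest!: spec[of _ e] elim!: eventually_mono)
  qed
  then have "eventually (\<lambda>x. \<forall>b\<in>Basis. norm (D x b - D x0 b) < e) (nhds x0)"
    by (intro eventually_ball_finite) auto
  moreover have "eventually (\<lambda>x. x \<in> S) (nhds x0)" using S eventually_nhds by blast
  ultimately have "eventually (\<lambda>x. x \<in> S \<and> (\<forall>b\<in>Basis. norm (D x b - D x0 b) < e)) (nhds x0)"
    by eventually_elim auto
  then obtain d where d: "d > 0"
    "\<And>x. dist x x0 < d \<Longrightarrow> x \<in> S \<and> (\<forall>b\<in>Basis. norm (D x b - D x0 b) < e)"
    unfolding eventually_nhds_metric by blast
  have dS: "x \<in> S" "\<And>b. b \<in> Basis \<Longrightarrow> norm (D x b - D x0 b) < e" if "x \<in> ball x0 d" for x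
    using d(2)[of x] that by (auto simp: dist_commute)
  have on: "onorm (\<lambda>v. D x v - D x0 v) \<le> B/2" if x: "x \<in> ball x0 d" for x
  proof (rule onorm_le)
    fix v :: 'b
    have l: "linear (\<lambda>v. D x v - D x0 v)"
      using lin[OF dS(1)[OF x]] lin[OF S(2)] by (rule linear_compose_sub)
    have "norm (D x v - D x0 v) = norm (\<Sum>b\<in>Basis. (v \<bullet> b) *\<^sub>R (D x b - D x0 b))"
      using linear_sum[OF l, of "\<lambda>b. (v \<bullet> b) *\<^sub>R b" Basis] linear_scale[OF l]
      by (simp add: euclidean_representation)
    also have "\<dots> \<le> (\<Sum>b\<in>(Basis::'b set). norm v * e)"
    proof (rule sum_norm_le)
      fix b :: 'b assume b: "b \<in> Basis"
      have "\<bar>v \<bullet> b\<bar> * norm (D x b - D x0 b) \<le> norm v * e"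
        using Basis_le_norm[OF b, of v] dS(2)[OF x b] by (intro mult_mono) auto
      then show "norm ((v \<bullet> b) *\<^sub>R (D x b - D x0 b)) \<le> norm v * e" by simp
    qed
    also have "\<dots> = B/2 * norm v" by (simp add: e_def)
    finally show "norm (D x v - D x0 v) \<le> B/2 * norm v" .
  qed
  have expd: "B/2 * norm (x - y) \<le> norm (F x - F y)" if x: "x \<in> ball x0 d" and y: "y \<in> ball x0 d" for x y
  proof -
    have l0: "linear (D x0)" using lin[OF S(2)] .
    have bl0: "bounded_linear (D x0)" using D[OF S(2)] has_derivative_bounded_linear by blast
    have "norm ((F x - D x0 x) - (F y - D x0 y)) \<le> B/2 * norm (x - y)"
    proof (rule differentiable_bound[OF convex_ball _ on x y])
      fix z assume "z \<in> ball x0 d"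
      then have "(F has_derivative D z) (at z)" using D dS(1) by blast
      then show "((\<lambda>x. F x - D x0 x) has_derivative (\<lambda>v. D z v - D x0 v)) (at z within ball x0 d)"
        by (intro has_derivative_diff bounded_linear_imp_has_derivative[OF bl0])
           (rule has_derivative_at_withinI)
    qed
    moreover have "B * norm (x - y) \<le> norm (D x0 x - D x0 y)"
      using B(2)[of "x - y"] by (simp add: linear_diff[OF l0])
    moreover have "norm (D x0 x - D x0 y) \<le> norm (F x - F y) + norm ((F x - D x0 x) - (F y - D x0 y))"
      using norm_triangle_ineq4[of "F x - F y" "(F x - D x0 x) - (F y - D x0 y)"]
      by (simp add: algebra_simps)
    ultimately show ?thesis by simp
  qed
  show ?thesis
    by (rule that[OF d(1) _ _ expd]) (use B(1) dS(1) in auto)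
qed

text \<open>By \<open>curve_lift\<close> the competing curves in the description are images of
  parameter curves, and injectivity of the derivative forces their velocity to be \<open>y\<close>.
  The image of the line \<open>x + t y\<close> shows that the description is not vacuous.\<close>

lemma shape_op_param:
  fixes F :: "'b::euclidean_space \<Rightarrow> C2"
  assumes "embedded_param V F F' m" and x: "x \<in> V"
    and cov: "\<And>c \<gamma>. c 0 = x \<Longrightarrow> (c has_vector_derivative y) (at 0) \<Longrightarrow>
       eventually (\<lambda>t. c t \<in> V \<and> \<gamma> t = F (c t)) (nhds 0) \<Longrightarrow>
       cov_deriv g \<gamma> (\<lambda>t. \<xi> (\<gamma> t)) 0 = - K"
  shows "shape_op g (F ` V) \<xi> (F x) (F' x y) = K"
proof -
  interpret embedded_param V F F' m by fact
  have val: "cov_deriv g \<gamma> (\<lambda>t. \<xi> (\<gamma> t)) 0 = - K" if \<gamma>: "curve_in (F ` V) (F x) (F' x y) \<gamma>" for \<gamma>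
  proof (rule curve_lift[OF x \<gamma>])
    fix c y' assume c: "c 0 = x" "(c has_vector_derivative y') (at 0)" "F' x y' = F' x y"
      "\<forall>\<^sub>F t in nhds 0. c t \<in> V \<and> \<gamma> t = F (c t)"
    then have "y' = y" using inj_deriv[OF x] by (simp add: inj_eq)
    then show ?thesis using cov[of c \<gamma>] c by simp
  qed
  have ex: "curve_in (F ` V) (F x) (F' x y) (\<lambda>t. F (x + t *\<^sub>R y))"
    by (rule curve_in_compose[OF x _ has_vector_derivative_line]) simp
  show ?thesis
    unfolding shape_op_def
  proof (rule the_equality)
    show "\<exists>\<gamma>. curve_in (F ` V) (F x) (F' x y) \<gamma> \<and> K = - cov_deriv g \<gamma> (\<lambda>t. \<xi> (\<gamma> t)) 0"
      using ex val[OF ex] by (intro exI[of _ "\<lambda>t. F (x + t *\<^sub>R y)"]) simp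
  next
    fix Y assume "\<exists>\<gamma>. curve_in (F ` V) (F x) (F' x y) \<gamma> \<and> Y = - cov_deriv g \<gamma> (\<lambda>t. \<xi> (\<gamma> t)) 0"
    then show "Y = K" using val by auto
  qed
qed

section \<open>Slices of a parametrization and leaves\<close>

lemma embedded_param_slice:
  fixes F :: "real \<times> complex \<Rightarrow> 'a::euclidean_space"
  assumes "embedded_param (T \<times> B) F F' m" "open B" "s \<in> T"
  shows "embedded_param B (\<lambda>w. F (s, w)) (\<lambda>w d. F' (s, w) (0, d)) m"
proof -
  interpret embedded_param "T \<times> B" F F' m by fact
  have lin: "bounded_linear (\<lambda>w::complex. (0::real, w))"
    by (intro bounded_linear_Pair bounded_linear_ident bounded_linear_zero)
  show ?thesis
  proof
    have "Ck_on n B (\<lambda>w. F ((0, w) + (s, 0)))" for n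
      using smooth assms(3) unfolding smooth_on_def
      by (intro Ck_on_compose_linear[OF assms(2) open_V lin]) auto
    then show "smooth_on B (\<lambda>w. F (s, w))" by (simp add: smooth_on_def)
    show "((\<lambda>w. F (s, w)) has_derivative (\<lambda>d. F' (s, w) (0, d))) (at w)" if "w \<in> B" for w
    proof -
      have "((\<lambda>w. (s, w)) has_derivative (\<lambda>d. (0, d))) (at w)"
        by (auto intro!: derivative_eq_intros)
      from has_derivative_compose[OF this deriv] show ?thesis using that assms(3) by auto
    qed
    show "m * norm (w - w') \<le> norm (F (s, w) - F (s, w'))" if "w \<in> B" "w' \<in> B" for w w'
      using expanding[of "(s, w)" "(s, w')"] that assms(3) by (simp add: norm_Pair)
  qed (use assms m_pos in auto)
qed

text \<open>The first parameter, as a function on the hypersurface, has derivative 0 along every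
  curve in \<open>L\<close>, because tangent vectors of \<open>L\<close> belong to the slice
  directions. It is therefore locally constant on \<open>L\<close>, and constant by
  connectedness.\<close>

lemma integral_surface_in_slice:
  fixes F :: "real \<times> complex \<Rightarrow> C2"
  assumes "embedded_param (T \<times> B) F F' m"
    and \<Delta>: "\<And>x. x \<in> T \<times> B \<Longrightarrow> \<Delta> (F x) = range (\<lambda>d. F' x (0, d))"
    and L: "integral_surface (F ` (T \<times> B)) \<Delta> L"
  obtains s where "s \<in> T" "L \<subseteq> F ` ({s} \<times> B)"
proof -
  interpret embedded_param "T \<times> B" F F' m by fact
  let ?V = "T \<times> B"
  define h where "h = (\<lambda>p. fst (inv_into ?V F p))"
  have hF: "h (F x) = fst x" if "x \<in> ?V" for x using that inj_F by (simp add: h_def)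
  have LM: "L \<subseteq> F ` ?V" and Lne: "L \<noteq> {}" and Lc: "connected L" and Ls: "real_surface L"
    and LT: "\<And>p. p \<in> L \<Longrightarrow> tangent_space L p = \<Delta> p"
    using L by (auto simp: integral_surface_def)
  have along: "((\<lambda>t. h (\<gamma> t)) has_vector_derivative 0) (at 0)"
    if \<gamma>: "curve_in L p X \<gamma>" for \<gamma> p X
  proof -
    have pL: "p \<in> L" using \<gamma> by (auto simp: curve_in_def)
    then obtain x where x: "x \<in> ?V" "p = F x" using LM by blast
    have "curve_in (F ` ?V) (F x) X \<gamma>" using \<gamma> LM x by (auto simp: curve_in_def)
    then show ?thesis
    proof (rule curve_lift[OF x(1)])
      fix c y assume c: "c 0 = x" "(c has_vector_derivative y) (at 0)" "F' x y = X"
        "\<forall>\<^sub>F t in nhds 0. c t \<in> ?V \<and> \<gamma> t = F (c t)"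
      have "X \<in> tangent_space L p" using \<gamma> by (auto simp: tangent_space_def)
      then obtain d where "F' x y = F' x (0, d)" using LT[OF pL] \<Delta>[OF x(1)] x(2) c(3) by auto
      then have "y = (0, d)" using inj_deriv[OF x(1)] by (simp add: inj_eq)
      then have "((\<lambda>t. fst (c t)) has_vector_derivative 0) (at 0)"
        using bounded_linear.has_vector_derivative[OF bounded_linear_fst c(2)] by simp
      moreover have "\<forall>\<^sub>F t in nhds 0. fst (c t) = h (\<gamma> t)"
        using c(4) by eventually_elim (use hF in auto)
      ultimately show ?thesis
        by (rule has_vector_derivative_eventually_eq)
    qed
  qed
  have const: "eventually (\<lambda>q. h p = h q) (at p within L)" if p: "p \<in> L" for p
  proof -
    obtain W and \<Phi> :: "complex \<Rightarrow> C2" where \<Phi>: "regular_param L W \<Phi>" "p \<in> \<Phi> ` W"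
      using Ls p unfolding real_surface_def by blast
    then obtain x0 where x0: "x0 \<in> W" "p = \<Phi> x0" by blast
    have W: "open W" "smooth_on W \<Phi>" "openin (top_of_set L) (\<Phi> ` W)"
      using \<Phi>(1) by (auto simp: regular_param_def)
    obtain G where G: "homeomorphism W (\<Phi> ` W) \<Phi> G" using \<Phi>(1) by (auto simp: regular_param_def)
    obtain d where d: "d > 0" "ball x0 d \<subseteq> W" using W(1) x0(1) open_contains_ball by blast
    have loc: "h (\<Phi> x) = h p" if x: "x \<in> ball x0 d" for x
    proof -
      have seg: "x0 + t *\<^sub>R (x - x0) \<in> W" if "t \<in> {0..1}" for t
      proof -
        have "norm (t *\<^sub>R (x - x0)) \<le> norm (x - x0)"
          using that by (simp add: mult_left_le_one_le)
        also have "\<dots> < d" using x by (simp add: dist_norm norm_minus_commute)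
        finally show ?thesis using d(2) by (auto simp: dist_norm subset_iff)
      qed
      have "((\<lambda>t. h (\<Phi> (x0 + t *\<^sub>R (x - x0)))) has_vector_derivative 0) (at t within {0..1})"
        if t: "t \<in> {0..1}" for t
      proof -
        \<comment> \<open>\<open>along\<close> concerns velocities at time 0, so the segment is
          restarted at its point \<open>y\<close> and the result is shifted back to time
          \<open>t\<close>.\<close>
        define y where "y = x0 + t *\<^sub>R (x - x0)"
        have y: "y \<in> W" using seg[OF t] by (simp add: y_def)
        have D: "(\<Phi> has_derivative frechet_derivative \<Phi> (at y)) (at y)"
          using Ck_on_Suc_derivD(1)[OF W(1) _ y, of 0] W(2) unfolding smooth_on_def by blast
        have line: "((\<lambda>\<tau>. y + \<tau> *\<^sub>R (x - x0)) has_derivative (\<lambda>\<tau>. \<tau> *\<^sub>R (x - x0))) (at 0)"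
          by (auto intro!: derivative_eq_intros)
        have "((\<lambda>\<tau>. \<Phi> (y + \<tau> *\<^sub>R (x - x0))) has_derivative (\<lambda>\<tau>. frechet_derivative \<Phi> (at y) (\<tau> *\<^sub>R (x - x0)))) (at 0)"
          using has_derivative_compose[OF line, of \<Phi>] D by simp
        then have vd: "((\<lambda>\<tau>. \<Phi> (y + \<tau> *\<^sub>R (x - x0))) has_vector_derivative frechet_derivative \<Phi> (at y) (x - x0)) (at 0)"
          using linear_scale[OF has_derivative_linear[OF D]] by (simp add: has_vector_derivative_def)
        obtain d' where d': "d' > 0" "ball y d' \<subseteq> W" using W(1) y open_contains_ball by blast
        define a where "a = d' / (norm (x - x0) + 1)"
        have a: "a > 0" using d' by (simp add: a_def add_nonneg_pos)
        have "\<Phi> (y + \<tau> *\<^sub>R (x - x0)) \<in> L" if "\<bar>\<tau>\<bar> < a" for \<tau>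
        proof -
          have "\<bar>\<tau>\<bar> * norm (x - x0) \<le> \<bar>\<tau>\<bar> * (norm (x - x0) + 1)" by (intro mult_left_mono) auto
          also have "\<dots> < d'"
            using that by (simp add: a_def pos_less_divide_eq add_nonneg_pos)
          finally have "y + \<tau> *\<^sub>R (x - x0) \<in> W" using d'(2) by (auto simp: dist_norm subset_iff)
          then show ?thesis using W(3) openin_imp_subset by blast
        qed
        then have "curve_in L (\<Phi> y) (frechet_derivative \<Phi> (at y) (x - x0)) (\<lambda>\<tau>. \<Phi> (y + \<tau> *\<^sub>R (x - x0)))"
          using a vd by (auto simp: curve_in_def)
        from along[OF this]
        have "((\<lambda>\<tau>. h (\<Phi> (y + \<tau> *\<^sub>R (x - x0)))) has_vector_derivative 0) (at (t - t))" by simp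
        moreover have "((\<lambda>u. u - t) has_derivative (\<lambda>u. u)) (at t)"
          by (auto intro!: derivative_eq_intros)
        ultimately have "((\<lambda>u. h (\<Phi> (y + (u - t) *\<^sub>R (x - x0)))) has_derivative (\<lambda>u. 0)) (at t)"
          unfolding has_vector_derivative_def
          using has_derivative_compose[of "\<lambda>u. u - t" "\<lambda>u. u" t UNIV "\<lambda>\<tau>. h (\<Phi> (y + \<tau> *\<^sub>R (x - x0)))" "\<lambda>u. 0"]
          by simp
        moreover have "y + (u - t) *\<^sub>R (x - x0) = x0 + u *\<^sub>R (x - x0)" for u
          by (simp add: y_def algebra_simps)
        ultimately show ?thesis
          by (simp add: has_vector_derivative_def has_derivative_at_withinI)
      qed
      from has_vector_derivative_zero_constant[OF convex_real_interval(5) this]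
      obtain k where k: "\<And>t. t \<in> {0..1} \<Longrightarrow> h (\<Phi> (x0 + t *\<^sub>R (x - x0))) = k" by blast
      from k[of 0] k[of 1] show ?thesis by (simp add: x0(2))
    qed
    \<comment> \<open>Local constancy is needed in the topology of \<open>L\<close>. It is here that
      the surface chart has to be a homeomorphism onto a relatively open set.\<close>
    have "openin (top_of_set L) (\<Phi> ` ball x0 d)"
    proof -
      have "openin (top_of_set W) (ball x0 d)" using d(2) W(1) by (simp add: openin_open_eq)
      then show ?thesis using homeomorphism_imp_open_map[OF G] openin_trans W(3) by blast
    qed
    then obtain S where S: "open S" "\<Phi> ` ball x0 d = L \<inter> S" unfolding openin_open by blast
    have "p \<in> S" using S(2) x0(2) d(1) by (metis IntD2 centre_in_ball imageI)
    moreover have "h p = h q" if "q \<in> S" "q \<in> L" for q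
    proof -
      obtain x where "x \<in> ball x0 d" "q = \<Phi> x" using \<open>q \<in> S\<close> \<open>q \<in> L\<close> S(2) by blast
      then show ?thesis using loc by simp
    qed
    ultimately show ?thesis using S(1) unfolding eventually_at_topological by blast
  qed
  obtain p0 where p0: "p0 \<in> L" using Lne by blast
  have same: "h p = h p0" if "p \<in> L" for p
    using connected_local_const[OF Lc p0 that, of h] const by simp
  show ?thesis
  proof
    show "h p0 \<in> T" using p0 LM hF by auto
    show "L \<subseteq> F ` ({h p0} \<times> B)"
    proof
      fix p assume p: "p \<in> L"
      then obtain x where x: "x \<in> ?V" "p = F x" using LM by blast
      have "fst x = h p0" using same[OF p] hF[OF x(1)] x(2) by simp
      then show "p \<in> F ` ({h p0} \<times> B)" using x by (cases x) auto
    qed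
  qed
qed

text \<open>Every integral surface lies in a slice and every slice is one, since \<open>B\<close> is
  connected. Slices are comparable only if equal, because \<open>F\<close> is injective and
  \<open>B\<close> is nonempty; so the maximal integral surfaces are the slices.\<close>

lemma leaves_eq_slices:
  fixes F :: "real \<times> complex \<Rightarrow> C2"
  assumes emb: "embedded_param (T \<times> B) F F' m" and B: "open B" "connected B" "B \<noteq> {}"
    and \<Delta>: "\<And>x. x \<in> T \<times> B \<Longrightarrow> \<Delta> (F x) = range (\<lambda>d. F' x (0, d))"
  shows "{L. leaf (F ` (T \<times> B)) \<Delta> L} = {F ` ({s} \<times> B) | s. s \<in> T}"
proof -
  interpret embedded_param "T \<times> B" F F' m by fact
  have int: "integral_surface (F ` (T \<times> B)) \<Delta> (F ` ({s} \<times> B))" if s: "s \<in> T" for s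
  proof -
    interpret sl: embedded_param B "\<lambda>w. F (s, w)" "\<lambda>w d. F' (s, w) (0, d)" m
      by (rule embedded_param_slice[OF emb B(1) s])
    have eq: "F ` ({s} \<times> B) = (\<lambda>w. F (s, w)) ` B" by auto
    have "connected ((\<lambda>w. F (s, w)) ` B)"
      using sl.homeomorphism_F B(2) by (auto simp: homeomorphism_def intro: connected_continuous_image)
    moreover have "real_surface ((\<lambda>w. F (s, w)) ` B)"
      unfolding real_surface_def using sl.regular by blast
    ultimately show ?thesis
      unfolding integral_surface_def eq
      using s B(3) \<Delta> sl.tangent_space_image by auto
  qed
  have disj: "s = s'" if st: "s \<in> T" "s' \<in> T" "F ` ({s} \<times> B) \<subseteq> F ` ({s'} \<times> B)" for s s'
  proof -
    obtain w where w: "w \<in> B" using B(3) by blast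
    then obtain w' where "w' \<in> B" "F (s, w) = F (s', w')" using st(3) by blast
    then show ?thesis using inj_F w st(1,2) by (auto dest: inj_onD)
  qed
  show ?thesis
  proof (intro set_eqI iffI)
    fix L assume "L \<in> {L. leaf (F ` (T \<times> B)) \<Delta> L}"
    then have L: "integral_surface (F ` (T \<times> B)) \<Delta> L"
      and max: "\<And>L'. integral_surface (F ` (T \<times> B)) \<Delta> L' \<Longrightarrow> L \<subseteq> L' \<Longrightarrow> L' = L"
      by (auto simp: leaf_def)
    obtain s where "s \<in> T" "L \<subseteq> F ` ({s} \<times> B)"
      using integral_surface_in_slice[OF emb \<Delta> L] by blast
    then show "L \<in> {F ` ({s} \<times> B) | s. s \<in> T}" using max[OF int] by blast
  next
    fix L assume "L \<in> {F ` ({s} \<times> B) | s. s \<in> T}"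
    then obtain s where s: "s \<in> T" "L = F ` ({s} \<times> B)" by blast
    have "L' = L" if L': "integral_surface (F ` (T \<times> B)) \<Delta> L'" "L \<subseteq> L'" for L'
    proof -
      obtain s' where s': "s' \<in> T" "L' \<subseteq> F ` ({s'} \<times> B)"
        using integral_surface_in_slice[OF emb \<Delta> L'(1)] by blast
      then have "s = s'" using disj[OF s(1) s'(1)] s(2) L'(2) by blast
      then show ?thesis using s s' L'(2) by blast
    qed
    then show "L \<in> {L. leaf (F ` (T \<times> B)) \<Delta> L}" using int[OF s(1)] s(2) by (simp add: leaf_def)
  qed
qed

section \<open>Hermitian forms\<close>

lemma exhaust_3_mod: "i = k \<or> i = k + 1 \<or> i = k + 2" for i k :: 3
  using exhaust_3[of i] exhaust_3[of k] by auto

lemma neq_3_mod: "k + 1 \<noteq> k" "k + 2 \<noteq> k" "k + 2 \<noteq> k + 1" "k \<noteq> k + 1" "k \<noteq> k + 2" "k + 1 \<noteq> k + 2" for k :: 3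
  using exhaust_3[of k] by auto

lemma vec_eq_3_mod: "x = y \<longleftrightarrow> x $ k = y $ k \<and> x $ (k + 1) = y $ (k + 1) \<and> x $ (k + 2) = y $ (k + 2)"
  for x y :: "'a^3"
proof
  assume c: "x $ k = y $ k \<and> x $ (k + 1) = y $ (k + 1) \<and> x $ (k + 2) = y $ (k + 2)"
  have "x $ i = y $ i" for i
    using exhaust_3_mod[of i k] c by (elim disjE) simp_all
  then show "x = y" by (simp add: vec_eq_iff)
qed simp

lemma scaleR_eq_vector_scale: "c *\<^sub>R x = complex_of_real c *s x" for x :: "complex^'n"
proof (unfold vec_eq_iff, intro allI)
  show "(c *\<^sub>R x) $ i = (complex_of_real c *s x) $ i" for i
    unfolding vector_scaleR_component vector_smult_component by (simp add: scaleR_conv_of_real)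
qed

lemma vector_scale_scaleR: "(r *\<^sub>R a) *s x = r *\<^sub>R (a *s x)" for x :: "complex^'n"
  by (simp add: scaleR_eq_vector_scale vector_smult_assoc) (simp add: scaleR_conv_of_real)

lemma bounded_linear_vector_scale: "bounded_linear (\<lambda>x::complex^3. a *s x)"
  by (intro linear_conv_bounded_linear[THEN iffD1] linearI)
     (simp_all add: vector_add_ldistrib scaleR_eq_vector_scale vector_smult_assoc mult.commute)

locale hermitian =
  fixes h :: "complex^3 \<Rightarrow> complex^3 \<Rightarrow> complex"
  assumes hermitian_form: "hermitian_form h"
begin

lemma h_add_left: "h (x + y) z = h x z + h y z"
  and h_scale_left: "h (c *s x) y = c * h x y"
  and h_cnj: "h y x = cnj (h x y)"
  using hermitian_form unfolding hermitian_form_def by blast+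

lemma h_add_right: "h z (x + y) = h z x + h z y"
  by (metis h_add_left h_cnj complex_cnj_add)

lemma h_scale_right: "h x (c *s y) = cnj c * h x y"
  by (metis h_scale_left h_cnj complex_cnj_mult complex_cnj_cnj)

lemma h_minus_left: "h (- x) y = - h x y"
  using h_scale_left[of "-1" x y] by simp

lemma h_minus_right: "h x (- y) = - h x y"
  using h_scale_right[of x "-1" y] by simp

lemma h_diff_left: "h (x - y) z = h x z - h y z"
  using h_add_left[of x "- y" z] by (simp add: h_minus_left)

lemma h_diff_right: "h z (x - y) = h z x - h z y"
  using h_add_right[of z x "- y"] by (simp add: h_minus_right)

lemma h_scaleR_left: "h (c *\<^sub>R x) y = of_real c * h x y"
  by (simp add: scaleR_eq_vector_scale h_scale_left)

lemma h_scaleR_right: "h x (c *\<^sub>R y) = of_real c * h x y"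
  by (simp add: scaleR_eq_vector_scale h_scale_right)

lemmas h_simps = h_add_left h_add_right h_scale_left h_scale_right h_minus_left h_minus_right
  h_diff_left h_diff_right h_scaleR_left h_scaleR_right

lemma h_zero [simp]: "h 0 x = 0" "h x 0 = 0"
  using h_scale_left[of 0 0 x] h_scale_right[of x 0 0] by auto

lemma bounded_bilinear_h: "bounded_bilinear h"
proof -
  have "h (c *\<^sub>R x) y = c *\<^sub>R h x y" "h x (c *\<^sub>R y) = c *\<^sub>R h x y" for c x y
    unfolding h_scaleR_left h_scaleR_right by (simp_all add: scaleR_conv_of_real)
  then have "bilinear h"
    unfolding bilinear_def by (auto intro!: linearI simp: h_add_left h_add_right)
  then show ?thesis by (simp add: bilinear_conv_bounded_bilinear)
qed

lemma has_vector_derivative_h: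
  assumes "(f has_vector_derivative f') (at t)" "(g has_vector_derivative g') (at t)"
  shows "((\<lambda>t. h (f t) (g t)) has_vector_derivative h (f t) g' + h f' (g t)) (at t)"
  by (rule bounded_bilinear.has_vector_derivative[OF bounded_bilinear_h assms])

lemma h_self: "h x x = of_real (ip h x x)"
  using h_cnj[of x x] by (simp add: ip_def complex_eq_iff)

lemma ip_ii: "ip h x (\<i> *s y) = Im (h x y)"
  by (simp add: ip_def h_simps)

lemma horizontal_iff: "horizontal h z X \<longleftrightarrow> h X z = 0"
  by (simp add: horizontal_def ip_ii complex_eq_iff) (simp add: ip_def)

text \<open>If \<open>y\<close> were negative too, the orthogonal complex lines of \<open>x\<close>
  and \<open>y\<close> would form a negative definite space of real dimension 4. The basis vectors
  with plus sign span a positive definite space of dimension 4. Since 4 + 4 exceeds 6, the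
  eight-parameter map \<open>f\<close> has a nonzero kernel element, whose parts \<open>p\<close>
  and \<open>- q\<close> agree although their squares have opposite signs.\<close>

lemma ip_nonneg_of_signature:
  assumes "if \<epsilon> = 1 then positive_definite (ip h) else has_signature (ip h) 2 4"
    and "ip h x x < 0" "h y x = 0"
  shows "ip h y y \<ge> 0"
proof (cases "\<epsilon> = 1")
  case True
  then show ?thesis using assms(1) by (cases "y = 0") (auto simp: positive_definite_def ip_def intro: less_imp_le)
next
  case False
  then obtain u :: "nat \<Rightarrow> complex^3" where u: "\<And>i j. i < 6 \<Longrightarrow> j < 6 \<Longrightarrow>
      ip h (u i) (u j) = (if i \<noteq> j then 0 else if i < 2 then - 1 else 1)"
    using assms(1) by (auto simp: has_signature_def)
  show ?thesis
  proof (rule ccontr)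
    assume neg: "\<not> ip h y y \<ge> 0"
    define f :: "(complex \<times> complex) \<times> (real \<times> real) \<times> real \<times> real \<Rightarrow> complex^3"
      where "f = (\<lambda>((a, c), (t2, t3), t4, t5).
       a *s x + c *s y + (t2 *\<^sub>R u 2 + t3 *\<^sub>R u 3 + t4 *\<^sub>R u 4 + t5 *\<^sub>R u 5))"
    have "linear f"
      by (intro linearI) (auto simp: f_def vector_sadd_rdistrib vector_scale_scaleR scaleR_add_right
          scaleR_add_left)
    have "\<not> inj f"
    proof
      assume "inj f"
      then have "dim (range f) = dim (UNIV :: ((complex \<times> complex) \<times> (real \<times> real) \<times> real \<times> real) set)"
        using dim_image_eq[OF \<open>linear f\<close>, of UNIV] by simp
      then show False using dim_subset_UNIV[of "range f"] by (simp add: dim_UNIV)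
    qed
    then obtain v where v: "v \<noteq> 0" "f v = 0"
      using linear_injective_0[OF \<open>linear f\<close>] by blast
    obtain a c t2 t3 t4 t5 where veq: "v = ((a, c), (t2, t3), t4, t5)"
      by (metis surj_pair)
    define p where "p = a *s x + c *s y"
    define q where "q = t2 *\<^sub>R u 2 + t3 *\<^sub>R u 3 + t4 *\<^sub>R u 4 + t5 *\<^sub>R u 5"
    have pq: "p = - q" using v(2) by (simp add: veq f_def p_def q_def add_eq_0_iff2)
    have hxy: "h x y = 0" using assms(3) h_cnj[of y x] by simp
    have "h p p = a * cnj a * h x x + c * cnj c * h y y"
      by (simp add: p_def h_simps hxy assms(3))
    then have "ip h p p = (cmod a)\<^sup>2 * ip h x x + (cmod c)\<^sup>2 * ip h y y"
      by (simp add: ip_def complex_norm_square[symmetric] mult.commute[of "cnj _"])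
    moreover have "ip h q q = t2\<^sup>2 + t3\<^sup>2 + t4\<^sup>2 + t5\<^sup>2"
    proof -
      \<comment> \<open>The list pads the coefficients with zeros in the two negative positions, so
        that one index serves both coefficients and vectors.\<close>
      have "ip h q q = (\<Sum>i\<in>{2,3,4,5}. \<Sum>j\<in>{2,3,4,5}. [0,0,t2,t3,t4,t5]!i * [0,0,t2,t3,t4,t5]!j * ip h (u i) (u j))"
        by (simp add: q_def ip_def h_simps algebra_simps)
      then show ?thesis by (simp add: u power2_eq_square)
    qed
    moreover have "ip h p p = ip h q q" by (simp add: pq ip_def h_simps)
    moreover have "(cmod a)\<^sup>2 * ip h x x \<le> 0" "(cmod c)\<^sup>2 * ip h y y \<le> 0"
      using assms(2) neg by (auto intro: mult_nonneg_nonpos)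
    moreover have "t2\<^sup>2 \<ge> 0" "t3\<^sup>2 \<ge> 0" "t4\<^sup>2 \<ge> 0" "t5\<^sup>2 \<ge> 0" by auto
    ultimately have "(cmod a)\<^sup>2 * ip h x x = 0" "(cmod c)\<^sup>2 * ip h y y = 0"
      "t2\<^sup>2 = 0" "t3\<^sup>2 = 0" "t4\<^sup>2 = 0" "t5\<^sup>2 = 0" by linarith+
    then have "v = 0" using assms(2) neg by (simp add: veq zero_prod_def)
    then show False using v(1) by simp
  qed
qed

text \<open>Pairing with the three vectors recovers the coefficients of a combination. The
  combination map is thus injective from a finite-dimensional space to itself, hence onto.\<close>

lemma orthogonal_basis_expansion:
  assumes "h x y = 0" "h x z = 0" "h y z = 0" "h x x \<noteq> 0" "h y y \<noteq> 0" "h z z \<noteq> 0"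
  shows "w = (h w x / h x x) *s x + (h w y / h y y) *s y + (h w z / h z z) *s z"
proof -
  have o: "h y x = 0" "h z x = 0" "h z y = 0"
    using assms(1-3) h_cnj by (metis complex_cnj_zero)+
  define f where "f = (\<lambda>c::complex^3. (c $ 1) *s x + (c $ 2) *s y + (c $ 3) *s z)"
  have lin: "linear f"
    by (intro linearI) (auto simp: f_def vector_sadd_rdistrib vector_scale_scaleR scaleR_add_right)
  have "inj f"
    unfolding linear_injective_0[OF lin]
  proof (intro allI impI)
    fix c assume c: "f c = 0"
    have "h (f c) x = 0" "h (f c) y = 0" "h (f c) z = 0" by (simp_all add: c)
    then have "c $ 1 = 0" "c $ 2 = 0" "c $ 3 = 0"
      using assms o by (simp_all add: f_def h_simps)
    then show "c = 0" by (simp add: vec_eq_iff forall_3)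
  qed
  then have "surj f" using lin linear_injective_imp_surjective by blast
  then obtain c where c: "w = f c" by blast
  have "h w x = c $ 1 * h x x" "h w y = c $ 2 * h y y" "h w z = c $ 3 * h z z"
    using assms o by (simp_all add: c f_def h_simps)
  then show ?thesis using assms(4-6) by (simp add: c f_def)
qed

end

lemma has_vector_derivative_divide_complex:
  fixes f g :: "real \<Rightarrow> complex"
  assumes f: "(f has_vector_derivative f') (at t)" and g: "(g has_vector_derivative g') (at t)"
    and "g t \<noteq> 0"
  shows "((\<lambda>t. f t / g t) has_vector_derivative (f' * g t - f t * g') / (g t)\<^sup>2) (at t)"
proof -
  have "((\<lambda>t. f t / g t) has_derivative
      (\<lambda>x. - f t * (inverse (g t) * (x *\<^sub>R g') * inverse (g t)) + (x *\<^sub>R f') / g t)) (at t)"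
    by (rule has_derivative_divide[OF f[unfolded has_vector_derivative_def]
          g[unfolded has_vector_derivative_def] assms(3)])
  moreover have "- f t * (inverse (g t) * (x *\<^sub>R g') * inverse (g t)) + (x *\<^sub>R f') / g t =
      x *\<^sub>R ((f' * g t - f t * g') / (g t)\<^sup>2)" for x :: real
    using assms(3) by (simp add: scaleR_conv_of_real field_simps power2_eq_square)
  ultimately show ?thesis by (simp add: has_vector_derivative_def)
qed

lemma has_vector_derivative_vec_nth:
  "(f has_vector_derivative f') F \<Longrightarrow> ((\<lambda>t. f t $ i) has_vector_derivative f' $ i) F"
  by (rule bounded_linear.has_vector_derivative[OF bounded_linear_vec_nth])

lemma has_vector_derivative_Pair:
  assumes "(f has_vector_derivative f') (at t)" "(g has_vector_derivative g') (at t)"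
  shows "((\<lambda>t. (f t, g t)) has_vector_derivative (f', g')) (at t)"
  using has_derivative_Pair[OF assms[unfolded has_vector_derivative_def]]
  by (simp add: has_vector_derivative_def)

section \<open>Affine charts\<close>

text \<open>\<open>pt k u\<close> is the representative with \<open>k\<close>-th coordinate 1 of the
  point with coordinates \<open>u\<close>, and \<open>hat k\<close> is the linear part of this
  affine section of the projection. With them the metric coefficients become rational expressions in
  products of \<open>h\<close>.\<close>

definition hat :: "3 \<Rightarrow> C2 \<Rightarrow> complex^3" where
  "hat k x = (\<chi> i. if i = k then 0 else if i = k + 1 then fst x else snd x)"

definition pt :: "3 \<Rightarrow> C2 \<Rightarrow> complex^3" where
  "pt k u = axis k 1 + hat k u"

definition cscale :: "complex \<Rightarrow> C2 \<Rightarrow> C2" where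
  "cscale a x = (a * fst x, a * snd x)"

lemma hat_nth [simp]: "hat k x $ k = 0" "hat k x $ (k + 1) = fst x" "hat k x $ (k + 2) = snd x"
  using neq_3_mod[of k] by (simp_all add: hat_def)

lemma pt_nth [simp]: "pt k x $ k = 1" "pt k x $ (k + 1) = fst x" "pt k x $ (k + 2) = snd x"
  using neq_3_mod[of k] by (simp_all add: pt_def axis_def)

lemma hat_simps:
  "hat k (x + y) = hat k x + hat k y" "hat k (x - y) = hat k x - hat k y"
  "hat k (cscale a x) = a *s hat k x" "hat k (r *\<^sub>R x) = r *\<^sub>R hat k x"
  by (simp_all add: vec_eq_3_mod[of _ _ k] cscale_def)

lemma bounded_linear_hat: "bounded_linear (hat k)"
  by (intro linear_conv_bounded_linear[THEN iffD1] linearI) (simp_all add: hat_simps)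

lemma vec_eq_pt_hat: "w = w $ k *s pt k u + hat k (w $ (k + 1) - w $ k * fst u, w $ (k + 2) - w $ k * snd u)"
  by (simp add: vec_eq_3_mod[of _ _ k])

lemma proj_eq: "proj z = range (\<lambda>c. c *s z)"
  by (simp add: proj_def vec.span_singleton)

lemma chart_proj:
  assumes "z $ k \<noteq> 0"
  shows "chart k (proj z) = (z $ (k + 1) / z $ k, z $ (k + 2) / z $ k)"
  unfolding chart_def proj_eq
proof (rule the_equality)
  show "\<exists>z'\<in>range (\<lambda>c. c *s z). z' $ k \<noteq> 0 \<and>
      (z $ (k + 1) / z $ k, z $ (k + 2) / z $ k) = (z' $ (k + 1) / z' $ k, z' $ (k + 2) / z' $ k)"
    using assms by (intro bexI[of _ "1 *s z"] rangeI) (simp add: assms)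
qed (use assms in auto)

lemma chart_proj_pt [simp]: "chart k (proj (pt k u)) = u"
  by (simp add: chart_proj)

lemma chart_proj_eqD:
  assumes "z $ k \<noteq> 0" "z' $ k \<noteq> 0" "chart k (proj z) = chart k (proj z')"
  shows "z' = (z' $ k / z $ k) *s z"
  using assms by (simp add: vec_eq_3_mod[of _ _ k] chart_proj field_simps)

lemma chart_proj_scale: "c \<noteq> 0 \<Longrightarrow> z $ k \<noteq> 0 \<Longrightarrow> chart k (proj (c *s z)) = chart k (proj z)"
  by (simp add: chart_proj)

lemma has_derivative_chart_proj:
  assumes z: "z $ k \<noteq> 0"
  shows "((\<lambda>y. chart k (proj y)) has_derivative
     (\<lambda>X. ((X $ (k + 1) * z $ k - z $ (k + 1) * X $ k) / (z $ k)\<^sup>2,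
           (X $ (k + 2) * z $ k - z $ (k + 2) * X $ k) / (z $ k)\<^sup>2))) (at z)"
proof (rule has_derivative_transform_within_open)
  have "((\<lambda>y. y $ i / y $ k) has_derivative (\<lambda>X. (X $ i * z $ k - z $ i * X $ k) / (z $ k)\<^sup>2)) (at z)" for i
  proof -
    have "((\<lambda>y. y $ i) has_derivative (\<lambda>X. X $ i)) (at z)" for i
      by (rule bounded_linear_imp_has_derivative[OF bounded_linear_vec_nth])
    from has_derivative_divide[OF this this z]
    have "((\<lambda>y. y $ i / y $ k) has_derivative (\<lambda>X. - (z $ i) * (inverse (z $ k) * X $ k * inverse (z $ k)) + X $ i / z $ k)) (at z)" .
    moreover have "- (z $ i) * (inverse (z $ k) * X $ k * inverse (z $ k)) + X $ i / z $ k =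
        (X $ i * z $ k - z $ i * X $ k) / (z $ k)\<^sup>2" for X
      using z by (simp add: field_simps power2_eq_square)
    ultimately show ?thesis by simp
  qed
  from has_derivative_Pair[OF this this]
  show "((\<lambda>y. (y $ (k + 1) / y $ k, y $ (k + 2) / y $ k)) has_derivative
     (\<lambda>X. ((X $ (k + 1) * z $ k - z $ (k + 1) * X $ k) / (z $ k)\<^sup>2,
           (X $ (k + 2) * z $ k - z $ (k + 2) * X $ k) / (z $ k)\<^sup>2))) (at z)" .
  have "continuous_on UNIV (\<lambda>y::complex^3. y $ k)"
    by (rule linear_continuous_on[OF bounded_linear_vec_nth])
  then have "open ((\<lambda>y::complex^3. y $ k) -` (- {0}))" by (intro open_vimage) auto
  then show "open {y::complex^3. y $ k \<noteq> 0}" by (simp add: vimage_def)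
qed (use z in \<open>auto simp: chart_proj\<close>)

lemma push_eq:
  assumes "z $ k \<noteq> 0"
  shows "push k z X = ((X $ (k + 1) * z $ k - z $ (k + 1) * X $ k) / (z $ k)\<^sup>2,
           (X $ (k + 2) * z $ k - z $ (k + 2) * X $ k) / (z $ k)\<^sup>2)"
  unfolding push_def frechet_derivative_at[OF has_derivative_chart_proj[OF assms], symmetric] ..

lemma has_derivative_chart_proj_push:
  "z $ k \<noteq> 0 \<Longrightarrow> ((\<lambda>y. chart k (proj y)) has_derivative push k z) (at z)"
  unfolding push_def using has_derivative_chart_proj[of z k]
  by (auto simp flip: frechet_derivative_works intro: differentiableI)

context
  fixes k :: 3 and z :: "complex^3"
  assumes z: "z $ k \<noteq> 0"
begin

lemma push_self: "push k z z = 0"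
  using z by (simp add: push_eq zero_prod_def)

lemma push_add: "push k z (X + Y) = push k z X + push k z Y"
  using z by (simp add: push_eq add_divide_distrib[symmetric] algebra_simps)

lemma push_scale: "push k z (c *s X) = cscale c (push k z X)"
  using z by (simp add: push_eq cscale_def algebra_simps)

lemma push_scaleR: "push k z (r *\<^sub>R X) = r *\<^sub>R push k z X"
  unfolding scaleR_eq_vector_scale push_scale by (simp add: cscale_def scaleR_conv_of_real prod_eq_iff)

lemma push_J: "push k z (\<i> *s X) = J (push k z X)"
  by (simp add: push_scale cscale_def J_def)

lemma push_minus: "push k z (- X) = - push k z X"
  using push_scaleR[of "-1" X] by simp

lemma push_diff: "push k z (X - Y) = push k z X - push k z Y"
  using push_add[of X "- Y"] by (simp add: push_minus)

text \<open>The projection is homogeneous of degree 0. A common factor of base point and vector,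
  such as \<open>e^(i \<theta>) \<sigma>\<close>, is therefore lost.\<close>

lemma push_scale_base: "c \<noteq> 0 \<Longrightarrow> push k (c *s z) (c *s X) = push k z X"
  using z by (simp add: push_eq power2_eq_square divide_simps) (simp add: algebra_simps)

lemma hat_push: "hat k (push k z X) = (1 / z $ k) *s (X - (X $ k / z $ k) *s z)"
proof -
  have "(a * z $ k - b * X $ k) / (z $ k)\<^sup>2 = (1 / z $ k) * (a - X $ k / z $ k * b)" for a b
    using z by (simp add: field_simps power2_eq_square)
  then show ?thesis using z by (simp add: push_eq vec_eq_3_mod[of _ _ k] diff_divide_distrib)
qed

lemma pt_chart: "pt k (chart k (proj z)) = (1 / z $ k) *s z"
  using z by (simp add: chart_proj vec_eq_3_mod[of _ _ k])

lemma push_eq_0D: "push k z X = 0 \<Longrightarrow> X = (X $ k / z $ k) *s z"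
  using z by (simp add: push_eq vec_eq_3_mod[of _ _ k] zero_prod_def eq_divide_eq mult.commute)

end

lemma push_pt_hat [simp]: "push k (pt k u) (hat k x) = x"
  by (simp add: push_eq)

section \<open>The submersion metric\<close>

context hermitian
begin

text \<open>Two points of the quadric on one complex line differ by a factor \<open>l\<close> with
  \<open>l * cnj l = 1\<close>, and horizontal lifts of one vector differ by the same factor. Their
  product is unaffected, so the description has a unique value.\<close>

lemma submersion_metric_horizontal:
  assumes c: "c \<noteq> 0" and z: "ip h z z = c" "z $ k \<noteq> 0" and X: "h X z = 0" and Y: "h Y z = 0"
  shows "submersion_metric h c k (chart k (proj z)) (push k z X) (push k z Y) = ip h X Y"
  unfolding submersion_metric_def
proof (rule the_equality)
  show "\<exists>z' X' Y'. z' \<in> quadric h c \<and> z' $ k \<noteq> 0 \<and> chart k (proj z') = chart k (proj z) \<and>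
      horizontal h z' X' \<and> horizontal h z' Y' \<and> push k z' X' = push k z X \<and> push k z' Y' = push k z Y \<and>
      ip h X Y = ip h X' Y'"
    using assms by (auto simp: quadric_def horizontal_iff)
next
  fix a
  assume "\<exists>z' X' Y'. z' \<in> quadric h c \<and> z' $ k \<noteq> 0 \<and> chart k (proj z') = chart k (proj z) \<and>
      horizontal h z' X' \<and> horizontal h z' Y' \<and> push k z' X' = push k z X \<and> push k z' Y' = push k z Y \<and>
      a = ip h X' Y'"
  then obtain z' X' Y' where z': "ip h z' z' = c" "z' $ k \<noteq> 0" "chart k (proj z') = chart k (proj z)"
    and X': "h X' z' = 0" "push k z' X' = push k z X" and Y': "h Y' z' = 0" "push k z' Y' = push k z Y"
    and a: "a = ip h X' Y'"
    by (auto simp: quadric_def horizontal_iff)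
  define l where "l = z' $ k / z $ k"
  have l: "l \<noteq> 0" "z' = l *s z" using chart_proj_eqD[OF z(2) z'(2)] z' z by (auto simp: l_def)
  have hz: "h z z = of_real c" using h_self[of z] z(1) by simp
  have "h z' z' = l * cnj l * h z z" by (simp add: l(2) h_simps)
  then have ll: "l * cnj l = 1" using h_self[of z'] z'(1) hz c by simp
  have eq: "U' = l *s U" if U: "h U z = 0" and U': "h U' z' = 0" "push k z' U' = push k z U" for U U'
  proof -
    \<comment> \<open>The difference is vertical, being in the kernel of \<open>push\<close>, and
      also horizontal; \<open>h z' z'\<close> is nonzero, so it vanishes.\<close>
    have "push k z' (U' - l *s U) = 0"
      using push_scale_base[OF z(2) l(1), of U] U'(2) l(2) push_diff[OF z'(2)] by simp
    then obtain m where m: "U' - l *s U = m *s z'" using push_eq_0D[OF z'(2)] by blast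
    have "m * h z' z' = h (U' - l *s U) z'" by (simp add: m h_simps)
    also have "\<dots> = 0" using U U' by (simp add: h_simps l(2))
    finally have "m = 0" using c h_self[of z'] z'(1) by simp
    then show ?thesis using m by simp
  qed
  have "h X' Y' = l * cnj l * h X Y"
    using eq[OF X X'] eq[OF Y Y'] by (simp add: h_simps)
  then show "a = ip h X Y" using ll a by (simp add: ip_def)
qed

text \<open>The Fubini-Study formula for arbitrary representatives: \<open>c / ip h z z > 0\<close>
  says that a positive multiple of \<open>z\<close> lies on the quadric, and the subtracted term
  removes the vertical components.\<close>

lemma submersion_metric_push:
  assumes z: "z $ k \<noteq> 0" and pos: "c / ip h z z > 0"
  shows "submersion_metric h c k (chart k (proj z)) (push k z X) (push k z Y) =
     c / ip h z z * Re (h X Y - h X z * h z Y / h z z)"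
proof -
  define t where "t = sqrt (c / ip h z z)"
  have t: "t > 0" "t\<^sup>2 = c / ip h z z" using pos by (auto simp: t_def)
  have N: "ip h z z \<noteq> 0" "c \<noteq> 0" "h z z \<noteq> 0" using pos by (auto simp: h_self)
  define H where "H = (\<lambda>U. U - (h U z / h z z) *s z)"
  define lam where "lam = complex_of_real t"
  have lam: "lam \<noteq> 0" "lam * cnj lam = of_real (c / ip h z z)"
    using t by (simp_all add: lam_def flip: t(2)) (simp add: power2_eq_square)
  have H0: "h (H U) z = 0" for U using N by (simp add: H_def h_simps)
  have "h (lam *s z) (lam *s z) = lam * cnj lam * h z z" by (simp add: h_simps)
  also have "\<dots> = of_real (c / ip h z z) * of_real (ip h z z)"
    unfolding lam(2) h_self[of z] ..
  finally have "ip h (lam *s z) (lam *s z) = c"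
    using N(1) by (simp add: ip_def[of h "lam *s z"])
  moreover have "push k (lam *s z) (lam *s H U) = push k z U" for U
    unfolding push_scale_base[OF z lam(1)] H_def
    by (simp add: push_diff[OF z] push_scale[OF z] push_self[OF z] cscale_def zero_prod_def)
  moreover have "h (lam *s H U) (lam *s z) = 0" for U by (simp add: h_simps H0)
  moreover have "(lam *s z) $ k \<noteq> 0" using z lam by simp
  ultimately have "submersion_metric h c k (chart k (proj z)) (push k z X) (push k z Y) =
      ip h (lam *s H X) (lam *s H Y)"
    using submersion_metric_horizontal[OF N(2), of "lam *s z" k "lam *s H X" "lam *s H Y"]
      chart_proj_scale[OF lam(1) z] by simp
  also have "\<dots> = Re (lam * cnj lam * h (H X) (H Y))" by (simp add: ip_def h_simps algebra_simps)
  also have "h (H X) (H Y) = h (H X) Y"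
    by (simp add: fun_cong[OF H_def, of Y] h_simps H0)
  also have "\<dots> = h X Y - h X z * h z Y / h z z" by (simp add: H_def h_simps)
  finally show ?thesis unfolding lam(2) by simp
qed

end

section \<open>The Levi-Civita connection of the submersion metric\<close>

text \<open>The Koszul formula for the metric coefficients after every product has been replaced by
  a complex number: \<open>a\<close>, \<open>b\<close>, \<open>d\<close> are the products of
  \<open>x\<close> with \<open>y\<close>, \<open>x\<close> with \<open>z\<close>, \<open>y\<close>
  with \<open>z\<close>; \<open>A\<close>, \<open>B\<close>, \<open>C\<close> those of
  \<open>x\<close>, \<open>y\<close>, \<open>z\<close> with the point \<open>q\<close>; and
  \<open>Q\<close> is the inverse of \<open>h q q\<close>. \<open>G\<close> is the derivative of a
  coefficient, the right-hand side the metric product of the claimed symbol with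
  \<open>z\<close>.\<close>

lemma christoffel_identity:
  fixes a b d A B C :: complex and n c :: real
  defines "Q \<equiv> complex_of_real n"
  defines "G \<equiv> \<lambda>yz Y Z yx xz X. - (yz * (X + cnj X) * Q\<^sup>2) - (yx * cnj Z + Y * xz) * Q\<^sup>2
     + 2 * (Y * cnj Z * (X + cnj X) * Q^3)"
  shows "(c * Re (G d B C (cnj a) b A) + c * Re (G b A C a d B) - c * Re (G a A B b (cnj d) C)) / 2 =
     c * n * Re (- (A * Q * d + B * Q * b) - (- (A * Q * B + B * Q * A)) * cnj C * Q)"
  unfolding G_def Q_def
  by (simp add: power2_eq_square power3_eq_cube algebra_simps add_divide_distrib diff_divide_distrib)

context hermitian
begin

lemma has_derivative_h_pt:
  fixes k :: 3
  defines "q \<equiv> pt k"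
  assumes "h (q u) (q u) \<noteq> 0"
  shows "((\<lambda>p. c * Re (h y z / h (q p) (q p) - h y (q p) * h (q p) z / (h (q p) (q p))\<^sup>2)) has_derivative
    (\<lambda>x. c * Re (- (h y z * (h (hat k x) (q u) + h (q u) (hat k x)) * (inverse (h (q u) (q u)))\<^sup>2)
       - (h y (hat k x) * h (q u) z + h y (q u) * h (hat k x) z) * (inverse (h (q u) (q u)))\<^sup>2
       + 2 * (h y (q u) * h (q u) z * (h (hat k x) (q u) + h (q u) (hat k x)) * (inverse (h (q u) (q u))) ^ 3)))) (at u)"
proof -
  have q: "(q has_derivative hat k) (at u)"
    unfolding q_def pt_def
    by (auto intro!: derivative_eq_intros bounded_linear_imp_has_derivative[OF bounded_linear_hat])
  note hd = bounded_bilinear.FDERIV[OF bounded_bilinear_h]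
  have yq: "((\<lambda>p. h y (q p)) has_derivative (\<lambda>x. h y (hat k x))) (at u)"
    using hd[OF has_derivative_const q, of y] by simp
  have qz: "((\<lambda>p. h (q p) z) has_derivative (\<lambda>x. h (hat k x) z)) (at u)"
    using hd[OF q has_derivative_const, of z] by simp
  have qq: "((\<lambda>p. h (q p) (q p)) has_derivative (\<lambda>x. h (q u) (hat k x) + h (hat k x) (q u))) (at u)"
    by (rule hd[OF q q])
  have i: "((\<lambda>p. inverse (h (q p) (q p))) has_derivative
      (\<lambda>x. - (inverse (h (q u) (q u)) * (h (q u) (hat k x) + h (hat k x) (q u)) * inverse (h (q u) (q u))))) (at u)"
    by (rule Deriv.has_derivative_inverse[OF assms(2) qq])
  let ?i = "inverse (h (q u) (q u))"
  let ?H = "\<lambda>x. h (q u) (hat k x) + h (hat k x) (q u)"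
  have "((\<lambda>p. c * Re (h y z * inverse (h (q p) (q p)) -
         (h y (q p) * h (q p) z) * (inverse (h (q p) (q p)) * inverse (h (q p) (q p))))) has_derivative
    (\<lambda>x. c * Re (h y z * - (?i * ?H x * ?i) - ((h y (q u) * h (q u) z) *
        (?i * - (?i * ?H x * ?i) + - (?i * ?H x * ?i) * ?i) +
        (h y (q u) * h (hat k x) z + h y (hat k x) * h (q u) z) * (?i * ?i))))) (at u)"
    by (intro has_derivative_mult_right bounded_linear.has_derivative[OF bounded_linear_Re]
        has_derivative_diff has_derivative_mult[OF has_derivative_mult has_derivative_mult] yq qz i)
  then show ?thesis
    by (rule has_derivative_eq_rhs[OF has_derivative_transform_within_open[OF _ open_UNIV]])
       (auto simp: divide_inverse power2_eq_square power3_eq_cube algebra_simps fun_eq_iff)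
qed

text \<open>As the metric is Kaehler and the coordinates are holomorphic, the symbol is complex
  bilinear in \<open>x\<close> and \<open>y\<close>. Nondegeneracy of \<open>h\<close> is what makes
  the metric determine it.\<close>

lemma christoffel_submersion_metric:
  fixes k :: 3 and u x y :: C2
  assumes nondeg: "\<And>x. (\<And>y. h x y = 0) \<Longrightarrow> x = 0"
    and pos: "c / ip h (pt k u) (pt k u) > 0"
  defines "q \<equiv> pt k u"
  shows "christoffel (submersion_metric h c k) u x y =
    - (cscale (h (hat k x) q / h q q) y + cscale (h (hat k y) q / h q q) x)"
proof -
  let ?g = "submersion_metric h c k"
  define n where "n = 1 / ip h q q"
  have N: "ip h q q \<noteq> 0" "h q q \<noteq> 0" using pos by (auto simp: q_def h_self)
  have inv: "inverse (h q q) = of_real n" by (simp add: h_self n_def inverse_eq_divide)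
  have g: "?g p y z = c * Re (h (hat k y) (hat k z) / h (pt k p) (pt k p) -
      h (hat k y) (pt k p) * h (pt k p) (hat k z) / (h (pt k p) (pt k p))\<^sup>2)"
    if p: "c / ip h (pt k p) (pt k p) > 0" for p y z
  proof -
    have "?g p y z = c / ip h (pt k p) (pt k p) * Re (h (hat k y) (hat k z) -
        h (hat k y) (pt k p) * h (pt k p) (hat k z) / h (pt k p) (pt k p))"
      using submersion_metric_push[of "pt k p" k c "hat k y" "hat k z"] p by simp
    also have "\<dots> = c * Re (of_real (1 / ip h (pt k p) (pt k p)) * (h (hat k y) (hat k z) -
        h (hat k y) (pt k p) * h (pt k p) (hat k z) / h (pt k p) (pt k p)))"
    proof -
      have "Re (complex_of_real m * W) = m * Re W" for m W by simp
      then show ?thesis by (simp only: mult.assoc[symmetric]) simp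
    qed
    finally show ?thesis by (simp add: h_self[of "pt k p"] algebra_simps power2_eq_square)
  qed
  have cont: "continuous_on UNIV (\<lambda>p. ip h (pt k p) (pt k p))"
  proof -
    have "continuous_on UNIV (\<lambda>p. pt k p)"
      unfolding pt_def by (intro continuous_intros linear_continuous_on bounded_linear_hat)
    then show ?thesis
      unfolding ip_def by (intro continuous_on_Re bounded_bilinear.continuous_on[OF bounded_bilinear_h])
  qed
  \<comment> \<open>Differentiating the coefficients at \<open>u\<close> requires the explicit
    formula in a neighbourhood; the sign condition is open.\<close>
  define S where "S = {p. c * ip h (pt k p) (pt k p) > 0}"
  have "open S"
    unfolding S_def by (intro open_Collect_less continuous_intros cont)
  have S_iff: "p \<in> S \<longleftrightarrow> c / ip h (pt k p) (pt k p) > 0" for p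
    by (auto simp: S_def zero_less_divide_iff zero_less_mult_iff)
  define G where "G = (\<lambda>y z x. c * Re (- (h y z * (h x q + h q x) * (inverse (h q q))\<^sup>2)
       - (h y x * h q z + h y q * h x z) * (inverse (h q q))\<^sup>2
       + 2 * (h y q * h q z * (h x q + h q x) * (inverse (h q q)) ^ 3)))"
  have dg: "frechet_derivative (\<lambda>p. ?g p y z) (at u) x = G (hat k y) (hat k z) (hat k x)" for x y z
  proof -
    have "((\<lambda>p. ?g p y z) has_derivative (\<lambda>x. G (hat k y) (hat k z) (hat k x))) (at u)"
      unfolding G_def q_def
      by (rule has_derivative_transform_within_open[OF has_derivative_h_pt \<open>open S\<close>])
         (use N pos g in \<open>auto simp: q_def S_iff\<close>)
    then show ?thesis by (simp flip: frechet_derivative_at)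
  qed
  define t where "t = - (cscale (h (hat k x) q / h q q) y + cscale (h (hat k y) q / h q q) x)"
  have gu: "?g u t z = c * n * Re (h (hat k t) (hat k z) - h (hat k t) q * h q (hat k z) * of_real n)" for t z
  proof -
    have "?g u t z = c / ip h q q * Re (h (hat k t) (hat k z) - h (hat k t) q * h q (hat k z) / h q q)"
      using submersion_metric_push[of "pt k u" k c "hat k t" "hat k z"] pos by (simp add: q_def)
    then show ?thesis by (simp add: h_self n_def)
  qed
  have hat_t: "hat k t = - ((h (hat k x) q * of_real n) *s hat k y + (h (hat k y) q * of_real n) *s hat k x)"
    by (simp add: t_def hat_simps(1,3) divide_inverse inv vec_eq_3_mod[of _ _ k] cscale_def)
  have c1: "christoffel1 ?g u x y z = ?g u t z" for z
  proof -
    have cn: "h q (hat k w) = cnj (h (hat k w) q)" for w by (rule h_cnj)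
    have yx: "h (hat k y) (hat k x) = cnj (h (hat k x) (hat k y))"
      "h (hat k z) (hat k y) = cnj (h (hat k y) (hat k z))" by (rule h_cnj)+
    show ?thesis
      unfolding christoffel1_def dg gu
      using christoffel_identity[where c = c and n = n and d = "h (hat k y) (hat k z)"
        and B = "h (hat k y) q" and C = "h (hat k z) q" and a = "h (hat k x) (hat k y)"
        and b = "h (hat k x) (hat k z)" and A = "h (hat k x) q"]
      by (simp add: G_def hat_t h_simps inv cn yx)
  qed
  have uniq: "t1 = t2" if "\<And>z. ?g u t1 z = ?g u t2 z" for t1 t2
  proof -
    define T where "T = hat k (t1 - t2)"
    \<comment> \<open>\<open>T'\<close> is the horizontal part of the difference. Its product with
      every \<open>hat k z\<close> vanishes, the imaginary part by using \<open>\<i>\<close> times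
      \<open>z\<close>; together with \<open>q\<close> these vectors span, so
      \<open>T' = 0\<close>.\<close>
    define T' where "T' = T - (h T q / h q q) *s q"
    have T'q: "h T' q = 0" using N by (simp add: T'_def h_simps)
    have re: "Re (h T' (hat k z)) = 0" for z
    proof -
      have "c * n * Re (h T (hat k z) - h T q * h q (hat k z) * of_real n) = ?g u t1 z - ?g u t2 z"
        unfolding gu T_def by (simp add: hat_simps h_simps algebra_simps)
      also have "\<dots> = 0" using that by simp
      finally show ?thesis
        using pos N by (simp add: T'_def h_simps divide_inverse inv n_def q_def[symmetric] mult.assoc mult.left_commute)
          (auto simp: mult.commute)
    qed
    have im: "h T' (hat k z) = 0" for z
    proof -
      have "Re (h T' (hat k (cscale \<i> z))) = 0" by (rule re)
      then have "Im (h T' (hat k z)) = 0" by (simp add: hat_simps h_simps)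
      then show ?thesis using re[of z] by (simp add: complex_eq_iff)
    qed
    have "h T' w = 0" for w
    proof -
      have "h T' w = h T' (w $ k *s q + hat k (w $ (k + 1) - w $ k * fst u, w $ (k + 2) - w $ k * snd u))"
        using vec_eq_pt_hat[of w k u] by (simp add: q_def)
      also have "\<dots> = 0" by (simp add: h_add_right h_scale_right T'q im)
      finally show ?thesis .
    qed
    then have "T' = 0" using nondeg by blast
    then have T: "T = (h T q / h q q) *s q" by (simp add: T'_def)
    \<comment> \<open>\<open>T\<close> is a multiple of \<open>q\<close>, but its
      \<open>k\<close>-th coordinate is 0 while that of \<open>q\<close> is 1.\<close>
    then have "T $ k = h T q / h q q" by (metis pt_nth(1) q_def mult.right_neutral vector_smult_component)
    then have "h T q / h q q = 0" by (simp add: T_def)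
    then have "T = 0" by (metis T vector_smult_lzero)
    moreover have "push k (pt k u) 0 = 0"
      using push_scaleR[of "pt k u" k 0 0] by simp
    ultimately have "t1 - t2 = 0"
      using push_pt_hat[of k u "t1 - t2"] by (simp add: T_def)
    then show ?thesis by simp
  qed
  show ?thesis
    unfolding christoffel_def t_def[symmetric]
  proof (rule the_equality)
    show "\<forall>z. ?g u t z = christoffel1 ?g u x y z" by (simp add: c1)
  next
    fix t' assume t': "\<forall>z. ?g u t' z = christoffel1 ?g u x y z"
    show "t' = t" by (rule uniq) (simp only: t' c1)
  qed
qed

text \<open>The derivatives of \<open>\<zeta>\<close> and \<open>X\<close> are needed at time 0
  only, which suits lifted curves, and \<open>\<zeta>\<close> need not stay in the quadric. Changing
  \<open>\<zeta>\<close> and \<open>X\<close> by a common factor adds equal multiples of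
  \<open>X\<close> to both terms.\<close>

lemma cov_deriv_push:
  assumes nondeg: "\<And>x. (\<And>y. h x y = 0) \<Longrightarrow> x = 0"
    and \<zeta>: "(\<zeta> has_vector_derivative \<zeta>') (at 0)" and X: "(X has_vector_derivative X') (at 0)"
    and zk: "\<zeta> 0 $ k \<noteq> 0" and pos: "c / ip h (\<zeta> 0) (\<zeta> 0) > 0" and hor: "h (X 0) (\<zeta> 0) = 0"
    and ev: "eventually (\<lambda>t. \<gamma> t = chart k (proj (\<zeta> t)) \<and> Y t = push k (\<zeta> t) (X t)) (nhds 0)"
  shows "cov_deriv (submersion_metric h c k) \<gamma> Y 0 =
     push k (\<zeta> 0) (X' - (h \<zeta>' (\<zeta> 0) / h (\<zeta> 0) (\<zeta> 0)) *s X 0)"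
proof -
  define z where "z = \<zeta> 0"
  let ?u = "chart k (proj z)"
  have zk: "z $ k \<noteq> 0" using zk by (simp add: z_def)
  have N: "h z z \<noteq> 0" using pos by (auto simp: z_def h_self)
  have "((\<lambda>t. chart k (proj (\<zeta> t))) has_vector_derivative push k z \<zeta>') (at 0)"
  proof -
    have "((\<lambda>t. chart k (proj (\<zeta> t))) has_derivative (\<lambda>t. push k z (t *\<^sub>R \<zeta>'))) (at 0)"
      using has_derivative_compose[OF \<zeta>[unfolded has_vector_derivative_def], of "\<lambda>y. chart k (proj y)" "push k z"]
        has_derivative_chart_proj_push[OF zk] by (simp add: z_def)
    then show ?thesis by (simp add: has_vector_derivative_def push_scaleR[OF zk])
  qed
  then have \<gamma>': "(\<gamma> has_vector_derivative push k z \<zeta>') (at 0)"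
    by (rule has_vector_derivative_eventually_eq) (use ev in eventually_elim, simp)
  define y' where "y' = (\<lambda>i. (X' $ i * z $ k - X 0 $ i * \<zeta>' $ k) / (z $ k)\<^sup>2 -
     (X 0 $ k / z $ k * ((\<zeta>' $ i * z $ k - z $ i * \<zeta>' $ k) / (z $ k)\<^sup>2) +
      (X' $ k * z $ k - X 0 $ k * \<zeta>' $ k) / (z $ k)\<^sup>2 * (z $ i / z $ k)))"
  have comp: "((\<lambda>t. X t $ i / \<zeta> t $ k - X t $ k / \<zeta> t $ k * (\<zeta> t $ i / \<zeta> t $ k)) has_vector_derivative y' i) (at 0)" for i
  proof -
    note nth = has_vector_derivative_vec_nth
    have zk0: "\<zeta> 0 $ k \<noteq> 0" using zk by (simp add: z_def)
    show ?thesis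
      unfolding y'_def z_def
      by (intro has_vector_derivative_diff has_vector_derivative_mult
          has_vector_derivative_divide_complex nth[OF X] nth[OF \<zeta>] zk0)
  qed
  have "isCont (\<lambda>t. \<zeta> t $ k) 0"
    using has_vector_derivative_continuous[OF has_vector_derivative_vec_nth[OF \<zeta>]] .
  then have "eventually (\<lambda>t. \<zeta> t $ k \<noteq> 0) (nhds 0)"
    using zk[unfolded z_def] unfolding continuous_at_open eventually_nhds
    by (metis (mono_tags, lifting) open_Compl open_empty closed_singleton ComplI ComplD singleton_iff)
  then have ev': "eventually (\<lambda>t. (X t $ (k + 1) / \<zeta> t $ k - X t $ k / \<zeta> t $ k * (\<zeta> t $ (k + 1) / \<zeta> t $ k),
      X t $ (k + 2) / \<zeta> t $ k - X t $ k / \<zeta> t $ k * (\<zeta> t $ (k + 2) / \<zeta> t $ k)) = Y t) (nhds 0)"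
    using ev by eventually_elim (simp add: push_eq field_simps power2_eq_square)
  have Y': "(Y has_vector_derivative (y' (k + 1), y' (k + 2))) (at 0)"
    by (rule has_vector_derivative_eventually_eq[OF has_vector_derivative_Pair[OF comp comp] ev'])
  have g0: "\<gamma> 0 = ?u" and Y0: "Y 0 = push k z (X 0)"
    using eventually_nhds_x_imp_x[OF ev] by (auto simp: z_def)
  let ?q = "pt k ?u"
  have q: "?q = (1 / z $ k) *s z" by (rule pt_chart[OF zk])
  \<comment> \<open>\<open>?q\<close> is the multiple of \<open>z\<close> with \<open>k\<close>-th
    coordinate 1. The correction \<open>U $ k / z $ k\<close> stems from the multiple of
    \<open>z\<close> that is subtracted when \<open>U\<close> is projected to that affine
    plane.\<close>
  have ratio: "h (hat k (push k z U)) ?q / h ?q ?q = h U z / h z z - U $ k / z $ k" for U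
    using N zk by (simp add: q hat_push[OF zk] h_simps field_simps)
  have "ip h ?q ?q = ip h z z / (cmod (z $ k))\<^sup>2"
  proof -
    have "h ?q ?q = h z z / (z $ k * cnj (z $ k))" by (simp add: q h_simps)
    then have "complex_of_real (ip h ?q ?q) = of_real (ip h z z / (cmod (z $ k))\<^sup>2)"
      unfolding of_real_divide complex_norm_square h_self[symmetric] .
    then show ?thesis by (simp only: of_real_eq_iff)
  qed
  then have "c / ip h ?q ?q = c / ip h z z * (cmod (z $ k))\<^sup>2" by simp
  moreover have "(cmod (z $ k))\<^sup>2 > 0" using zk by simp
  ultimately have pos': "c / ip h ?q ?q > 0"
    using mult_pos_pos[OF pos] by (simp only: z_def)
  have chr: "christoffel (submersion_metric h c k) ?u (push k z \<zeta>') (push k z (X 0)) =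
    - (cscale (h \<zeta>' z / h z z - \<zeta>' $ k / z $ k) (push k z (X 0)) +
       cscale (- (X 0 $ k / z $ k)) (push k z \<zeta>'))"
    using christoffel_submersion_metric[OF nondeg pos', of "push k z \<zeta>'" "push k z (X 0)"] ratio
      hor by (simp add: z_def)
  \<comment> \<open>Here \<open>a\<close>, \<open>d\<close>, \<open>e\<close>, \<open>b\<close>
    stand for \<open>X 0 $ i\<close>, \<open>X 0 $ k\<close>, \<open>z $ i\<close>,
    \<open>z $ k\<close>, and primes for derivatives. The terms with \<open>b'\<close> and
    \<open>e'\<close> produced by the quotient rule cancel against the Christoffel terms.\<close>
  have alg: "(a' * b - a * b') / b\<^sup>2 - (d / b * ((e' * b - e * b') / b\<^sup>2) + (d' * b - d * b') / b\<^sup>2 * (e / b))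
      - ((m - b' / b) * ((a * b - e * d) / b\<^sup>2) + - (d / b) * ((e' * b - e * b') / b\<^sup>2)) =
      ((a' - m * a) * b - e * (d' - m * d)) / b\<^sup>2" if "b \<noteq> 0" for a a' b b' d d' e e' m :: complex
    using that by (simp add: divide_simps power2_eq_square) (simp add: algebra_simps)
  have "cov_deriv (submersion_metric h c k) \<gamma> Y 0 = (y' (k + 1), y' (k + 2)) +
     christoffel (submersion_metric h c k) ?u (push k z \<zeta>') (push k z (X 0))"
    unfolding cov_deriv_def vector_derivative_at[OF \<gamma>'] vector_derivative_at[OF Y'] g0 Y0 ..
  also have "\<dots> = push k z (X' - (h \<zeta>' z / h z z) *s X 0)"
  proof -
    have cl: "y' i + - ((h \<zeta>' z / h z z - \<zeta>' $ k / z $ k) * ((X 0 $ i * z $ k - z $ i * X 0 $ k) / (z $ k)\<^sup>2) +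
        - (X 0 $ k / z $ k) * ((\<zeta>' $ i * z $ k - z $ i * \<zeta>' $ k) / (z $ k)\<^sup>2)) =
        ((X' $ i - (h \<zeta>' z / h z z) * X 0 $ i) * z $ k - z $ i * (X' $ k - (h \<zeta>' z / h z z) * X 0 $ k)) / (z $ k)\<^sup>2" for i
      unfolding y'_def add_uminus_conv_diff by (rule alg[OF zk])
    then show ?thesis
      unfolding chr unfolding push_eq[OF zk]
      by (simp only: cscale_def fst_conv snd_conv add_Pair uminus_Pair cl vector_minus_component
          vector_smult_component)
  qed
  finally show ?thesis by (simp add: z_def)
qed

end

section \<open>The ruled hypersurface over a curve\<close>

lemma has_vector_derivative_imp_has_derivative_fst:
  assumes "(f has_vector_derivative f') (at (fst x))"
  shows "((\<lambda>x. f (fst x)) has_derivative (\<lambda>y. fst y *\<^sub>R f')) (at x)"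
  using has_derivative_compose[OF bounded_linear_imp_has_derivative[OF bounded_linear_fst] assms[unfolded has_vector_derivative_def]]
  by simp

text \<open>The subspace enters through the orthogonality of \<delta> and \<open>v\<close>, the
  signature through \<open>spacelike\<close>. All functions live on the open set \<open>T\<close>,
  so that derivatives are two-sided.\<close>

locale ruled_data = hermitian h for h +
  fixes r \<epsilon> \<epsilon>' :: real and v :: "complex^3" and T :: "real set"
    and \<delta> \<delta>s \<delta>ss :: "real \<Rightarrow> complex^3" and k :: 3
  assumes r_pos: "r > 0" and \<epsilon>: "\<epsilon> \<in> {1, - 1}" and \<epsilon>': "\<epsilon>' \<in> {1, - 1}"
    and open_T: "open T"
    and smooth_\<delta>: "Ck_on n T \<delta>" and smooth_\<delta>s: "Ck_on n T \<delta>s"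
    and \<delta>': "s \<in> T \<Longrightarrow> (\<delta> has_vector_derivative \<delta>s s) (at s)"
    and \<delta>s': "s \<in> T \<Longrightarrow> (\<delta>s has_vector_derivative \<delta>ss s) (at s)"
    and \<delta>_v: "s \<in> T \<Longrightarrow> h (\<delta> s) v = 0"
    and \<delta>_\<delta>: "s \<in> T \<Longrightarrow> h (\<delta> s) (\<delta> s) = of_real (\<epsilon> * \<epsilon>' * r\<^sup>2)"
    and v_v: "h v v = of_real \<epsilon>'"
    and spacelike: "s \<in> T \<Longrightarrow> h x (\<delta> s) = 0 \<Longrightarrow> h x v = 0 \<Longrightarrow> ip h x x \<ge> 0"
begin

abbreviation \<eta> :: real where "\<eta> \<equiv> \<epsilon> * \<epsilon>'"
abbreviation c :: real where "c \<equiv> \<epsilon> * r\<^sup>2"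

text \<open>\<open>Z\<close> and \<open>E\<close> are \<open>f\<close> and \<open>e\<close> without the factor \<open>e\<^sup>i\<^sup>\<theta> \<sigma>\<close>; \<open>\<tau>\<close> is \<open>1/\<rho>\<close>, and \<open>X = i E/\<rho>\<close> is the
  horizontal vector at \<open>Z\<close> that represents the unit normal. Primes denote derivatives; those with two
  arguments are derivatives at the first in the direction of the second.\<close>

definition b where "b s = ip h (\<delta>s s) (\<i> *s \<delta> s) / r\<^sup>2"
definition E where "E s = \<delta>s s - (\<eta> * b s) *\<^sub>R (\<i> *s \<delta> s)"
definition b' where "b' s = ip h (\<delta>ss s) (\<i> *s \<delta> s) / r\<^sup>2"
definition E' where "E' s = \<delta>ss s - (\<eta> * b' s) *\<^sub>R (\<i> *s \<delta> s) - (\<eta> * b s) *\<^sub>R (\<i> *s \<delta>s s)"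
definition P where "P s = ip h (E s) (E s)"
definition Z where "Z x = \<delta> (fst x) + (snd x * of_real r) *s v"
definition N where "N x = ip h (Z x) (Z x)"
definition \<tau> where "\<tau> x = inverse (sqrt (P (fst x) * c * inverse (N x)))"
definition X where "X x = \<tau> x *\<^sub>R (\<i> *s E (fst x))"
definition F where "F x = chart k (proj (Z x))"
definition Z' where "Z' x y = fst y *\<^sub>R \<delta>s (fst x) + (snd y * of_real r) *s v"
definition F' where "F' x y = push k (Z x) (Z' x y)"
definition \<kappa> where "\<kappa> s = Im (h (E' s) (E s)) / P s"
definition D where "D = {x. fst x \<in> T \<and> \<epsilon>' * (1 + \<epsilon> * (cmod (snd x))\<^sup>2) > 0 \<and> P (fst x) \<noteq> 0 \<and> Z x $ k \<noteq> 0}"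

section \<open>The orthogonal frame along the curve and its derivatives\<close>

lemma signs [simp]: "\<epsilon> * \<epsilon> = 1" "\<epsilon>' * \<epsilon>' = 1" "\<epsilon> * (\<epsilon> * x) = x" "\<epsilon>' * (\<epsilon>' * x) = x" "\<epsilon> \<noteq> 0" "\<epsilon>' \<noteq> 0"
  using \<epsilon> \<epsilon>' by auto

lemma complex_signs [simp]:
  "complex_of_real \<epsilon> * of_real \<epsilon> = 1" "complex_of_real \<epsilon>' * of_real \<epsilon>' = 1"
  "complex_of_real \<epsilon> * (of_real \<epsilon> * x) = x" "complex_of_real \<epsilon>' * (of_real \<epsilon>' * x) = x"
  using \<epsilon> \<epsilon>' by auto

lemma v_\<delta>: "s \<in> T \<Longrightarrow> h v (\<delta> s) = 0"
  using \<delta>_v h_cnj by (metis complex_cnj_zero)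

lemma h_deriv_const:
  assumes "s \<in> T" "\<And>s. s \<in> T \<Longrightarrow> h (f s) (g s) = a"
    and "(f has_vector_derivative f') (at s)" "(g has_vector_derivative g') (at s)"
  shows "h (f s) g' + h f' (g s) = 0"
proof -
  have "((\<lambda>s. a) has_vector_derivative h (f s) g' + h f' (g s)) (at s)"
    by (rule has_vector_derivative_transform_within_open[OF has_vector_derivative_h[OF assms(3,4)] open_T assms(1,2)])
  then show ?thesis using vector_derivative_unique_at by (metis has_vector_derivative_const)
qed

context
  fixes s assumes s: "s \<in> T"
begin

lemma \<delta>s_v: "h (\<delta>s s) v = 0"
  using h_deriv_const[OF s \<delta>_v \<delta>'[OF s] has_vector_derivative_const] by simp

lemma \<delta>s_\<delta>: "h (\<delta>s s) (\<delta> s) = \<i> * of_real (b s * r\<^sup>2)"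
proof -
  have "h (\<delta> s) (\<delta>s s) + h (\<delta>s s) (\<delta> s) = 0"
    by (rule h_deriv_const[OF s \<delta>_\<delta> \<delta>'[OF s] \<delta>'[OF s]])
  then have "Re (h (\<delta>s s) (\<delta> s)) = 0"
    using h_cnj[of "\<delta> s" "\<delta>s s"] by (simp add: complex_eq_iff)
  moreover have "Im (h (\<delta>s s) (\<delta> s)) = b s * r\<^sup>2"
    using r_pos by (simp add: b_def ip_ii)
  ultimately show ?thesis by (simp add: complex_eq_iff)
qed

lemma E_v: "h (E s) v = 0"
  by (simp add: E_def h_simps \<delta>s_v \<delta>_v[OF s])

text \<open>Since \<open>h (\<delta> s) (\<delta> s)\<close> is \<open>\<eta> * r\<^sup>2\<close>
  and \<open>\<eta>\<close> is its own inverse, the coefficient \<open>\<eta> * b s\<close> in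
  \<open>E\<close> removes exactly the component along \<delta>.\<close>

lemma E_\<delta>: "h (E s) (\<delta> s) = 0"
  by (simp add: E_def h_simps \<delta>s_\<delta> \<delta>_\<delta>[OF s] algebra_simps)

lemma v_E: "h v (E s) = 0" and \<delta>_E: "h (\<delta> s) (E s) = 0"
  using E_v E_\<delta> h_cnj by (metis complex_cnj_zero)+

lemma E_E: "h (E s) (E s) = of_real (P s)"
  by (simp add: P_def h_self[of "E s"])

lemma \<delta>s_eq: "\<delta>s s = E s + (\<eta> * b s) *\<^sub>R (\<i> *s \<delta> s)"
  by (simp add: E_def)

lemma E_\<delta>s: "h (E s) (\<delta>s s) = of_real (P s)"
  by (subst \<delta>s_eq) (simp add: h_simps E_\<delta> E_E)

lemma \<delta>s_E: "h (\<delta>s s) (E s) = of_real (P s)"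
  by (subst \<delta>s_eq) (simp add: h_simps \<delta>_E E_E)

lemma P_nonneg: "P s \<ge> 0"
  unfolding P_def by (rule spacelike[OF s E_\<delta> E_v])

text \<open>Pythagoras for the two components of \<open>\<delta>s\<close>. It identifies the
  denominator in \<alpha> with \<open>P\<close>.\<close>

lemma \<delta>s_\<delta>s: "ip h (\<delta>s s) (\<delta>s s) = P s + \<eta> * (b s)\<^sup>2 * r\<^sup>2"
proof -
  have "h (\<delta>s s) (\<delta>s s) = of_real (P s + \<eta> * (b s)\<^sup>2 * r\<^sup>2)"
    by (subst (2) \<delta>s_eq) (simp add: h_simps \<delta>s_E \<delta>s_\<delta> algebra_simps power2_eq_square)
  then show ?thesis by (simp add: ip_def)
qed

lemma b_deriv: "(b has_vector_derivative b' s) (at s)"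
proof -
  have i: "((\<lambda>s. \<i> *s \<delta> s) has_vector_derivative \<i> *s \<delta>s s) (at s)"
    by (rule bounded_linear.has_vector_derivative[OF bounded_linear_vector_scale \<delta>'[OF s]])
  have "((\<lambda>s. Re (h (\<delta>s s) (\<i> *s \<delta> s))) has_vector_derivative
      Re (h (\<delta>s s) (\<i> *s \<delta>s s) + h (\<delta>ss s) (\<i> *s \<delta> s))) (at s)"
    by (rule bounded_linear.has_vector_derivative[OF bounded_linear_Re
          has_vector_derivative_h[OF \<delta>s'[OF s] i]])
  \<comment> \<open>\<open>h (\<delta>s s) (\<delta>s s)\<close> is real, so turning one argument by
    \<open>\<i>\<close> leaves no real part.\<close>
  moreover have "Re (h (\<delta>s s) (\<i> *s \<delta>s s)) = 0"
    using h_self[of "\<delta>s s"] by (simp add: h_simps)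
  ultimately have "((\<lambda>s. Re (h (\<delta>s s) (\<i> *s \<delta> s))) has_vector_derivative Re (h (\<delta>ss s) (\<i> *s \<delta> s))) (at s)"
    by simp
  from has_vector_derivative_mult[OF this has_vector_derivative_const[of "1 / r\<^sup>2"]]
  have "((\<lambda>s. Re (h (\<delta>s s) (\<i> *s \<delta> s)) * (1 / r\<^sup>2)) has_vector_derivative Re (h (\<delta>ss s) (\<i> *s \<delta> s)) * (1 / r\<^sup>2)) (at s)"
    by simp
  then show ?thesis unfolding b_def b'_def ip_def by simp
qed

end

context
  fixes s assumes s: "s \<in> T"
begin

lemma E_deriv: "(E has_vector_derivative E' s) (at s)"
proof -
  note bl = bounded_linear.has_vector_derivative[OF bounded_linear_vector_scale]
  have "((\<lambda>s. \<delta>s s - (\<eta> * b s) *\<^sub>R (\<i> *s \<delta> s)) has_vector_derivative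
      \<delta>ss s - ((\<eta> * b s) *\<^sub>R (\<i> *s \<delta>s s) + (\<eta> * b' s) *\<^sub>R (\<i> *s \<delta> s))) (at s)"
    by (intro has_vector_derivative_diff \<delta>s'[OF s] has_vector_derivative_scaleR bl \<delta>'[OF s]
        DERIV_cmult b_deriv[OF s, folded has_real_derivative_iff_has_vector_derivative])
  then show ?thesis by (simp add: E_def[abs_def] E'_def algebra_simps)
qed

text \<open>Differentiate the orthogonality of \<open>E\<close> and \<delta>. This component of
  \<open>E'\<close> is the source of \<beta> in the first column of the matrix.\<close>

lemma E'_\<delta>: "h (E' s) (\<delta> s) = - of_real (P s)"
  using h_deriv_const[OF s E_\<delta> E_deriv \<delta>'[OF s]] E_\<delta>s[OF s] by (simp add: add_eq_0_iff)

lemma E'_v: "h (E' s) v = 0"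
  using h_deriv_const[OF s E_v E_deriv has_vector_derivative_const] by simp

lemma basis_expansion:
  assumes "P s \<noteq> 0"
  shows "x = (h x (\<delta> s) / of_real (\<eta> * r\<^sup>2)) *s \<delta> s + (h x (E s) / of_real (P s)) *s E s + (h x v / of_real \<epsilon>') *s v"
  using orthogonal_basis_expansion[of "\<delta> s" "E s" v x] assms r_pos
  by (simp add: \<delta>_E[OF s] \<delta>_v[OF s] E_v[OF s] \<delta>_\<delta>[OF s] E_E[OF s] v_v)

text \<open>Where \<rho> is nonzero, \<delta>, \<open>E\<close> and \<open>v\<close> form an
  orthogonal basis without null vectors. This supplies the nondegeneracy that the Christoffel
  symbols require.\<close>

lemma nondegenerate:
  assumes "P s \<noteq> 0" "\<And>y. h x y = 0"
  shows "x = 0"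
  using basis_expansion[OF assms(1), of x] assms(2) by simp

lemma E'_eq:
  assumes "P s \<noteq> 0"
  shows "E' s = (h (E' s) (E s) / of_real (P s)) *s E s - (P s * \<eta> / r\<^sup>2) *\<^sub>R \<delta> s"
proof -
  have "- complex_of_real (P s) / of_real (\<eta> * r\<^sup>2) = of_real (- (P s * \<eta> / r\<^sup>2))"
    using \<epsilon> \<epsilon>' by auto
  then show ?thesis
    using basis_expansion[OF assms, of "E' s"]
    by (simp add: E'_\<delta> E'_v scaleR_eq_vector_scale)
qed

text \<open>The real part of \<open>h (\<delta>ss s) (\<delta> s)\<close> is found by
  differentiating the vanishing real part of \<open>h (\<delta>s s) (\<delta> s)\<close>. After
  division by \<open>P\<close> the last summand is one of the two terms
  \<open>- \<eta> * b s\<close> in \<alpha>.\<close>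

lemma Im_E'_E: "Im (h (E' s) (E s)) = ip h (\<delta>ss s) (\<i> *s \<delta>s s) - \<eta> * b s * ip h (\<delta>s s) (\<delta>s s) - \<eta> * b s * P s"
proof -
  have d: "((\<lambda>s. Re (h (\<delta>s s) (\<delta> s))) has_vector_derivative Re (h (\<delta>s s) (\<delta>s s) + h (\<delta>ss s) (\<delta> s))) (at s)"
    by (rule bounded_linear.has_vector_derivative[OF bounded_linear_Re
          has_vector_derivative_h[OF \<delta>s'[OF s] \<delta>'[OF s]]])
  have "((\<lambda>s. 0) has_vector_derivative Re (h (\<delta>s s) (\<delta>s s) + h (\<delta>ss s) (\<delta> s))) (at s)"
    by (rule has_vector_derivative_transform_within_open[OF d open_T s]) (simp add: \<delta>s_\<delta>)
  then have 1: "Re (h (\<delta>ss s) (\<delta> s)) = - ip h (\<delta>s s) (\<delta>s s)"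
    using vector_derivative_unique_at[OF _ has_vector_derivative_const] by (fastforce simp: ip_def)
  have "h (E' s) (E s) = h (\<delta>ss s) (E s) - \<i> * of_real (\<eta> * b s * P s)"
    unfolding E'_def by (simp add: h_simps \<delta>_E[OF s] \<delta>s_E[OF s])
  moreover have "h (\<delta>ss s) (E s) = h (\<delta>ss s) (\<delta>s s) + \<i> * of_real (\<eta> * b s) * h (\<delta>ss s) (\<delta> s)"
    unfolding E_def by (simp add: h_simps)
  ultimately show ?thesis by (simp add: 1 ip_ii)
qed

end

end

section \<open>Differential, metric and shape operator in terms of the parameters\<close>

context ruled_data
begin

lemma bounded_linear_snd_scale: "bounded_linear (\<lambda>x::real \<times> complex. (snd x * of_real r) *s v)"
  by (intro linear_conv_bounded_linear[THEN iffD1] linearI)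
     (simp_all add: vector_sadd_rdistrib algebra_simps vector_scale_scaleR)

lemma Z_deriv: "fst x \<in> T \<Longrightarrow> (Z has_derivative Z' x) (at x)"
  unfolding Z_def[abs_def] Z'_def
  by (intro has_derivative_add has_vector_derivative_imp_has_derivative_fst \<delta>'
      bounded_linear_imp_has_derivative bounded_linear_snd_scale)

lemma N_eq: "fst x \<in> T \<Longrightarrow> N x = c * (\<epsilon>' * (1 + \<epsilon> * (cmod (snd x))\<^sup>2))"
proof -
  assume s: "fst x \<in> T"
  have "h (Z x) (Z x) = of_real (\<eta> * r\<^sup>2) + snd x * cnj (snd x) * of_real (r\<^sup>2 * \<epsilon>')"
    by (simp add: Z_def h_simps \<delta>_\<delta>[OF s] \<delta>_v[OF s] v_\<delta>[OF s] v_v power2_eq_square)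
  also have "\<dots> = of_real (c * (\<epsilon>' * (1 + \<epsilon> * (cmod (snd x))\<^sup>2)))"
    unfolding complex_norm_square[symmetric] by (simp add: algebra_simps)
  finally show ?thesis by (simp add: N_def ip_def)
qed

lemma Z_Z: "h (Z x) (Z x) = of_real (N x)"
  by (simp add: N_def h_self)

text \<open>The square of \<sigma>: the factor by which the square of \<open>Z\<close> must change
  to reach the quadric.\<close>

definition S where "S x = c / N x"
definition W where "W y = push k (Z y) (\<tau> y *\<^sub>R E (fst y))"
text \<open>As \<open>\<tau>\<close> is the power -1/2 of \<open>P * c / N\<close>, its logarithmic
  derivative is half that of \<open>N\<close> minus half that of \<open>P\<close>.\<close>

definition \<tau>' where "\<tau>' z y = \<tau> z * (Re (h (Z' z y) (Z z)) / N z - fst y * Re (h (E' (fst z)) (E (fst z))) / P (fst z))"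
definition X' where "X' z y = \<tau>' z y *\<^sub>R (\<i> *s E (fst z)) + (\<tau> z * fst y) *\<^sub>R (\<i> *s E' (fst z))"
text \<open>The rate at which \<open>Z\<close> turns in its fibre; \<open>\<kappa>\<close> is
  likewise the rate at which \<open>E\<close> turns in its own complex line.\<close>

definition \<mu> where "\<mu> z y = Im (h (Z' z y) (Z z)) / N z"

context
  fixes x assumes x: "x \<in> D"
begin

lemma D_simps: "fst x \<in> T" "P (fst x) > 0" "Z x $ k \<noteq> 0" "\<epsilon>' * (1 + \<epsilon> * (cmod (snd x))\<^sup>2) > 0"
  using x P_nonneg[of "fst x"] by (auto simp: D_def less_le)

lemma c_neq_0: "c \<noteq> 0"
  using r_pos by simp

lemma S_pos: "S x > 0" and S_eq: "S x * (\<epsilon>' * (1 + \<epsilon> * (cmod (snd x))\<^sup>2)) = 1"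
  using D_simps(4) c_neq_0 by (auto simp: S_def N_eq[OF D_simps(1)])

lemma N_neq_0: "N x \<noteq> 0"
  using S_pos by (auto simp: S_def)

lemma \<tau>_pos: "\<tau> x > 0" and \<tau>_sq: "(\<tau> x)\<^sup>2 * P (fst x) * S x = 1"
proof -
  have "P (fst x) * c * inverse (N x) = P (fst x) * S x" by (simp add: S_def divide_inverse)
  moreover have "P (fst x) * S x > 0" using D_simps(2) S_pos by simp
  ultimately show "\<tau> x > 0" "(\<tau> x)\<^sup>2 * P (fst x) * S x = 1"
    using D_simps(2) S_pos by (simp_all add: \<tau>_def power_inverse field_simps)
qed

lemma E_Z: "h (E (fst x)) (Z x) = 0" and v_Z: "h v (Z x) = cnj (snd x) * of_real (r * \<epsilon>')"
  and \<delta>s_Z: "h (\<delta>s (fst x)) (Z x) = \<i> * of_real (b (fst x) * r\<^sup>2)"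
  using D_simps(1) by (simp_all add: Z_def h_simps E_\<delta> E_v v_\<delta> v_v \<delta>s_\<delta> \<delta>s_v)

lemma Z'_Z: "h (Z' x y) (Z x) = \<i> * of_real (fst y * b (fst x) * r\<^sup>2) + snd y * cnj (snd x) * of_real (r\<^sup>2 * \<epsilon>')"
  by (simp add: Z'_def h_simps v_Z \<delta>s_Z power2_eq_square algebra_simps)

lemma push_\<delta>: "push k (Z x) (a *s \<delta> (fst x)) = - F' x (0, a * snd x)"
proof -
  have "\<delta> (fst x) = Z x - (snd x * of_real r) *s v" by (simp add: Z_def)
  then have "a *s \<delta> (fst x) = a *s Z x - (a * snd x * of_real r) *s v"
    by (simp add: vector_ssub_ldistrib vector_smult_assoc mult.assoc)
  then show ?thesis
    by (simp add: F'_def Z'_def push_diff[OF D_simps(3)] push_scale[OF D_simps(3), of a]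
        push_self[OF D_simps(3)] cscale_def zero_prod_def)
qed

lemma F_deriv: "(F has_derivative F' x) (at x)"
  unfolding F_def[abs_def] F'_def
  by (rule has_derivative_compose[OF Z_deriv[OF D_simps(1)] has_derivative_chart_proj_push[OF D_simps(3)]])

lemma linear_F': "linear (F' x)"
  using F_deriv has_derivative_linear by blast

text \<open>A kernel vector has \<open>Z'\<close> proportional to \<open>Z\<close>. Comparing
  components along \<open>E\<close>, \<delta> and \<open>v\<close>, in this order, kills
  \<open>fst y\<close>, the factor of proportionality, and \<open>snd y\<close>.\<close>

lemma inj_F': "inj (F' x)"
  unfolding linear_injective_0[OF linear_F']
proof (intro allI impI)
  fix y assume "F' x y = 0"
  then obtain m where m: "Z' x y = m *s Z x"
    using push_eq_0D[OF D_simps(3)] by (auto simp: F'_def)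
  note s = D_simps(1)
  have "h (Z' x y) (E (fst x)) = 0"
    unfolding m by (simp add: Z_def h_simps \<delta>_E[OF s] v_E[OF s])
  then have y1: "fst y = 0"
    using D_simps(2) by (simp add: Z'_def h_simps \<delta>s_E[OF s] v_E[OF s])
  have "h (Z' x y) (\<delta> (fst x)) = m * of_real (\<eta> * r\<^sup>2)"
    unfolding m by (simp add: Z_def h_simps \<delta>_\<delta>[OF s] v_\<delta>[OF s])
  moreover have "h (Z' x y) (\<delta> (fst x)) = 0"
    by (simp add: Z'_def y1 h_simps v_\<delta>[OF s])
  ultimately have "m = 0" using r_pos by simp
  then have "h (Z' x y) v = 0" by (simp add: m)
  then have "snd y = 0" using r_pos by (simp add: Z'_def y1 h_simps v_v)
  then show "y = 0" using y1 by (simp add: prod_eq_iff)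
qed

lemma metric_F:
  "submersion_metric h c k (F x) (push k (Z x) A) (push k (Z x) B) =
     S x * Re (h A B - h A (Z x) * h (Z x) B / of_real (N x))"
  using submersion_metric_push[of "Z x" k c A B] D_simps(3) S_pos
  by (simp add: F_def S_def N_def Z_Z)

lemma metric_F_horizontal:
  "h A (Z x) = 0 \<Longrightarrow> submersion_metric h c k (F x) (push k (Z x) A) (push k (Z x) B) = S x * Re (h A B)"
  by (simp add: metric_F)

lemma metric_normal: "submersion_metric h c k (F x) (push k (Z x) (X x)) (push k (Z x) (X x)) = 1"
  using \<tau>_sq by (subst metric_F_horizontal)
    (simp_all add: X_def h_simps E_Z E_E[OF D_simps(1)] power2_eq_square algebra_simps)

lemma metric_W: "submersion_metric h c k (F x) (W x) (W x) = 1"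
  unfolding W_def using \<tau>_sq by (subst metric_F_horizontal)
    (simp_all add: h_simps E_Z E_E[OF D_simps(1)] power2_eq_square algebra_simps)

lemma metric_normal_tangent: "submersion_metric h c k (F x) (push k (Z x) (X x)) (F' x y) = 0"
  unfolding F'_def by (subst metric_F_horizontal)
    (simp_all add: X_def Z'_def h_simps E_Z E_v[OF D_simps(1)] E_\<delta>s[OF D_simps(1)])

lemma metric_tangent_W: "submersion_metric h c k (F x) (F' x y) (W x) = fst y * \<tau> x * P (fst x) * S x"
  unfolding F'_def W_def metric_F
  using h_cnj[of "Z x" "E (fst x)"]
  by (simp add: Z'_def h_simps E_Z v_E[OF D_simps(1)] \<delta>s_E[OF D_simps(1)])

lemma metric_W_vertical: "submersion_metric h c k (F x) (W x) (F' x (0, d)) = 0"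
  unfolding F'_def W_def
  by (subst metric_F_horizontal) (simp_all add: Z'_def h_simps E_Z E_v[OF D_simps(1)])

text \<open>The metric on a ruling is conformal to the parameter plane with factor
  \<open>r\<^sup>2\<close> times the fourth power of \<sigma>. This accounts for the length of
  \<open>R\<close>.\<close>

lemma metric_vertical:
  "submersion_metric h c k (F x) (F' x (0, d)) (F' x (0, d')) = r\<^sup>2 * (S x)\<^sup>2 * Re (d * cnj d')"
proof -
  let ?w = "snd x"
  have 1: "h (Z' x (0, d)) (Z' x (0, d')) = of_real (r\<^sup>2 * \<epsilon>') * (d * cnj d')"
    by (simp add: Z'_def h_simps v_v power2_eq_square)
  have 2: "h (Z' x (0, d)) (Z x) = d * cnj ?w * of_real (r\<^sup>2 * \<epsilon>')"
    by (simp add: Z'_Z)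
  have "h (Z x) (Z' x (0, d')) = cnj (d' * cnj ?w * of_real (r\<^sup>2 * \<epsilon>'))"
    using h_cnj[of "Z x" "Z' x (0, d')"] by (simp add: Z'_Z)
  then have 3: "h (Z' x (0, d)) (Z x) * h (Z x) (Z' x (0, d')) / of_real (N x) =
      of_real (r\<^sup>2 * r\<^sup>2 / N x) * (?w * cnj ?w) * (d * cnj d')"
    unfolding 2 by (simp add: power2_eq_square algebra_simps)
  have 4: "r\<^sup>2 / N x = \<epsilon> * S x" by (simp add: S_def)
  have "submersion_metric h c k (F x) (F' x (0, d)) (F' x (0, d')) =
     S x * Re (of_real (r\<^sup>2 * \<epsilon>') * (d * cnj d') - of_real (r\<^sup>2 * r\<^sup>2 / N x) * of_real ((cmod ?w)\<^sup>2) * (d * cnj d'))"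
    unfolding F'_def metric_F 1 3 complex_norm_square ..
  also have "\<dots> = S x * Re (of_real (r\<^sup>2 * \<epsilon>' - r\<^sup>2 * (r\<^sup>2 / N x) * (cmod ?w)\<^sup>2) * (d * cnj d'))"
    by (simp add: algebra_simps)
  also have "\<dots> = S x * (r\<^sup>2 * (\<epsilon>' - \<epsilon> * S x * (cmod ?w)\<^sup>2)) * Re (d * cnj d')"
  proof -
    have "Re (complex_of_real m * u) = m * Re u" for m u by simp
    then show ?thesis unfolding 4 by (simp add: algebra_simps)
  qed
  \<comment> \<open>This is the equation that determines \<sigma>, multiplied by
    \<open>\<epsilon>'\<close>.\<close>
  also have "\<epsilon>' - \<epsilon> * S x * (cmod ?w)\<^sup>2 = S x"
  proof -
    have "\<epsilon>' = \<epsilon>' * (S x * (\<epsilon>' * (1 + \<epsilon> * (cmod ?w)\<^sup>2)))" by (simp add: S_eq)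
    also have "\<dots> = S x + \<epsilon> * S x * (cmod ?w)\<^sup>2" by (simp add: algebra_simps)
    finally show ?thesis by simp
  qed
  finally show ?thesis by (simp add: power2_eq_square ac_simps)
qed

text \<open>Adding a multiple of \<open>Z\<close>, which projects to 0, trades the \<delta>-part of
  \<open>\<tau> E\<close> for a multiple of \<open>v\<close>. The sum is a derivative of
  \<open>Z\<close>, and its parameter direction can be read off.\<close>

lemma W_eq: "W x = F' x (\<tau> x, of_real (\<tau> x * \<eta> * b (fst x)) * (\<i> * snd x))"
proof -
  have "Z' x (\<tau> x, of_real (\<tau> x * \<eta> * b (fst x)) * (\<i> * snd x)) =
      \<tau> x *\<^sub>R E (fst x) + (of_real (\<tau> x * \<eta> * b (fst x)) * \<i>) *s Z x"
    by (simp add: Z'_def Z_def \<delta>s_eq[OF D_simps(1)] scaleR_eq_vector_scale vector_add_ldistrib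
        vector_smult_assoc mult.assoc)
  moreover have "push k (Z x) (a *s Z x) = 0" for a
    by (simp add: push_scale[OF D_simps(3)] push_self[OF D_simps(3)] cscale_def zero_prod_def)
  ultimately show ?thesis by (simp only: F'_def W_def push_add[OF D_simps(3)] add_0_right)
qed

lemma nondegenerate_h: "(\<And>y. h A y = 0) \<Longrightarrow> A = 0"
  using nondegenerate[OF D_simps(1)] D_simps(2) by force

lemma P_deriv: "(P has_vector_derivative 2 * Re (h (E' (fst x)) (E (fst x)))) (at (fst x))"
proof -
  note d = E_deriv[OF D_simps(1)]
  have "((\<lambda>s. Re (h (E s) (E s))) has_vector_derivative Re (h (E (fst x)) (E' (fst x)) + h (E' (fst x)) (E (fst x)))) (at (fst x))"
    by (rule bounded_linear.has_vector_derivative[OF bounded_linear_Re has_vector_derivative_h[OF d d]])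
  then show ?thesis
    using h_cnj[of "E (fst x)" "E' (fst x)"] by (simp add: P_def[abs_def] ip_def)
qed

lemma N_deriv: "(N has_derivative (\<lambda>y. 2 * Re (h (Z' x y) (Z x)))) (at x)"
proof -
  note d = Z_deriv[OF D_simps(1)]
  have "((\<lambda>x. Re (h (Z x) (Z x))) has_derivative (\<lambda>y. Re (h (Z x) (Z' x y) + h (Z' x y) (Z x)))) (at x)"
    by (rule bounded_linear.has_derivative[OF bounded_linear_Re bounded_bilinear.FDERIV[OF bounded_bilinear_h d d]])
  moreover have "Re (h (Z x) (Z' x y) + h (Z' x y) (Z x)) = 2 * Re (h (Z' x y) (Z x))" for y
    using h_cnj[of "Z x" "Z' x y"] by simp
  ultimately show ?thesis by (simp add: N_def[abs_def] ip_def)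
qed

lemma \<tau>_deriv: "(\<tau> has_derivative \<tau>' x) (at x)"
proof -
  let ?M = "\<lambda>x. P (fst x) * c * inverse (N x)"
  have Mp: "?M x > 0"
    using D_simps(2) S_pos by (simp add: S_def divide_inverse mult.assoc)
  have "((\<lambda>x. P (fst x)) has_derivative (\<lambda>y. fst y *\<^sub>R (2 * Re (h (E' (fst x)) (E (fst x)))))) (at x)"
    by (rule has_vector_derivative_imp_has_derivative_fst[OF P_deriv])
  from has_derivative_mult[OF has_derivative_mult_left[OF this, of c] Deriv.has_derivative_inverse[OF N_neq_0 N_deriv]]
  have M: "(?M has_derivative (\<lambda>y. P (fst x) * c * - (inverse (N x) * (2 * Re (h (Z' x y) (Z x))) * inverse (N x)) +
      fst y *\<^sub>R (2 * Re (h (E' (fst x)) (E (fst x)))) * c * inverse (N x))) (at x)" (is "(?M has_derivative ?M') (at x)") .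
  have "((\<lambda>x. sqrt (?M x)) has_derivative (\<lambda>y. ?M' y * (inverse (sqrt (?M x)) / 2))) (at x)"
    by (rule DERIV_compose_FDERIV[OF DERIV_real_sqrt[OF Mp] M])
  from Deriv.has_derivative_inverse[OF _ this] Mp
  have "(\<tau> has_derivative (\<lambda>y. - (\<tau> x * (?M' y * (\<tau> x / 2)) * \<tau> x))) (at x)"
    unfolding \<tau>_def[abs_def] by (metis less_irrefl real_sqrt_eq_zero_cancel_iff)
  moreover have "- (\<tau> x * (?M' y * (\<tau> x / 2)) * \<tau> x) = \<tau>' x y" for y
  proof -
    \<comment> \<open>Used to eliminate the radicand, so that only logarithmic derivatives
      remain.\<close>
    have t: "\<tau> x * \<tau> x * (P (fst x) * c * inverse (N x)) = 1"
      using \<tau>_sq by (simp add: S_def power2_eq_square divide_inverse ac_simps)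
    have M': "?M' y = (P (fst x) * c * inverse (N x)) *
        (2 * (fst y * Re (h (E' (fst x)) (E (fst x))) / P (fst x) - Re (h (Z' x y) (Z x)) / N x))"
      using D_simps(2) N_neq_0 by (simp add: field_simps)
    have "- (\<tau> x * (?M' y * (\<tau> x / 2)) * \<tau> x) = - \<tau> x * (\<tau> x * \<tau> x * ?M' y) / 2" by simp
    also have "\<dots> = - \<tau> x * ((\<tau> x * \<tau> x * (P (fst x) * c * inverse (N x))) *
        (2 * (fst y * Re (h (E' (fst x)) (E (fst x))) / P (fst x) - Re (h (Z' x y) (Z x)) / N x))) / 2"
      unfolding M' by (simp only: mult.assoc)
    also have "\<dots> = \<tau>' x y" unfolding t by (simp add: \<tau>'_def algebra_simps add_divide_distrib diff_divide_distrib)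
    finally show ?thesis .
  qed
  ultimately show ?thesis by (simp add: \<tau>'_def[abs_def])
qed

lemma X_deriv: "(X has_derivative X' x) (at x)"
proof -
  have "((\<lambda>s. \<i> *s E s) has_vector_derivative \<i> *s E' (fst x)) (at (fst x))"
    by (rule bounded_linear.has_vector_derivative[OF bounded_linear_vector_scale E_deriv[OF D_simps(1)]])
  from has_derivative_scaleR[OF \<tau>_deriv has_vector_derivative_imp_has_derivative_fst[OF this]]
  show ?thesis by (simp add: X_def[abs_def] X'_def[abs_def] add.commute)
qed

text \<open>In the coefficient of \<open>E\<close> the real parts of \<open>h(E', E)/P\<close> and
  \<open>h(Z', Z)/N\<close> cancel against \<open>\<tau>'\<close>, because \<open>X\<close>
  represents a unit field. The imaginary parts leave \<open>\<kappa>\<close> and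
  \<open>\<mu>\<close>, and the \<delta>-part of \<open>E'\<close> projects to a vector along the
  ruling.\<close>

lemma push_X':
  "push k (Z x) (X' x y - (h (Z' x y) (Z x) / h (Z x) (Z x)) *s X x) =
     - ((fst y * \<kappa> (fst x) - \<mu> x y) *\<^sub>R W x - (fst y * \<tau> x * P (fst x) * \<eta> / r\<^sup>2) *\<^sub>R F' x (0, \<i> * snd x))"
proof -
  let ?s = "fst x" and ?a = "fst y"
  let ?q = "h (E' ?s) (E ?s)" and ?z = "h (Z' x y) (Z x)"
  have P: "P ?s \<noteq> 0" using D_simps(2) by simp
  have q: "?q / of_real (P ?s) = of_real (Re ?q / P ?s) + \<i> * of_real (\<kappa> ?s)"
    by (simp add: complex_eq_iff \<kappa>_def)
  have zN: "?z / of_real (N x) = of_real (Re ?z / N x) + \<i> * of_real (\<mu> x y)"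
    by (simp add: complex_eq_iff \<mu>_def)
  have E': "E' ?s = (of_real (Re ?q / P ?s) + \<i> * of_real (\<kappa> ?s)) *s E ?s - of_real (P ?s * \<eta> / r\<^sup>2) *s \<delta> ?s"
    using E'_eq[OF D_simps(1) P] unfolding q scaleR_eq_vector_scale .
  have "X' x y - (?z / h (Z x) (Z x)) *s X x =
      (of_real (\<tau>' x y) * \<i>) *s E ?s + (of_real (\<tau> x * ?a) * \<i>) *s E' ?s -
      ((of_real (Re ?z / N x) + \<i> * of_real (\<mu> x y)) * of_real (\<tau> x) * \<i>) *s E ?s"
    unfolding Z_Z zN by (simp add: X'_def X_def scaleR_eq_vector_scale vector_smult_assoc mult.assoc)
  also have "\<dots> = (of_real (\<tau>' x y) * \<i> + of_real (\<tau> x * ?a) * \<i> * (of_real (Re ?q / P ?s) + \<i> * of_real (\<kappa> ?s))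
       - (of_real (Re ?z / N x) + \<i> * of_real (\<mu> x y)) * of_real (\<tau> x) * \<i>) *s E ?s
      - (of_real (\<tau> x * ?a) * \<i> * of_real (P ?s * \<eta> / r\<^sup>2)) *s \<delta> ?s"
    by (subst E') (simp add: vector_smult_assoc vector_sadd_rdistrib vector_ssub_ldistrib vector_sub_rdistrib algebra_simps)
  also have "of_real (\<tau>' x y) * \<i> + of_real (\<tau> x * ?a) * \<i> * (of_real (Re ?q / P ?s) + \<i> * of_real (\<kappa> ?s))
       - (of_real (Re ?z / N x) + \<i> * of_real (\<mu> x y)) * of_real (\<tau> x) * \<i> =
      complex_of_real (- ((?a * \<kappa> ?s - \<mu> x y) * \<tau> x))"
    by (simp add: \<tau>'_def complex_eq_iff algebra_simps)
  finally have "X' x y - (?z / h (Z x) (Z x)) *s X x =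
      (- (?a * \<kappa> ?s - \<mu> x y)) *\<^sub>R (\<tau> x *\<^sub>R E ?s) - (?a * \<tau> x * P ?s * \<eta> / r\<^sup>2) *\<^sub>R (\<i> *s \<delta> ?s)"
    by (simp add: scaleR_eq_vector_scale vector_smult_assoc algebra_simps)
  then show ?thesis
    by (simp add: push_diff[OF D_simps(3)] push_scaleR[OF D_simps(3)] push_\<delta> W_def[symmetric])
       (simp add: W_def push_scaleR[OF D_simps(3)] algebra_simps)
qed

lemma shape_op_F:
  assumes "embedded_param V F F' m" "x \<in> V" and \<xi>: "\<And>z. z \<in> V \<Longrightarrow> \<xi> (F z) = push k (Z z) (X z)"
  shows "shape_op (submersion_metric h c k) (F ` V) \<xi> (F x) (F' x y) =
     (fst y * \<kappa> (fst x) - \<mu> x y) *\<^sub>R W x - (fst y * \<tau> x * P (fst x) * \<eta> / r\<^sup>2) *\<^sub>R F' x (0, \<i> * snd x)"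
proof (rule shape_op_param[OF assms(1,2)])
  fix cv \<gamma> assume cv: "cv 0 = x" "(cv has_vector_derivative y) (at 0)"
    "\<forall>\<^sub>F t in nhds 0. cv t \<in> V \<and> \<gamma> t = F (cv t)"
  have lin: "linear (Z' x)" "linear (X' x)"
    using has_derivative_linear[OF Z_deriv[OF D_simps(1)]] has_derivative_linear[OF X_deriv] by auto
  have comp: "((\<lambda>t. f (cv t)) has_vector_derivative f' y) (at 0)"
    if "(f has_derivative f') (at x)" "linear f'" for f :: "real \<times> complex \<Rightarrow> complex^3" and f'
    using has_derivative_compose[OF cv(2)[unfolded has_vector_derivative_def], of f f'] that cv(1)
    by (simp add: has_vector_derivative_def linear_scale)
  have "cov_deriv (submersion_metric h c k) \<gamma> (\<lambda>t. \<xi> (\<gamma> t)) 0 =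
      push k (Z (cv 0)) (X' x y - (h (Z' x y) (Z (cv 0)) / h (Z (cv 0)) (Z (cv 0))) *s X (cv 0))"
  proof (rule cov_deriv_push[OF nondegenerate_h comp[OF Z_deriv[OF D_simps(1)] lin(1)] comp[OF X_deriv lin(2)]])
    show "Z (cv 0) $ k \<noteq> 0" "0 < c / ip h (Z (cv 0)) (Z (cv 0))" "h (X (cv 0)) (Z (cv 0)) = 0"
      using D_simps(3) S_pos by (simp_all add: cv(1) S_def N_def X_def h_simps E_Z)
    show "\<forall>\<^sub>F t in nhds 0. \<gamma> t = chart k (proj (Z (cv t))) \<and> \<xi> (\<gamma> t) = push k (Z (cv t)) (X (cv t))"
      using cv(3) by eventually_elim (use \<xi> in \<open>auto simp: F_def\<close>)
  qed
  then show "cov_deriv (submersion_metric h c k) \<gamma> (\<lambda>t. \<xi> (\<gamma> t)) 0 =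
      - ((fst y * \<kappa> (fst x) - \<mu> x y) *\<^sub>R W x - (fst y * \<tau> x * P (fst x) * \<eta> / r\<^sup>2) *\<^sub>R F' x (0, \<i> * snd x))"
    unfolding cv(1) push_X' .
qed

end

end

section \<open>Smoothness and local embedding\<close>

context ruled_data
begin

lemma E_Ck: "Ck_on n T E"
proof -
  note bil = Ck_on_bilinear[OF open_T]
  have "Ck_on n T (\<lambda>s. Re (h (\<delta>s s) (\<i> *s \<delta> s)) * (1 / r\<^sup>2))"
    by (intro bil[OF bounded_bilinear_mult] Ck_on_bounded_linear[OF open_T bounded_linear_Re]
        bil[OF bounded_bilinear_h] Ck_on_bounded_linear[OF open_T bounded_linear_vector_scale]
        Ck_on_const[OF open_T] smooth_\<delta> smooth_\<delta>s)
  then have "Ck_on n T b" by (simp add: b_def[abs_def] ip_def)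
  then have "Ck_on n T (\<lambda>s. \<delta>s s + ((- \<eta>) * b s) *\<^sub>R (\<i> *s \<delta> s))"
    by (intro Ck_on_add[OF open_T] bil[OF bounded_bilinear_scaleR] bil[OF bounded_bilinear_mult]
        Ck_on_bounded_linear[OF open_T bounded_linear_vector_scale] Ck_on_const[OF open_T]
        smooth_\<delta> smooth_\<delta>s)
  then show ?thesis by (simp add: E_def[abs_def])
qed

lemma P_Ck: "Ck_on n T P"
  unfolding P_def[abs_def] ip_def
  by (intro Ck_on_bounded_linear[OF open_T bounded_linear_Re] Ck_on_bilinear[OF open_T bounded_bilinear_h] E_Ck)

context
  fixes U :: "(real \<times> complex) set"
  assumes U: "open U" "U \<subseteq> T \<times> UNIV"
begin

lemma Ck_on_fst:
  assumes "Ck_on n T f"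
  shows "Ck_on n U (\<lambda>x. f (fst x))"
proof -
  have "fst x + 0 \<in> T" if "x \<in> U" for x using that U(2) by auto
  from Ck_on_compose_linear[OF U(1) open_T bounded_linear_fst this assms] show ?thesis by simp
qed

lemma Z_Ck: "Ck_on n U Z"
  unfolding Z_def[abs_def]
  by (intro Ck_on_add[OF U(1)] Ck_on_fst smooth_\<delta> Ck_on_linear[OF U(1) bounded_linear_snd_scale])

lemma Z_nth_Ck: "Ck_on n U (\<lambda>x. Z x $ i)"
  by (rule Ck_on_bounded_linear[OF U(1) bounded_linear_vec_nth Z_Ck])

end

lemma open_D: "open D"
proof -
  let ?f = "\<lambda>x. (\<epsilon>' * (1 + \<epsilon> * (cmod (snd x))\<^sup>2), P (fst x), Z x $ k)"
  have o: "open (T \<times> (UNIV :: complex set))" using open_T by (simp add: open_Times)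
  have "continuous_on (T \<times> UNIV) ?f"
    using Ck_on_fst[OF o order_refl P_Ck, of 0] Z_Ck[OF o order_refl, of 0]
    by (auto intro!: continuous_intros)
  then have "open ((T \<times> UNIV) \<inter> ?f -` ({0<..} \<times> (- {0}) \<times> (- {0})))"
    by (intro continuous_open_preimage o open_Times) auto
  moreover have "(T \<times> UNIV) \<inter> ?f -` ({0<..} \<times> (- {0}) \<times> (- {0})) = D"
    by (auto simp: D_def)
  ultimately show ?thesis by simp
qed

lemma D_subset: "D \<subseteq> T \<times> UNIV"
  by (auto simp: D_def)

lemma F_Ck: "Ck_on n D F"
proof (rule Ck_on_cong[OF open_D])
  show "Ck_on n D (\<lambda>x. (Z x $ (k + 1) * inverse (Z x $ k), Z x $ (k + 2) * inverse (Z x $ k)))"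
    by (intro Ck_on_Pair[OF open_D] Ck_on_bilinear[OF open_D bounded_bilinear_mult]
        Ck_on_inverse[OF open_D] Z_nth_Ck[OF open_D D_subset]) (auto simp: D_def)
qed (simp add: F_def chart_proj D_def divide_inverse)

lemma push_X_Ck: "Ck_on n D (\<lambda>x. push k (Z x) (X x))"
proof -
  note bil = Ck_on_bilinear[OF open_D]
  have N: "Ck_on n D N"
    unfolding N_def[abs_def] ip_def
    by (intro Ck_on_bounded_linear[OF open_D bounded_linear_Re] bil[OF bounded_bilinear_h] Z_Ck[OF open_D D_subset])
  have "Ck_on n D \<tau>"
    unfolding \<tau>_def[abs_def]
  proof (rule Ck_on_inverse_sqrt[OF open_D])
    show "Ck_on n D (\<lambda>x. P (fst x) * c * inverse (N x))"
      by (intro bil[OF bounded_bilinear_mult] Ck_on_inverse[OF open_D] Ck_on_fst[OF open_D D_subset]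
          P_Ck N Ck_on_const[OF open_D]) (rule N_neq_0)
    show "P (fst x) * c * inverse (N x) > 0" if "x \<in> D" for x
      using S_pos[OF that] D_simps(2)[OF that] by (simp add: S_def divide_inverse mult.assoc)
  qed
  then have X: "Ck_on n D X"
    unfolding X_def[abs_def]
    by (intro bil[OF bounded_bilinear_scaleR] Ck_on_bounded_linear[OF open_D bounded_linear_vector_scale]
        Ck_on_fst[OF open_D D_subset] E_Ck)
  have Xi: "Ck_on n D (\<lambda>x. X x $ i)" for i
    by (rule Ck_on_bounded_linear[OF open_D bounded_linear_vec_nth X])
  have i: "Ck_on n D (\<lambda>x. inverse (Z x $ k))"
    by (intro Ck_on_inverse[OF open_D] Z_nth_Ck[OF open_D D_subset]) (auto simp: D_def)
  show ?thesis
  proof (rule Ck_on_cong[OF open_D])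
    show "Ck_on n D (\<lambda>x. (X x $ (k + 1) * inverse (Z x $ k) + (- 1) * (Z x $ (k + 1) * X x $ k * (inverse (Z x $ k) * inverse (Z x $ k))),
        X x $ (k + 2) * inverse (Z x $ k) + (- 1) * (Z x $ (k + 2) * X x $ k * (inverse (Z x $ k) * inverse (Z x $ k)))))"
      by (intro Ck_on_Pair[OF open_D] Ck_on_add[OF open_D] bil[OF bounded_bilinear_mult] Xi i
          Z_nth_Ck[OF open_D D_subset] Ck_on_const[OF open_D])
    show "(X x $ (k + 1) * inverse (Z x $ k) + (- 1) * (Z x $ (k + 1) * X x $ k * (inverse (Z x $ k) * inverse (Z x $ k))),
        X x $ (k + 2) * inverse (Z x $ k) + (- 1) * (Z x $ (k + 2) * X x $ k * (inverse (Z x $ k) * inverse (Z x $ k)))) =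
        push k (Z x) (X x)" if "x \<in> D" for x
      using that by (simp add: D_def push_eq field_simps power2_eq_square)
  qed
qed

lemma local_embedding:
  assumes "(s0, w0) \<in> D"
  obtains a m where "a > 0" "ball s0 a \<times> ball w0 a \<subseteq> D"
    "embedded_param (ball s0 a \<times> ball w0 a) F F' m"
proof -
  have "frechet_derivative F (at (s0, w0)) = F' (s0, w0)"
    using F_deriv[OF assms] by (simp flip: frechet_derivative_at)
  then obtain d m where d: "d > 0" "m > 0" "ball (s0, w0) d \<subseteq> D"
    "\<And>x y. x \<in> ball (s0, w0) d \<Longrightarrow> y \<in> ball (s0, w0) d \<Longrightarrow> m * norm (x - y) \<le> norm (F x - F y)"
    using immersion_locally_expanding[OF open_D assms F_Ck] inj_F'[OF assms] by metis
  \<comment> \<open>A product of balls of radius \<open>d/2\<close> fits into the ball of radius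
    \<open>d\<close>. The product shape makes every slice a copy of one connected disc.\<close>
  define V where "V = ball s0 (d/2) \<times> ball w0 (d/2)"
  have V: "V \<subseteq> ball (s0, w0) d"
  proof
    fix x assume "x \<in> V"
    then have "dist s0 (fst x) + dist w0 (snd x) < d" by (auto simp: V_def)
    moreover have "dist (s0, w0) x \<le> dist s0 (fst x) + dist w0 (snd x)"
      using sqrt_sum_squares_le_sum_abs[of "dist s0 (fst x)" "dist w0 (snd x)"]
      by (cases x) (simp add: dist_Pair_Pair)
    ultimately show "x \<in> ball (s0, w0) d" by simp
  qed
  have oV: "open V" by (simp add: V_def open_Times)
  have "embedded_param V F F' m"
  proof
    show "smooth_on V F"
      unfolding smooth_on_def using Ck_on_interior[OF F_Ck oV] V d(3) by blast
    show "(F has_derivative F' x) (at x)" if "x \<in> V" for x using F_deriv V d(3) that by blast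
    show "m * norm (x - y) \<le> norm (F x - F y)" if "x \<in> V" "y \<in> V" for x y
      using d(4) V that by blast
  qed (use oV d(2) in auto)
  then show ?thesis using that[of "d/2" m] d V by (auto simp: V_def)
qed

end

section \<open>A ruled piece of the hypersurface: normal, rulings, leaves\<close>

locale ruled_piece = ruled_data h r \<epsilon> \<epsilon>' v T \<delta> \<delta>s \<delta>ss k + emb: embedded_param "I \<times> B" F F' m
  for h r \<epsilon> \<epsilon>' v T \<delta> \<delta>s \<delta>ss k I B m +
  assumes in_D: "I \<times> B \<subseteq> D" and B: "open B" "connected B" "B \<noteq> {}"
begin

abbreviation g where "g \<equiv> submersion_metric h c k"
abbreviation M where "M \<equiv> F ` (I \<times> B)"
definition \<xi> where "\<xi> p = push k (Z (inv_into (I \<times> B) F p)) (X (inv_into (I \<times> B) F p))"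

lemma \<xi>_F: "x \<in> I \<times> B \<Longrightarrow> \<xi> (F x) = push k (Z x) (X x)"
  using emb.inj_F by (simp add: \<xi>_def)

lemma structure_vector_F:
  assumes "x \<in> I \<times> B"
  shows "structure_vector \<xi> (F x) = W x"
proof -
  have zk: "Z x $ k \<noteq> 0" using D_simps(3) assms in_D by blast
  have "\<i> *s (t *s (\<i> *s u)) = - (t *s u)" for t and u :: "complex^3"
    by (simp add: vec_eq_iff complex_eq_iff)
  then have "J (push k (Z x) (X x)) = push k (Z x) (- (\<tau> x *\<^sub>R E (fst x)))"
    unfolding push_J[OF zk, symmetric] by (simp add: X_def scaleR_eq_vector_scale)
  then show ?thesis
    by (simp add: structure_vector_def \<xi>_F[OF assms] push_minus[OF zk] W_def)
qed

lemma W_perp_F: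
  assumes x: "x \<in> I \<times> B"
  shows "W_perp g M \<xi> (F x) = range (\<lambda>d. F' x (0, d))"
proof -
  have xD: "x \<in> D" using x in_D by blast
  have "g (F x) (F' x y) (W x) = 0 \<longleftrightarrow> fst y = 0" for y
    using \<tau>_pos[OF xD] D_simps(2)[OF xD] S_pos[OF xD] by (simp add: metric_tangent_W[OF xD])
  then have "W_perp g M \<xi> (F x) = {F' x y | y. fst y = 0}"
    unfolding W_perp_def structure_vector_F[OF x] emb.tangent_space_image[OF x] by auto
  also have "\<dots> = range (\<lambda>d. F' x (0, d))" by force
  finally show ?thesis .
qed

lemma unit_normal_M: "unit_normal g M \<xi>"
  unfolding unit_normal_def
proof (intro conjI ballI)
  have "smooth_on (I \<times> B) (\<lambda>x. \<xi> (F x))"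
    unfolding smooth_on_def
  proof
    fix n
    have "Ck_on n (I \<times> B) (\<lambda>x. push k (Z x) (X x))"
      by (rule Ck_on_interior[OF push_X_Ck emb.open_V in_D])
    then show "Ck_on n (I \<times> B) (\<lambda>x. \<xi> (F x))"
      by (rule Ck_on_cong[OF emb.open_V, rotated]) (simp add: \<xi>_F)
  qed
  then show "smooth_field M \<xi>"
    unfolding smooth_field_def using emb.regular by blast
next
  fix p assume "p \<in> M"
  then obtain x where x: "x \<in> I \<times> B" "p = F x" by blast
  then have xD: "x \<in> D" using in_D by blast
  show "g p (\<xi> p) (\<xi> p) = 1"
    unfolding x(2) \<xi>_F[OF x(1)] by (rule metric_normal[OF xD])
  show "g p (\<xi> p) Y = 0" if "Y \<in> tangent_space M p" for Y
    using that unfolding x(2) \<xi>_F[OF x(1)] emb.tangent_space_image[OF x(1)]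
    by (auto simp: metric_normal_tangent[OF xD])
qed

lemma shape_op_M:
  assumes "x \<in> I \<times> B"
  shows "shape_op g M \<xi> (F x) (F' x y) =
     (fst y * \<kappa> (fst x) - \<mu> x y) *\<^sub>R W x - (fst y * \<tau> x * P (fst x) * \<eta> / r\<^sup>2) *\<^sub>R F' x (0, \<i> * snd x)"
  by (rule shape_op_F[OF _ emb.embedded_param_axioms assms \<xi>_F]) (use assms in_D in blast)

text \<open>The multiple of \<open>Z\<close> by the root of \<open>S x\<close> lies on the quadric,
  since \<open>S x * N x\<close> is \<open>c\<close>.\<close>

lemma F_in_chart_domain: "x \<in> D \<Longrightarrow> F x \<in> chart_domain h c k"
proof -
  assume x: "x \<in> D"
  define l where "l = complex_of_real (sqrt (S x))"
  have l: "l \<noteq> 0" "l * cnj l = of_real (S x)"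
    using S_pos[OF x] by (simp_all add: l_def flip: of_real_mult)
  have "h (l *s Z x) (l *s Z x) = l * cnj l * of_real (N x)" by (simp add: h_simps Z_Z)
  then have "ip h (l *s Z x) (l *s Z x) = c"
    using N_neq_0[OF x] unfolding l by (simp add: ip_def S_def)
  moreover have "(l *s Z x) $ k \<noteq> 0" using l D_simps(3)[OF x] by simp
  moreover have "F x = chart k (proj (l *s Z x))"
    using chart_proj_scale[OF l(1) D_simps(3)[OF x]] by (simp add: F_def)
  ultimately show ?thesis unfolding chart_domain_def quadric_def by blast
qed

lemma ruled_M: "ruled_hypersurface (chart_domain h c k) g M \<xi>"
  unfolding ruled_hypersurface_def
proof (intro conjI ballI)
  show "M \<subseteq> chart_domain h c k" using F_in_chart_domain in_D by blast
  show "real_hypersurface M" unfolding real_hypersurface_def using emb.regular by blast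
  show "unit_normal g M \<xi>" by (rule unit_normal_M)
  fix p assume "p \<in> M"
  then obtain x where x: "x \<in> I \<times> B" "p = F x" by blast
  show "shape_op g M \<xi> p ` W_perp g M \<xi> p \<subseteq> span {structure_vector \<xi> p}"
  proof (rule image_subsetI)
    fix Y assume "Y \<in> W_perp g M \<xi> p"
    then obtain d where Y: "Y = F' x (0, d)" unfolding x(2) W_perp_F[OF x(1)] by blast
    \<comment> \<open>For \<open>fst y = 0\<close> both the \<open>\<kappa>\<close> term and the
      component along the ruling drop out.\<close>
    have "shape_op g M \<xi> p Y = (- \<mu> x (0, d)) *\<^sub>R structure_vector \<xi> p"
      unfolding x(2) Y shape_op_M[OF x(1)] structure_vector_F[OF x(1)] by simp
    then show "shape_op g M \<xi> p Y \<in> span {structure_vector \<xi> p}"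
      by (simp only:) (rule span_scale[OF span_base], simp)
  qed
qed

lemma leaves_M: "{L. leaf M (W_perp g M \<xi>) L} = {F ` ({s} \<times> B) | s. s \<in> I}"
  by (rule leaves_eq_slices[OF emb.embedded_param_axioms B W_perp_F])

end

section \<open>The radial vector\<close>

context ruled_data
begin

text \<open>\<sigma> is prescribed only where the bracket is positive. This is an open condition, so
  near \<open>t\<close> it coincides with the power -1/2 of the bracket, which explains the cube in
  the derivative.\<close>

lemma has_vector_derivative_\<sigma>:
  assumes \<sigma>: "\<And>w. \<epsilon>' * (1 + \<epsilon> * (cmod w)\<^sup>2) > 0 \<Longrightarrow> \<sigma> w > 0 \<and> \<epsilon>' * (\<sigma> w)\<^sup>2 * (1 + \<epsilon> * (cmod w)\<^sup>2) = 1"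
    and w: "\<epsilon>' * (1 + \<epsilon> * (cmod (cw t))\<^sup>2) > 0" and cw: "(cw has_vector_derivative d) (at t)"
  shows "((\<lambda>t. \<sigma> (cw t)) has_real_derivative - ((\<sigma> (cw t))^3) * \<eta> * Re (d * cnj (cw t))) (at t)"
proof -
  let ?q = "\<lambda>t. \<epsilon>' * (1 + \<epsilon> * ((Re (cw t))\<^sup>2 + (Im (cw t))\<^sup>2))"
  have q: "?q t = \<epsilon>' * (1 + \<epsilon> * (cmod (cw t))\<^sup>2)" for t by (simp add: cmod_power2)
  have \<sigma>_eq: "\<sigma> (cw t) = inverse (sqrt (?q t))" if "?q t > 0" for t
  proof -
    have s: "\<sigma> (cw t) > 0" "(\<sigma> (cw t))\<^sup>2 * ?q t = 1"
      using \<sigma>[of "cw t"] that unfolding q by (auto simp: algebra_simps)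
    then have "?q t = (inverse (\<sigma> (cw t)))\<^sup>2" by (simp add: power_inverse inverse_unique)
    then show ?thesis using s(1) by simp
  qed
  have Re: "((\<lambda>t. Re (cw t)) has_real_derivative Re d) (at t)" "((\<lambda>t. Im (cw t)) has_real_derivative Im d) (at t)"
    unfolding has_real_derivative_iff_has_vector_derivative
    by (intro bounded_linear.has_vector_derivative[OF bounded_linear_Re cw]
        bounded_linear.has_vector_derivative[OF bounded_linear_Im cw])+
  have qd: "(?q has_real_derivative \<epsilon>' * (\<epsilon> * (2 * Re (d * cnj (cw t))))) (at t)"
  proof -
    have "(?q has_real_derivative \<epsilon>' * (0 + \<epsilon> * (of_nat 2 * (Re d * Re (cw t) ^ (2 - Suc 0)) +
        of_nat 2 * (Im d * Im (cw t) ^ (2 - Suc 0))))) (at t)"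
      by (intro DERIV_cmult DERIV_add DERIV_const DERIV_power Re)
    then show ?thesis by (simp add: algebra_simps)
  qed
  have qt: "?q t > 0" using w q by simp
  have "((\<lambda>t. inverse (sqrt (?q t))) has_real_derivative
      - (inverse (sqrt (?q t)) * (inverse (sqrt (?q t)) / 2 * (\<epsilon>' * (\<epsilon> * (2 * Re (d * cnj (cw t)))))) * inverse (sqrt (?q t)))) (at t)"
    by (rule DERIV_inverse'[OF DERIV_chain2[OF DERIV_real_sqrt[OF qt] qd]]) (use qt in auto)
  moreover have "\<forall>\<^sub>F t in nhds t. inverse (sqrt (?q t)) = \<sigma> (cw t)"
  proof -
    have "isCont ?q t" using qd DERIV_isCont by blast
    then have "\<forall>\<^sub>F t in nhds t. ?q t > 0"
      using qt unfolding continuous_at_open eventually_nhds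
      by (metis (mono_tags, lifting) greaterThan_iff open_greaterThan)
    then show ?thesis by eventually_elim (simp add: \<sigma>_eq)
  qed
  ultimately have "((\<lambda>t. \<sigma> (cw t)) has_vector_derivative
      - (inverse (sqrt (?q t)) * (inverse (sqrt (?q t)) / 2 * (\<epsilon>' * (\<epsilon> * (2 * Re (d * cnj (cw t)))))) * inverse (sqrt (?q t)))) (at t)"
    unfolding has_real_derivative_iff_has_vector_derivative by (rule has_vector_derivative_eventually_eq)
  then show ?thesis
    unfolding \<sigma>_eq[OF qt, symmetric] has_real_derivative_iff_has_vector_derivative
    by (rule has_vector_derivative_eq_rhs)
      (simp add: power3_eq_cube algebra_simps add_divide_distrib)
qed

text \<open>\<sigma> varies with the modulus of \<open>w\<close>. Its radial derivative contributes
  the multiple of \<open>Z\<close> that makes the result horizontal.\<close>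

lemma radial_derivative:
  assumes \<sigma>: "\<And>w. \<epsilon>' * (1 + \<epsilon> * (cmod w)\<^sup>2) > 0 \<Longrightarrow> \<sigma> w > 0 \<and> \<epsilon>' * (\<sigma> w)\<^sup>2 * (1 + \<epsilon> * (cmod w)\<^sup>2) = 1"
    and f: "\<And>w. f w = a *s (\<sigma> w *\<^sub>R (\<delta> s + (w * of_real r) *s v))"
    and w: "\<epsilon>' * (1 + \<epsilon> * (cmod w)\<^sup>2) > 0"
  shows "Re w *\<^sub>R vector_derivative (\<lambda>x. f (Complex x (Im w))) (at (Re w)) +
      Im w *\<^sub>R vector_derivative (\<lambda>y. f (Complex (Re w) y)) (at (Im w)) =
    (a * of_real (\<sigma> w)) *s ((- (\<sigma> w)\<^sup>2 * \<eta> * (cmod w)\<^sup>2) *\<^sub>R Z (s, w) + (w * of_real r) *s v)"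
proof -
  let ?\<sigma>' = "\<lambda>d. - ((\<sigma> w)^3) * \<eta> * Re (d * cnj w)"
  have d: "((\<lambda>t. f (cw t)) has_vector_derivative a *s (\<sigma> w *\<^sub>R ((d * of_real r) *s v) + ?\<sigma>' d *\<^sub>R Z (s, w))) (at t)"
    if cw: "(cw has_vector_derivative d) (at t)" "cw t = w" for cw d t
  proof -
    have "bounded_linear (\<lambda>w. (w * of_real r) *s v)"
      by (intro linear_conv_bounded_linear[THEN iffD1] linearI)
         (simp_all add: vector_sadd_rdistrib algebra_simps vector_scale_scaleR)
    from bounded_linear.has_vector_derivative[OF this cw(1)]
    have Zd: "((\<lambda>t. \<delta> s + (cw t * of_real r) *s v) has_vector_derivative (d * of_real r) *s v) (at t)"
      using has_vector_derivative_add[OF has_vector_derivative_const] by fastforce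
    have "((\<lambda>t. \<sigma> (cw t)) has_real_derivative ?\<sigma>' d) (at t)"
      using has_vector_derivative_\<sigma>[OF \<sigma> _ cw(1)] w cw(2) by simp
    from bounded_linear.has_vector_derivative[OF bounded_linear_vector_scale has_vector_derivative_scaleR[OF this Zd]]
    show ?thesis using cw(2) by (simp add: f Z_def)
  qed
  have "((\<lambda>x. Complex x (Im w)) has_vector_derivative 1) (at (Re w))"
    "((\<lambda>y. Complex (Re w) y) has_vector_derivative \<i>) (at (Im w))"
    unfolding Complex_eq by (auto intro!: derivative_eq_intros)
  note d1 = vector_derivative_at[OF d[OF this(1) complex_surj]]
    and d2 = vector_derivative_at[OF d[OF this(2) complex_surj]]
  have K: "(Re w * ?\<sigma>' 1 + Im w * ?\<sigma>' \<i>) = \<sigma> w * (- (\<sigma> w)\<^sup>2 * \<eta> * (cmod w)\<^sup>2)"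
    unfolding cmod_power2 by (simp add: power2_eq_square power3_eq_cube algebra_simps)
  have "Re w *\<^sub>R (a *s (\<sigma> w *\<^sub>R ((1 * of_real r) *s v) + ?\<sigma>' 1 *\<^sub>R Z (s, w))) +
      Im w *\<^sub>R (a *s (\<sigma> w *\<^sub>R ((\<i> * of_real r) *s v) + ?\<sigma>' \<i> *\<^sub>R Z (s, w))) =
      a *s ((Re w * ?\<sigma>' 1 + Im w * ?\<sigma>' \<i>) *\<^sub>R Z (s, w) + \<sigma> w *\<^sub>R (((of_real (Re w) + \<i> * of_real (Im w)) * of_real r) *s v))"
    unfolding scaleR_eq_vector_scale vec_eq_iff by (simp add: algebra_simps)
  also have "\<dots> = (a * of_real (\<sigma> w)) *s ((- (\<sigma> w)\<^sup>2 * \<eta> * (cmod w)\<^sup>2) *\<^sub>R Z (s, w) + (w * of_real r) *s v)"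
    unfolding K complex_eq[symmetric] scaleR_eq_vector_scale vec_eq_iff by (simp add: algebra_simps)
  finally show ?thesis unfolding d1 d2 .
qed

end

section \<open>The adapted frame and the matrix of the shape operator\<close>

context ruled_piece
begin

context
  fixes s w and m' :: real
  assumes x: "(s, w) \<in> I \<times> B" and w: "w \<noteq> 0"
  defines "m' \<equiv> 1 / (S (s, w) * cmod w * r)"
begin

text \<open>\<open>m'\<close> is the reciprocal of the length of \<open>R\<close>. The vectors with
  \<open>w\<close> and \<open>\<i> * w\<close> are orthogonal and equally long because the metric on
  the ruling is conformal.\<close>

lemma orthonormal_basis_M:
  "orthonormal_basis (g (F (s, w))) (tangent_space M (F (s, w)))
    (vector [W (s, w), F' (s, w) (0, of_real m' * (\<i> * w)), F' (s, w) (0, of_real m' * w)])"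
proof -
  have xD: "(s, w) \<in> D" using x in_D by blast
  note lin = linear_F'[OF xD]
  have S: "S (s, w) > 0" by (rule S_pos[OF xD])
  have m: "m' \<noteq> 0" using w S r_pos by (simp add: m'_def)
  have mm: "r\<^sup>2 * (S (s, w))\<^sup>2 * (m'\<^sup>2 * (cmod w)\<^sup>2) = 1"
    using w S r_pos by (simp add: m'_def power2_eq_square)
  have ww: "Re w * Re w + Im w * Im w = (cmod w)\<^sup>2"
    by (simp only: cmod_power2) (simp add: power2_eq_square)
  have m2: "(m' * Re w) * (m' * Re w) + (m' * Im w) * (m' * Im w) = m'\<^sup>2 * (cmod w)\<^sup>2"
    unfolding ww[symmetric] by (simp add: power2_eq_square algebra_simps)
  have tW: "g (F (s, w)) (F' (s, w) (0, d)) (W (s, w)) = 0" for d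
    by (simp add: metric_tangent_W[OF xD])
  have vv: "g (F (s, w)) (F' (s, w) (0, of_real m' * w)) (F' (s, w) (0, of_real m' * w)) = 1"
    "g (F (s, w)) (F' (s, w) (0, of_real m' * (\<i> * w))) (F' (s, w) (0, of_real m' * (\<i> * w))) = 1"
    "g (F (s, w)) (F' (s, w) (0, of_real m' * w)) (F' (s, w) (0, of_real m' * (\<i> * w))) = 0"
    "g (F (s, w)) (F' (s, w) (0, of_real m' * (\<i> * w))) (F' (s, w) (0, of_real m' * w)) = 0"
    using m2 mm by (simp_all add: metric_vertical[OF xD] add.commute)
  let ?B = "vector [W (s, w), F' (s, w) (0, of_real m' * (\<i> * w)), F' (s, w) (0, of_real m' * w)] :: C2^3"
  have range: "range (\<lambda>i. ?B $ i) = {W (s, w), F' (s, w) (0, of_real m' * (\<i> * w)), F' (s, w) (0, of_real m' * w)}"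
    by (auto simp: UNIV_3)
  have "span (range (\<lambda>i. ?B $ i)) = range (F' (s, w))"
  proof
    have "subspace (range (F' (s, w)))" by (rule linear_subspace_image[OF lin subspace_UNIV])
    then show "span (range (\<lambda>i. ?B $ i)) \<subseteq> range (F' (s, w))"
      unfolding range by (intro span_minimal) (auto simp: W_eq[OF xD])
    show "range (F' (s, w)) \<subseteq> span (range (\<lambda>i. ?B $ i))"
    proof
      fix Y assume "Y \<in> range (F' (s, w))"
      then obtain y where Y: "Y = F' (s, w) y" by blast
      let ?t = "\<tau> (s, w)"
      have t: "?t \<noteq> 0" using \<tau>_pos[OF xD] by simp
      \<comment> \<open>Once the \<open>W\<close>-part is split off, the rest is \<open>u\<close>
        times \<open>of_real m' * w\<close> in the ruling parameter; real and imaginary part of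
        \<open>u\<close> are the two remaining coordinates.\<close>
      define u where "u = (snd y - of_real (fst y / ?t) * (of_real (?t * \<eta> * b s) * (\<i> * w))) / (of_real m' * w)"
      have "y = (fst y / ?t) *\<^sub>R (?t, of_real (?t * \<eta> * b s) * (\<i> * w)) +
          (Im u *\<^sub>R (0, of_real m' * (\<i> * w)) + Re u *\<^sub>R (0, of_real m' * w))"
      proof -
        have "of_real (Im u) * (of_real m' * (\<i> * w)) + of_real (Re u) * (of_real m' * w) =
            (of_real (Re u) + \<i> * of_real (Im u)) * (of_real m' * w)" by (simp add: algebra_simps)
        also have "\<dots> = snd y - of_real (fst y / ?t) * (of_real (?t * \<eta> * b s) * (\<i> * w))"
          using w m by (simp add: complex_eq[symmetric] u_def)
        finally show ?thesis using t by (simp add: prod_eq_iff scaleR_conv_of_real)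
      qed
      from arg_cong[OF this, of "F' (s, w)"]
      have "Y = (fst y / ?t) *\<^sub>R W (s, w) +
          (Im u *\<^sub>R F' (s, w) (0, of_real m' * (\<i> * w)) + Re u *\<^sub>R F' (s, w) (0, of_real m' * w))"
        unfolding Y W_eq[OF xD] linear_add[OF lin] linear_scale[OF lin] fst_conv snd_conv .
      then show "Y \<in> span (range (\<lambda>i. ?B $ i))"
        unfolding range by (simp only:) (intro span_add span_scale span_base; simp)
    qed
  qed
  then show ?thesis
    unfolding orthonormal_basis_def emb.tangent_space_image[OF x]
    by (simp add: forall_3 metric_W[OF xD] metric_W_vertical[OF xD] tW vv)
qed

text \<open>The two entries \<beta> arise separately: the first row from \<open>\<mu>\<close> on the
  ruling, the first column from the component of \<open>E'\<close> along \<delta>. Their agreement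
  is the symmetry of the shape operator.\<close>

lemma has_matrix_M:
  defines "\<alpha> \<equiv> \<tau> (s, w) * (\<kappa> s - \<eta> * b s)" and "\<beta> \<equiv> - (\<eta> * (cmod w / r))"
  shows "has_matrix (shape_op g M \<xi> (F (s, w)))
    (vector [W (s, w), F' (s, w) (0, of_real m' * (\<i> * w)), F' (s, w) (0, of_real m' * w)])
    (vector [vector [\<alpha>, \<beta>, 0], vector [\<beta>, 0, 0], vector [0, 0, 0]])"
  unfolding has_matrix_def
proof
  fix y :: "real^3"
  have xD: "(s, w) \<in> D" using x in_D by blast
  note lin = linear_F'[OF xD]
  have S: "S (s, w) > 0" by (rule S_pos[OF xD])
  let ?t = "\<tau> (s, w)" and ?S = "S (s, w)"
  define d where "d = of_real (y $ 1 * ?t * \<eta> * b s) * (\<i> * w) + (of_real (y $ 2 * m') * (\<i> * w) + of_real (y $ 3 * m') * w)"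
  have "(y $ 1) *\<^sub>R W (s, w) + (y $ 2 *\<^sub>R F' (s, w) (0, of_real m' * (\<i> * w)) + y $ 3 *\<^sub>R F' (s, w) (0, of_real m' * w))
    = F' (s, w) (y $ 1 *\<^sub>R (?t, of_real (?t * \<eta> * b s) * (\<i> * w)) +
         (y $ 2 *\<^sub>R (0, of_real m' * (\<i> * w)) + y $ 3 *\<^sub>R (0, of_real m' * w)))"
    unfolding linear_add[OF lin] linear_scale[OF lin] W_eq[OF xD] fst_conv snd_conv ..
  also have "y $ 1 *\<^sub>R (?t, of_real (?t * \<eta> * b s) * (\<i> * w)) +
         (y $ 2 *\<^sub>R (0, of_real m' * (\<i> * w)) + y $ 3 *\<^sub>R (0, of_real m' * w)) = (y $ 1 * ?t, d)"
    by (simp add: d_def scaleR_conv_of_real algebra_simps)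
  finally have comb: "(y $ 1) *\<^sub>R W (s, w) + (y $ 2 *\<^sub>R F' (s, w) (0, of_real m' * (\<i> * w)) + y $ 3 *\<^sub>R F' (s, w) (0, of_real m' * w))
    = F' (s, w) (y $ 1 * ?t, d)" .
  have rN: "r\<^sup>2 / N (s, w) = \<epsilon> * ?S" by (simp add: S_def)
  have "Im (d * cnj w) = (y $ 1 * ?t * \<eta> * b s + y $ 2 * m') * (cmod w)\<^sup>2"
    unfolding cmod_power2 by (simp add: d_def power2_eq_square algebra_simps)
  moreover have "Im (h (Z' (s, w) (y $ 1 * ?t, d)) (Z (s, w))) =
      r\<^sup>2 * (y $ 1 * ?t * b s + \<epsilon>' * Im (d * cnj w))"
    unfolding Z'_Z[OF xD] by (simp add: algebra_simps)
  ultimately have "Im (h (Z' (s, w) (y $ 1 * ?t, d)) (Z (s, w))) =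
      r\<^sup>2 * (y $ 1 * ?t * b s + \<epsilon>' * ((y $ 1 * ?t * \<eta> * b s + y $ 2 * m') * (cmod w)\<^sup>2))"
    by (simp only:)
  then have "\<mu> (s, w) (y $ 1 * ?t, d) =
      r\<^sup>2 / N (s, w) * (y $ 1 * ?t * b s + \<epsilon>' * ((y $ 1 * ?t * \<eta> * b s + y $ 2 * m') * (cmod w)\<^sup>2))"
    by (simp add: \<mu>_def)
  also have "\<dots> = y $ 1 * ?t * b s * (\<eta> * (?S * (\<epsilon>' * (1 + \<epsilon> * (cmod w)\<^sup>2)))) + y $ 2 * (\<eta> * (?S * m' * (cmod w)\<^sup>2))"
    unfolding rN by (simp add: algebra_simps)
  \<comment> \<open>The ruling part of \<open>W\<close> depends on \<open>w\<close>; by the equation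
    for \<sigma> the contribution of \<open>W\<close> to \<open>\<mu>\<close> nevertheless reduces
    to \<open>\<eta> * b s\<close> times \<open>?t\<close>, the second such term in
    \<alpha>.\<close>
  also have "?S * (\<epsilon>' * (1 + \<epsilon> * (cmod w)\<^sup>2)) = 1" using S_eq[OF xD] by simp
  also have "?S * m' * (cmod w)\<^sup>2 = cmod w / r"
    using S w r_pos by (simp add: m'_def power2_eq_square)
  finally have \<mu>: "y $ 1 * ?t * \<kappa> s - \<mu> (s, w) (y $ 1 * ?t, d) = \<alpha> * y $ 1 + \<beta> * y $ 2"
    by (simp add: \<alpha>_def \<beta>_def algebra_simps)
  \<comment> \<open>\<open>?t * ?t * P s\<close> is \<open>1 / ?S\<close>, as \<open>?t\<close> is
    1/\<rho>; this factor cancels the one in \<open>m'\<close>.\<close>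
  have "m' * (\<beta> * y $ 1) = - (y $ 1 * ?t * ?t * P s * \<eta> / r\<^sup>2)"
  proof -
    have "?t * ?t * P s = 1 / ?S"
      using \<tau>_sq[OF xD] S by (simp add: field_simps power2_eq_square)
    then have "y $ 1 * (?t * ?t * P s) * \<eta> / r\<^sup>2 = y $ 1 * (1 / ?S) * \<eta> / r\<^sup>2" by simp
    moreover have "m' * (\<beta> * y $ 1) = - (y $ 1 * (1 / ?S) * \<eta> / r\<^sup>2)"
      using S w r_pos by (simp add: m'_def \<beta>_def power2_eq_square ac_simps)
    ultimately show ?thesis by (simp add: mult.assoc)
  qed
  then have "(\<beta> * y $ 1) *\<^sub>R F' (s, w) (0, of_real m' * (\<i> * w)) =
      - ((y $ 1 * ?t * ?t * P s * \<eta> / r\<^sup>2) *\<^sub>R F' (s, w) (0, \<i> * w))"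
  proof -
    assume e: "m' * (\<beta> * y $ 1) = - (y $ 1 * ?t * ?t * P s * \<eta> / r\<^sup>2)"
    have "(0::real, complex_of_real m' * (\<i> * w)) = m' *\<^sub>R (0, \<i> * w)"
      by (simp add: scaleR_conv_of_real)
    then have "F' (s, w) (0, of_real m' * (\<i> * w)) = m' *\<^sub>R F' (s, w) (0, \<i> * w)"
      by (metis lin linear_scale)
    then have "(\<beta> * y $ 1) *\<^sub>R F' (s, w) (0, of_real m' * (\<i> * w)) = (m' * (\<beta> * y $ 1)) *\<^sub>R F' (s, w) (0, \<i> * w)"
      by (simp add: mult.commute)
    then show ?thesis unfolding e by simp
  qed
  then show "shape_op g M \<xi> (F (s, w)) (\<Sum>i\<in>UNIV. y $ i *\<^sub>R
      (vector [W (s, w), F' (s, w) (0, of_real m' * (\<i> * w)), F' (s, w) (0, of_real m' * w)] :: C2^3) $ i) =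
    (\<Sum>i\<in>UNIV. ((vector [vector [\<alpha>, \<beta>, 0], vector [\<beta>, 0, 0], vector [0, 0, 0]] :: real^3^3) *v y) $ i *\<^sub>R
      (vector [W (s, w), F' (s, w) (0, of_real m' * (\<i> * w)), F' (s, w) (0, of_real m' * w)] :: C2^3) $ i)"
    using comb shape_op_M[OF x, of "(y $ 1 * ?t, d)"] \<mu>
    by (simp add: sum_3 matrix_vector_mult_def add.assoc)
qed

end

end

section \<open>Derivatives of the curve, length of the radial vector, perpendicular lines\<close>

lemma Ck_on_vector_derivative:
  assumes "open T" "Ck_on (Suc n) T f"
  shows "Ck_on n T (\<lambda>s. vector_derivative f (at s))"
    and "s \<in> T \<Longrightarrow> (f has_vector_derivative vector_derivative f (at s)) (at s)"
proof -
  have diff: "f differentiable at s" if "s \<in> T" for s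
    using Ck_on_Suc_derivD(1)[OF assms that] by (rule differentiableI)
  then show "s \<in> T \<Longrightarrow> (f has_vector_derivative vector_derivative f (at s)) (at s)"
    by (simp flip: vector_derivative_works)
  show "Ck_on n T (\<lambda>s. vector_derivative f (at s))"
    by (rule Ck_on_cong[OF assms(1) _ Ck_on_Suc_derivD(2)[OF assms, of 1]])
       (simp add: frechet_derivative_eq_vector_derivative[OF diff])
qed

context ruled_data
begin

text \<open>\<open>U\<close> is \<open>R\<close> without the factor
  \<open>e^(i \<theta>) \<sigma>\<close>. As \<open>S * N = c\<close>, its multiple of
  \<open>Z\<close> cancels the vertical component of the multiple of \<open>v\<close>;
  \<open>U\<close> is therefore horizontal and its square can be taken from the metric on the
  ruling.\<close>

lemma radial_length:
  assumes x: "(s, w) \<in> D"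
  defines "U \<equiv> (- S (s, w) * \<eta> * (cmod w)\<^sup>2) *\<^sub>R Z (s, w) + (w * of_real r) *s v"
  shows "push k (Z (s, w)) U = F' (s, w) (0, w)" and "ip h U U = r\<^sup>2 * S (s, w) * (cmod w)\<^sup>2"
proof -
  have z: "Z (s, w) $ k \<noteq> 0" using D_simps(3)[OF x] .
  show p: "push k (Z (s, w)) U = F' (s, w) (0, w)"
    by (simp add: U_def F'_def Z'_def push_add[OF z] push_diff[OF z] push_scaleR[OF z] push_self[OF z])
  have S: "S (s, w) > 0" by (rule S_pos[OF x])
  have SN: "S (s, w) * N (s, w) = \<epsilon> * r\<^sup>2" using N_neq_0[OF x] by (simp add: S_def)
  have "h U (Z (s, w)) = of_real (- (S (s, w) * N (s, w)) * \<eta> * (cmod w)\<^sup>2) + w * cnj w * of_real (r\<^sup>2 * \<epsilon>')"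
    using v_Z[OF x] by (simp add: U_def h_simps Z_Z power2_eq_square algebra_simps)
  also have "\<dots> = 0"
    unfolding SN complex_norm_square[symmetric] by (simp add: algebra_simps)
  finally have hor: "h U (Z (s, w)) = 0" .
  have "S (s, w) * Re (h U U) = r\<^sup>2 * (S (s, w))\<^sup>2 * Re (w * cnj w)"
    using metric_F_horizontal[OF x hor, of U] metric_vertical[OF x, of w w] unfolding p by simp
  also have "Re (w * cnj w) = (cmod w)\<^sup>2" by (simp only: cmod_power2) (simp add: power2_eq_square)
  finally show "ip h U U = r\<^sup>2 * S (s, w) * (cmod w)\<^sup>2"
    using S by (simp add: ip_def power2_eq_square)
qed

text \<open>At \<delta> the vector \<delta> projects to 0, so the line has the directions of
  multiples of \<open>v\<close>, which is orthogonal to \<open>V\<close>. The constant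
  \<open>\<eta> * r\<^sup>2\<close> is the square of \<delta>, which covers the indefinite case as
  well.\<close>

lemma perp_line_span:
  assumes s: "s \<in> T" and V: "\<And>y. y \<in> V \<Longrightarrow> h v y = 0"
  shows "perp_line h (\<eta> * r\<^sup>2) V (\<delta> s) (vec.span {\<delta> s, v})"
  unfolding perp_line_def
proof (intro conjI allI impI ballI)
  have v0: "v \<noteq> 0" using v_v by auto
  have "\<delta> s \<notin> vec.span {v}"
  proof
    assume "\<delta> s \<in> vec.span {v}"
    then obtain a where a: "\<delta> s = a *s v" by (auto simp: vec.span_singleton)
    have "h (\<delta> s) (\<delta> s) = a * h v (\<delta> s)" by (subst (1) a) (simp add: h_simps)
    then show False using \<delta>_\<delta>[OF s] v_\<delta>[OF s] r_pos by simp
  qed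
  then have "vec.independent {\<delta> s, v}" "\<delta> s \<noteq> v"
    using v0 by (auto simp: vec.independent_insert vec.span_base)
  then show "vec.dim (vec.span {\<delta> s, v}) = 2"
    using vec.dim_span_eq_card_independent by fastforce
  show "\<delta> s \<in> vec.span {\<delta> s, v}" by (simp add: vec.span_base)
  fix k' x y assume k': "\<delta> s $ k' \<noteq> 0" and x: "x \<in> vec.span {\<delta> s, v}" and y: "y \<in> V"
  obtain a a' where "x - a *s \<delta> s = a' *s v"
    using x by (auto simp: vec.span_insert vec.span_singleton)
  then have x: "x = a *s \<delta> s + a' *s v" by (simp add: algebra_simps)
  have ip: "ip h (\<delta> s) (\<delta> s) = \<eta> * r\<^sup>2" using \<delta>_\<delta>[OF s] by (simp add: ip_def)
  have "\<eta> * r\<^sup>2 \<noteq> 0" using r_pos by simp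
  then show "submersion_metric h (\<eta> * r\<^sup>2) k' (chart k' (proj (\<delta> s))) (push k' (\<delta> s) x) (push k' (\<delta> s) y) = 0"
    using submersion_metric_push[OF k', of "\<eta> * r\<^sup>2" x y]
    by (simp add: ip x h_simps V[OF y] v_\<delta>[OF s] \<delta>_\<delta>[OF s])
qed (rule vec.subspace_span)

end

section \<open>The theorem\<close>

theorem mainTheorem4:
  fixes h :: "complex^3 \<Rightarrow> complex^3 \<Rightarrow> complex"
    and r \<epsilon> \<epsilon>' :: real
    and V :: "(complex^3) set" and v :: "complex^3"
    and I :: "real set" and \<delta> \<delta>\<^sub>s \<delta>\<^sub>s\<^sub>s :: "real \<Rightarrow> complex^3"
    and \<sigma> :: "complex \<Rightarrow> real" and f :: "real \<Rightarrow> real \<Rightarrow> complex \<Rightarrow> complex^3"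
    and b :: "real \<Rightarrow> real" and e R :: "real \<Rightarrow> real \<Rightarrow> complex \<Rightarrow> complex^3"
    and \<rho> \<alpha> :: "real \<Rightarrow> real \<Rightarrow> complex \<Rightarrow> real" and \<beta> :: "complex \<Rightarrow> real"
    and dom :: "(real \<times> real \<times> complex) set"
    and \<theta>\<^sub>0 s\<^sub>0 :: real and w\<^sub>0 :: complex and k :: 3
  assumes "r > 0" and "\<epsilon> \<in> {1, - 1}" and "\<epsilon>' \<in> {1, - 1}"
    and "hermitian_form h"
    and "if \<epsilon> = 1 then positive_definite (ip h) else has_signature (ip h) 2 4"
    and "vec.subspace V" and "vec.dim V = 2"
    and "\<forall>x\<in>V. (\<forall>y\<in>V. ip h x y = 0) \<longrightarrow> x = 0"
    and "\<forall>x\<in>V. ip h v x = 0" and "ip h v v = \<epsilon>'"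
    and "is_interval I" and "smooth_on I \<delta>" and "\<delta> ` I \<subseteq> V"
    and "\<forall>s\<in>I. ip h (\<delta> s) (\<delta> s) = \<epsilon> * \<epsilon>' * r\<^sup>2"
    and "\<And>s. \<delta>\<^sub>s s = vector_derivative \<delta> (at s)"
    and "\<And>s. \<delta>\<^sub>s\<^sub>s s = vector_derivative \<delta>\<^sub>s (at s)"
    and "dom = {(\<theta>, s, w). s \<in> interior I \<and> \<epsilon>' * (1 + \<epsilon> * (cmod w)\<^sup>2) > 0}"
    and "\<And>w. \<epsilon>' * (1 + \<epsilon> * (cmod w)\<^sup>2) > 0 \<Longrightarrow>
           \<sigma> w > 0 \<and> \<epsilon>' * (\<sigma> w)\<^sup>2 * (1 + \<epsilon> * (cmod w)\<^sup>2) = 1"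
    and "\<And>\<theta> s w. f \<theta> s w = cis \<theta> *s (\<sigma> w *\<^sub>R (\<delta> s + (w * of_real r) *s v))"
    and "\<And>s. b s = ip h (\<delta>\<^sub>s s) (\<i> *s \<delta> s) / r\<^sup>2"
    and "\<And>\<theta> s w. e \<theta> s w =
           cis \<theta> *s (\<sigma> w *\<^sub>R (\<delta>\<^sub>s s - (\<epsilon>' * \<epsilon> * b s) *\<^sub>R (\<i> *s \<delta> s)))"
    and "\<And>\<theta> s w. \<rho> \<theta> s w = len h (e \<theta> s w)"
    and "\<And>\<theta> s w. R \<theta> s w =
           Re w *\<^sub>R vector_derivative (\<lambda>x. f \<theta> s (Complex x (Im w))) (at (Re w)) +
           Im w *\<^sub>R vector_derivative (\<lambda>y. f \<theta> s (Complex (Re w) y)) (at (Im w))"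
    and "\<And>w. \<beta> w = - (\<epsilon>' * \<epsilon> * (cmod w / r))"
    and "\<And>\<theta> s w. \<alpha> \<theta> s w =
           1 / \<rho> \<theta> s w *
             ((ip h (\<delta>\<^sub>s\<^sub>s s) (\<i> *s \<delta>\<^sub>s s) - \<epsilon>' * \<epsilon> * b s * ip h (\<delta>\<^sub>s s) (\<delta>\<^sub>s s)) /
                (ip h (\<delta>\<^sub>s s) (\<delta>\<^sub>s s) - \<epsilon>' * \<epsilon> * (b s)\<^sup>2 * r\<^sup>2)
              - 2 * \<epsilon>' * \<epsilon> * b s)"
    and "(\<theta>\<^sub>0, s\<^sub>0, w\<^sub>0) \<in> dom" and "\<rho> \<theta>\<^sub>0 s\<^sub>0 w\<^sub>0 \<noteq> 0" and "f \<theta>\<^sub>0 s\<^sub>0 w\<^sub>0 $ k \<noteq> 0"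
  shows "\<exists>U M \<xi> g.
     open U \<and> (\<theta>\<^sub>0, s\<^sub>0, w\<^sub>0) \<in> U \<and> U \<subseteq> dom \<and>
     (\<forall>(\<theta>, s, w)\<in>U. \<rho> \<theta> s w \<noteq> 0 \<and> f \<theta> s w $ k \<noteq> 0) \<and>
     M = chart k ` proj ` {f \<theta> s w | \<theta> s w. (\<theta>, s, w) \<in> U} \<and>
     g = submersion_metric h (\<epsilon> * r\<^sup>2) k \<and>
     ruled_hypersurface (chart_domain h (\<epsilon> * r\<^sup>2) k) g M \<xi> \<and>
     {L. leaf M (W_perp g M \<xi>) L} =
       {chart k ` proj ` {f \<theta> s w | \<theta> w. (\<theta>, s, w) \<in> U} | s. \<exists>\<theta> w. (\<theta>, s, w) \<in> U} \<and>
     (\<forall>s. (\<exists>\<theta> w. (\<theta>, s, w) \<in> U) \<longrightarrow>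
        (\<exists>P. perp_line h (\<epsilon> * \<epsilon>' * r\<^sup>2) V (\<delta> s) P \<and>
             proj ` {f \<theta> s w | \<theta> w. (\<theta>, s, w) \<in> U} \<subseteq> proj ` (P - {0}))) \<and>
     (\<forall>(\<theta>, s, w)\<in>U. w \<noteq> 0 \<longrightarrow>
        (let z = f \<theta> s w; p = chart k (proj z);
             W = structure_vector \<xi> p;
             E1 = push k z ((1 / len h (R \<theta> s w)) *\<^sub>R (\<i> *s R \<theta> s w));
             E2 = push k z ((1 / len h (R \<theta> s w)) *\<^sub>R R \<theta> s w)
         in \<xi> p = push k z ((1 / \<rho> \<theta> s w) *\<^sub>R (\<i> *s e \<theta> s w)) \<and>
            W = push k z ((1 / \<rho> \<theta> s w) *\<^sub>R e \<theta> s w) \<and>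
            orthonormal_basis (g p) (tangent_space M p) (vector [W, E1, E2]) \<and>
            has_matrix (shape_op g M \<xi> p) (vector [W, E1, E2])
              (vector [vector [\<alpha> \<theta> s w, \<beta> w, 0],
                       vector [\<beta> w, 0, 0],
                       vector [0, 0, 0]])))"
proof -
  have hf: "hermitian h" by unfold_locales (rule assms(4))
  interpret hermitian h by (rule hf)
  note r = assms(1) and \<delta>s = assms(15) and \<delta>ss = assms(16) and dom = assms(17) and \<sigma> = assms(18)
    and f = assms(19) and b = assms(20) and e = assms(21) and \<rho> = assms(22) and R = assms(23)
    and \<beta> = assms(24) and \<alpha> = assms(25) and pt_dom = assms(26) and \<rho>0 = assms(27) and fk = assms(28)
  define T where "T = interior I"
  have T: "open T" "T \<subseteq> I" by (auto simp: T_def interior_subset)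
  have \<delta>V: "\<delta> s \<in> V" if "s \<in> T" for s using assms(13) T that by blast
  \<comment> \<open>\<open>V\<close> is a complex subspace: testing with \<open>\<i> *s x\<close>
    turns real orthogonality into Hermitian orthogonality.\<close>
  have vV: "h v x = 0" if "x \<in> V" for x
  proof -
    have "\<i> *s x \<in> V" using assms(6) that by (rule vec.subspace_scale)
    then have "ip h v (\<i> *s x) = 0" "ip h v x = 0" using assms(9) that by auto
    then show ?thesis unfolding ip_ii by (simp add: ip_def complex_eq_iff)
  qed
  have smooth: "Ck_on n T \<delta>" for n
    using assms(12) Ck_on_interior[OF _ T] unfolding smooth_on_def by blast
  have \<delta>s_fun: "\<delta>\<^sub>s = (\<lambda>s. vector_derivative \<delta> (at s))" and \<delta>ss_fun: "\<delta>\<^sub>s\<^sub>s = (\<lambda>s. vector_derivative \<delta>\<^sub>s (at s))"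
    using \<delta>s \<delta>ss by auto
  have smooth': "Ck_on n T \<delta>\<^sub>s" for n
    unfolding \<delta>s_fun by (rule Ck_on_vector_derivative(1)[OF T(1) smooth])
  have \<epsilon>s: "\<epsilon> * \<epsilon> = 1" "\<epsilon>' * \<epsilon>' = 1" using assms(2,3) by auto
  interpret L: ruled_data h r \<epsilon> \<epsilon>' v T \<delta> \<delta>\<^sub>s \<delta>\<^sub>s\<^sub>s k
  proof
    show "h v v = of_real \<epsilon>'" using assms(10) h_self[of v] by simp
    fix s assume s: "s \<in> T"
    show "(\<delta> has_vector_derivative \<delta>\<^sub>s s) (at s)" "(\<delta>\<^sub>s has_vector_derivative \<delta>\<^sub>s\<^sub>s s) (at s)"
      using Ck_on_vector_derivative(2)[OF T(1) smooth s] Ck_on_vector_derivative(2)[OF T(1) smooth' s]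
      by (simp_all add: \<delta>s \<delta>ss)
    show dv: "h (\<delta> s) v = 0" using vV[OF \<delta>V[OF s]] h_cnj[of "\<delta> s" v] by simp
    have dd: "ip h (\<delta> s) (\<delta> s) = \<epsilon> * \<epsilon>' * r\<^sup>2" using assms(14) T(2) s by blast
    then show "h (\<delta> s) (\<delta> s) = of_real (\<epsilon> * \<epsilon>' * r\<^sup>2)" using h_self[of "\<delta> s"] by simp
    show "ip h x x \<ge> 0" if x: "h x (\<delta> s) = 0" "h x v = 0" for x
    proof (cases "\<epsilon> = 1")
      case True
      then show ?thesis
        using assms(5) by (cases "x = 0") (auto simp: positive_definite_def ip_def intro: less_imp_le)
    next
      case False
      then have \<epsilon>: "\<epsilon> = - 1" using assms(2) by simp
      show ?thesis
      \<comment> \<open>The squares of \<delta> and \<open>v\<close> have the signs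
        \<open>\<epsilon> * \<epsilon>'\<close> and \<open>\<epsilon>'\<close>, so for
        \<open>\<epsilon> = - 1\<close> the timelike vector is \<delta> in the first case and
        \<open>v\<close> in the second.\<close>
      proof (cases "\<epsilon>' = 1")
        case True
        then have "ip h (\<delta> s) (\<delta> s) < 0" using dd \<epsilon> r by simp
        then show ?thesis using ip_nonneg_of_signature[OF assms(5) _ x(1)] by blast
      next
        case False
        then have "ip h v v < 0" using assms(3,10) by auto
        then show ?thesis using ip_nonneg_of_signature[OF assms(5) _ x(2)] by blast
      qed
    qed
  qed (use r assms(2,3) T(1) smooth smooth' in auto)

  define lam where "lam = (\<lambda>\<theta> w. cis \<theta> * complex_of_real (\<sigma> w))"
  define pos where "pos = (\<lambda>w. \<epsilon>' * (1 + \<epsilon> * (cmod w)\<^sup>2) > 0)"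
  have lam: "lam \<theta> w \<noteq> 0" "lam \<theta> w * cnj (lam \<theta> w) = of_real ((\<sigma> w)\<^sup>2)" if "pos w" for \<theta> w
  proof -
    have "\<sigma> w > 0" using \<sigma>[of w] that by (simp add: pos_def)
    then show "lam \<theta> w \<noteq> 0" by (simp add: lam_def)
    show "lam \<theta> w * cnj (lam \<theta> w) = of_real ((\<sigma> w)\<^sup>2)"
      using complex_norm_square[of "lam \<theta> w"] by (simp add: lam_def norm_mult)
  qed
  have fZ: "f \<theta> s w = lam \<theta> w *s L.Z (s, w)" for \<theta> s w
    by (simp add: f lam_def L.Z_def scaleR_eq_vector_scale vector_smult_assoc)
  have bb: "b s = L.b s" for s by (simp add: b L.b_def)
  have eE: "e \<theta> s w = lam \<theta> w *s L.E s" for \<theta> s w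
    by (simp add: e lam_def L.E_def bb scaleR_eq_vector_scale vector_smult_assoc mult.commute[of \<epsilon>'])
  have \<rho>sq: "ip h (e \<theta> s w) (e \<theta> s w) = (\<sigma> w)\<^sup>2 * L.P s" if "pos w" for \<theta> s w
  proof -
    have "h (e \<theta> s w) (e \<theta> s w) = lam \<theta> w * cnj (lam \<theta> w) * h (L.E s) (L.E s)"
      by (simp add: eE h_simps)
    then show ?thesis unfolding lam(2)[OF that] by (simp add: ip_def L.P_def)
  qed
  have s0: "s\<^sub>0 \<in> T" "pos w\<^sub>0" using pt_dom by (auto simp: dom T_def pos_def)
  have "L.P s\<^sub>0 \<noteq> 0" using \<rho>0 \<rho>sq[OF s0(2)] by (auto simp: \<rho> len_def)
  moreover have "L.Z (s\<^sub>0, w\<^sub>0) $ k \<noteq> 0" using fk by (simp add: fZ)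
  ultimately have "(s\<^sub>0, w\<^sub>0) \<in> L.D" using s0 by (simp add: L.D_def pos_def)
  then obtain a m where a: "a > 0" "ball s\<^sub>0 a \<times> ball w\<^sub>0 a \<subseteq> L.D"
    and emb: "embedded_param (ball s\<^sub>0 a \<times> ball w\<^sub>0 a) L.F L.F' m"
    using L.local_embedding by blast
  define J where "J = ball s\<^sub>0 a"
  define B where "B = ball w\<^sub>0 a"
  interpret emb: embedded_param "J \<times> B" L.F L.F' m using emb by (simp add: J_def B_def)
  interpret Q: ruled_piece h r \<epsilon> \<epsilon>' v T \<delta> \<delta>\<^sub>s \<delta>\<^sub>s\<^sub>s k J B m
    by unfold_locales (use a in \<open>auto simp: J_def B_def\<close>)
  define U where "U = (UNIV :: real set) \<times> J \<times> B"
  have UD: "(s, w) \<in> L.D" "pos w" "s \<in> T" if "(\<theta>, s, w) \<in> U" for \<theta> s w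
    using that Q.in_D by (auto simp: U_def L.D_def pos_def)
  have \<sigma>S: "\<sigma> w > 0" "(\<sigma> w)\<^sup>2 = L.S (s, w)" if "(s, w) \<in> L.D" for s w
  proof -
    have p: "\<epsilon>' * (1 + \<epsilon> * (cmod w)\<^sup>2) > 0" using that by (simp add: L.D_def)
    show "\<sigma> w > 0" using \<sigma>[OF p] by simp
    have "(\<sigma> w)\<^sup>2 * (\<epsilon>' * (1 + \<epsilon> * (cmod w)\<^sup>2)) = L.S (s, w) * (\<epsilon>' * (1 + \<epsilon> * (cmod w)\<^sup>2))"
      using \<sigma>[OF p] L.S_eq[OF that] by (simp add: algebra_simps)
    then show "(\<sigma> w)\<^sup>2 = L.S (s, w)" using p by (metis less_irrefl mult_right_cancel)
  qed
  have F_f: "chart k (proj (f \<theta> s w)) = L.F (s, w)" if "(\<theta>, s, w) \<in> U" for \<theta> s w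
    unfolding fZ L.F_def by (rule chart_proj_scale[OF lam(1) L.D_simps(3)]) (use UD[OF that] in auto)
  have \<rho>\<tau>: "\<rho> \<theta> s w > 0" "1 / \<rho> \<theta> s w = L.\<tau> (s, w)" if "(\<theta>, s, w) \<in> U" for \<theta> s w
  proof -
    note x = UD(1)[OF that]
    have "\<rho> \<theta> s w = sqrt (L.S (s, w) * L.P s)"
      unfolding \<rho> len_def \<rho>sq[OF UD(2)[OF that]] \<sigma>S(2)[OF x] ..
    moreover have "L.\<tau> (s, w) = inverse (sqrt (L.S (s, w) * L.P s))"
      by (simp add: L.\<tau>_def L.S_def divide_inverse mult.commute mult.left_commute)
    ultimately show "\<rho> \<theta> s w > 0" "1 / \<rho> \<theta> s w = L.\<tau> (s, w)"
      using L.S_pos[OF x] L.D_simps(2)[OF x] by (simp_all add: inverse_eq_divide)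
  qed
  have slice: "chart k ` proj ` {f \<theta> s w | \<theta> w. (\<theta>, s, w) \<in> U} = L.F ` ({s} \<times> B)" if "s \<in> J" for s
  proof -
    have "chart k ` proj ` {f \<theta> s w | \<theta> w. (\<theta>, s, w) \<in> U} = {chart k (proj (f \<theta> s w)) | \<theta> w. (\<theta>, s, w) \<in> U}" by blast
    also have "\<dots> = {L.F (s, w) | \<theta> w. (\<theta>, s, w) \<in> U}" using F_f by metis
    also have "\<dots> = L.F ` ({s} \<times> B)" using that by (auto simp: U_def)
    finally show ?thesis .
  qed
  have sJ: "(\<exists>\<theta> w. (\<theta>, s, w) \<in> U) \<longleftrightarrow> s \<in> J" for s using Q.B(3) by (auto simp: U_def)
  have M: "Q.M = chart k ` proj ` {f \<theta> s w | \<theta> s w. (\<theta>, s, w) \<in> U}"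
  proof -
    have "chart k ` proj ` {f \<theta> s w | \<theta> s w. (\<theta>, s, w) \<in> U} = {chart k (proj (f \<theta> s w)) | \<theta> s w. (\<theta>, s, w) \<in> U}" by blast
    also have "\<dots> = {L.F (s, w) | \<theta> s w. (\<theta>, s, w) \<in> U}" using F_f by metis
    also have "\<dots> = Q.M" by (auto simp: U_def)
    finally show ?thesis ..
  qed
  have leaves: "{L. leaf Q.M (W_perp Q.g Q.M Q.\<xi>) L} =
       {chart k ` proj ` {f \<theta> s w | \<theta> w. (\<theta>, s, w) \<in> U} | s. \<exists>\<theta> w. (\<theta>, s, w) \<in> U}"
    unfolding Q.leaves_M sJ by (simp only: slice cong: rev_conj_cong)
  have perp: "\<exists>P. perp_line h (\<epsilon> * \<epsilon>' * r\<^sup>2) V (\<delta> s) P \<and>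
             proj ` {f \<theta> s w | \<theta> w. (\<theta>, s, w) \<in> U} \<subseteq> proj ` (P - {0})" if "\<exists>\<theta> w. (\<theta>, s, w) \<in> U" for s
  proof (intro exI conjI image_mono subsetI)
    have s: "s \<in> T" using that UD(3) by blast
    show "perp_line h (\<epsilon> * \<epsilon>' * r\<^sup>2) V (\<delta> s) (vec.span {\<delta> s, v})"
      by (rule L.perp_line_span[OF s vV])
    fix z assume "z \<in> {f \<theta> s w | \<theta> w. (\<theta>, s, w) \<in> U}"
    then obtain \<theta> w where z: "z = f \<theta> s w" and x: "(\<theta>, s, w) \<in> U" by blast
    have "z $ k \<noteq> 0" using lam(1)[OF UD(2)[OF x]] L.D_simps(3)[OF UD(1)[OF x]] by (simp add: z fZ)
    moreover have "z \<in> vec.span {\<delta> s, v}"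
      unfolding z fZ L.Z_def
      by (intro vec.span_scale vec.span_add vec.span_base) auto
    ultimately show "z \<in> vec.span {\<delta> s, v} - {0}" by auto
  qed
  have main: "w \<noteq> 0 \<longrightarrow>
        (let z = f \<theta> s w; p = chart k (proj z);
             W = structure_vector Q.\<xi> p;
             E1 = push k z ((1 / len h (R \<theta> s w)) *\<^sub>R (\<i> *s R \<theta> s w));
             E2 = push k z ((1 / len h (R \<theta> s w)) *\<^sub>R R \<theta> s w)
         in Q.\<xi> p = push k z ((1 / \<rho> \<theta> s w) *\<^sub>R (\<i> *s e \<theta> s w)) \<and>
            W = push k z ((1 / \<rho> \<theta> s w) *\<^sub>R e \<theta> s w) \<and>
            orthonormal_basis (Q.g p) (tangent_space Q.M p) (vector [W, E1, E2]) \<and>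
            has_matrix (shape_op Q.g Q.M Q.\<xi> p) (vector [W, E1, E2])
              (vector [vector [\<alpha> \<theta> s w, \<beta> w, 0],
                       vector [\<beta> w, 0, 0],
                       vector [0, 0, 0]]))" if xU: "(\<theta>, s, w) \<in> U" for \<theta> s w
  proof
    assume w: "w \<noteq> 0"
    note x = UD(1)[OF xU] and posw = UD(2)[OF xU] and s = UD(3)[OF xU]
    have xJB: "(s, w) \<in> J \<times> B" using xU by (simp add: U_def)
    note zk = L.D_simps(3)[OF x]
    define z where "z = f \<theta> s w"
    define p where "p = chart k (proj z)"
    have p: "p = L.F (s, w)" unfolding p_def z_def by (rule F_f[OF xU])
    \<comment> \<open>Base point and vector carry the same factor \<open>lam \<theta> w\<close>, so
      quantities at \<open>f \<theta> s w\<close> turn into those at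
      \<open>L.Z (s, w)\<close>.\<close>
    have push_z: "push k z (t *\<^sub>R (lam \<theta> w *s Y)) = t *\<^sub>R push k (L.Z (s, w)) Y" for t Y
    proof -
      have "t *\<^sub>R (lam \<theta> w *s Y) = lam \<theta> w *s (t *\<^sub>R Y)"
        by (simp add: scaleR_eq_vector_scale vector_smult_assoc mult.commute)
      then show ?thesis
        unfolding z_def fZ using push_scale_base[OF zk lam(1)[OF posw]] push_scaleR[OF zk] by metis
    qed
    have ilam: "\<i> *s (lam \<theta> w *s Y) = lam \<theta> w *s (\<i> *s Y)" for Y
      by (simp add: vector_smult_assoc mult.commute)
    have \<xi>: "Q.\<xi> p = push k z ((1 / \<rho> \<theta> s w) *\<^sub>R (\<i> *s e \<theta> s w))"
      unfolding p Q.\<xi>_F[OF xJB] eE ilam push_z \<rho>\<tau>(2)[OF xU] by (simp add: L.X_def push_scaleR[OF zk])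
    have sv: "structure_vector Q.\<xi> p = L.W (s, w)"
      unfolding p by (rule Q.structure_vector_F[OF xJB])
    have W: "structure_vector Q.\<xi> p = push k z ((1 / \<rho> \<theta> s w) *\<^sub>R e \<theta> s w)"
      unfolding sv eE push_z \<rho>\<tau>(2)[OF xU] by (simp add: L.W_def push_scaleR[OF zk])
    define Y where "Y = (- L.S (s, w) * (\<epsilon> * \<epsilon>') * (cmod w)\<^sup>2) *\<^sub>R L.Z (s, w) + (w * of_real r) *s v"
    have RY: "R \<theta> s w = lam \<theta> w *s Y"
      unfolding R using L.radial_derivative[OF \<sigma> f[of \<theta> s], of w] posw
      by (simp add: pos_def Y_def lam_def \<sigma>S(2)[OF x])
    have Y: "push k (L.Z (s, w)) Y = L.F' (s, w) (0, w)" "ip h Y Y = r\<^sup>2 * L.S (s, w) * (cmod w)\<^sup>2"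
      unfolding Y_def by (rule L.radial_length[OF x])+
    have S: "L.S (s, w) > 0" by (rule L.S_pos[OF x])
    have "h (R \<theta> s w) (R \<theta> s w) = lam \<theta> w * cnj (lam \<theta> w) * h Y Y" by (simp add: RY h_simps)
    then have "ip h (R \<theta> s w) (R \<theta> s w) = (\<sigma> w)\<^sup>2 * ip h Y Y"
      unfolding lam(2)[OF posw] by (simp add: ip_def)
    then have "ip h (R \<theta> s w) (R \<theta> s w) = (L.S (s, w) * cmod w * r)\<^sup>2"
      unfolding \<sigma>S(2)[OF x] Y(2) by (simp add: power2_eq_square)
    then have len: "len h (R \<theta> s w) = L.S (s, w) * cmod w * r"
      using S r by (simp add: len_def)
    define n where "n = 1 / (L.S (s, w) * cmod w * r)"
    note lin = L.linear_F'[OF x]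
    have scl: "n *\<^sub>R L.F' (s, w) (0, d) = L.F' (s, w) (0, of_real n * d)" for d
      using linear_scale[OF lin, of n "(0, d)"] by (simp add: scaleR_conv_of_real)
    have E2: "push k z ((1 / len h (R \<theta> s w)) *\<^sub>R R \<theta> s w) = L.F' (s, w) (0, of_real n * w)"
      unfolding len n_def[symmetric] unfolding RY push_z Y(1) by (rule scl)
    have "push k (L.Z (s, w)) (\<i> *s Y) = L.F' (s, w) (0, \<i> * w)"
      unfolding push_scale[OF zk] Y(1) L.F'_def
      by (simp add: L.Z'_def flip: push_scale[OF zk]) (simp add: vector_smult_assoc mult.assoc)
    then have E1: "push k z ((1 / len h (R \<theta> s w)) *\<^sub>R (\<i> *s R \<theta> s w)) = L.F' (s, w) (0, of_real n * (\<i> * w))"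
      unfolding len n_def[symmetric] unfolding RY ilam push_z by (simp add: scl)
    have P: "L.P s > 0" using L.D_simps(2)[OF x] by simp
    have Peq: "ip h (\<delta>\<^sub>s s) (\<delta>\<^sub>s s) - \<epsilon>' * \<epsilon> * (b s)\<^sup>2 * r\<^sup>2 = L.P s"
      unfolding bb L.\<delta>s_\<delta>s[OF s] by simp
    \<comment> \<open>The summand with \<open>L.P s\<close> restores what \<open>Im_E'_E\<close>
      subtracts. Division by \<open>L.P s\<close> then turns the quotient in \<alpha> into
      \<open>L.\<kappa> s\<close> plus one term \<open>\<epsilon> * \<epsilon>' * b s\<close>,
      leaving one of the two subtracted ones.\<close>
    have num: "ip h (\<delta>\<^sub>s\<^sub>s s) (\<i> *s \<delta>\<^sub>s s) - \<epsilon>' * \<epsilon> * b s * ip h (\<delta>\<^sub>s s) (\<delta>\<^sub>s s) =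
        Im (h (L.E' s) (L.E s)) + \<epsilon> * \<epsilon>' * b s * L.P s"
      unfolding L.Im_E'_E[OF s] bb by simp
    have \<alpha>': "\<alpha> \<theta> s w = L.\<tau> (s, w) * (L.\<kappa> s - \<epsilon> * \<epsilon>' * L.b s)"
      unfolding \<alpha> \<rho>\<tau>(2)[OF xU] Peq num using P by (simp add: L.\<kappa>_def bb add_divide_distrib)
    have \<beta>': "\<beta> w = - (\<epsilon> * \<epsilon>' * (cmod w / r))" by (simp add: \<beta>)
    show "let z = f \<theta> s w; p = chart k (proj z);
             W = structure_vector Q.\<xi> p;
             E1 = push k z ((1 / len h (R \<theta> s w)) *\<^sub>R (\<i> *s R \<theta> s w));
             E2 = push k z ((1 / len h (R \<theta> s w)) *\<^sub>R R \<theta> s w)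
         in Q.\<xi> p = push k z ((1 / \<rho> \<theta> s w) *\<^sub>R (\<i> *s e \<theta> s w)) \<and>
            W = push k z ((1 / \<rho> \<theta> s w) *\<^sub>R e \<theta> s w) \<and>
            orthonormal_basis (Q.g p) (tangent_space Q.M p) (vector [W, E1, E2]) \<and>
            has_matrix (shape_op Q.g Q.M Q.\<xi> p) (vector [W, E1, E2])
              (vector [vector [\<alpha> \<theta> s w, \<beta> w, 0],
                       vector [\<beta> w, 0, 0],
                       vector [0, 0, 0]])"
      unfolding Let_def z_def[symmetric] p_def[symmetric]
    proof (intro conjI)
      show "orthonormal_basis (Q.g p) (tangent_space Q.M p) (vector [structure_vector Q.\<xi> p,
          push k z ((1 / len h (R \<theta> s w)) *\<^sub>R (\<i> *s R \<theta> s w)), push k z ((1 / len h (R \<theta> s w)) *\<^sub>R R \<theta> s w)])"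
        unfolding E1 E2 sv unfolding p n_def by (rule Q.orthonormal_basis_M[OF xJB w])
      show "has_matrix (shape_op Q.g Q.M Q.\<xi> p) (vector [structure_vector Q.\<xi> p,
          push k z ((1 / len h (R \<theta> s w)) *\<^sub>R (\<i> *s R \<theta> s w)), push k z ((1 / len h (R \<theta> s w)) *\<^sub>R R \<theta> s w)])
          (vector [vector [\<alpha> \<theta> s w, \<beta> w, 0], vector [\<beta> w, 0, 0], vector [0, 0, 0]])"
        unfolding E1 E2 sv unfolding p n_def \<alpha>' \<beta>' by (rule Q.has_matrix_M[OF xJB w])
    qed (fact \<xi> W)+
  qed
  show ?thesis
  proof (intro exI[of _ U] exI[of _ Q.M] exI[of _ Q.\<xi>] exI[of _ Q.g] conjI)
    show "open U" by (simp add: U_def J_def B_def open_Times)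
    show "(\<theta>\<^sub>0, s\<^sub>0, w\<^sub>0) \<in> U" using a(1) by (simp add: U_def J_def B_def)
    show "U \<subseteq> dom" using UD by (auto simp: dom T_def pos_def)
    show "\<forall>(\<theta>, s, w)\<in>U. \<rho> \<theta> s w \<noteq> 0 \<and> f \<theta> s w $ k \<noteq> 0"
    proof (clarify)
      fix \<theta> s w assume x: "(\<theta>, s, w) \<in> U"
      show "\<rho> \<theta> s w \<noteq> 0 \<and> f \<theta> s w $ k \<noteq> 0"
        using \<rho>\<tau>(1)[OF x] lam(1)[OF UD(2)[OF x]] L.D_simps(3)[OF UD(1)[OF x]] by (simp add: fZ)
    qed
    show "Q.M = chart k ` proj ` {f \<theta> s w | \<theta> s w. (\<theta>, s, w) \<in> U}" by (rule M)
    show "ruled_hypersurface (chart_domain h (\<epsilon> * r\<^sup>2) k) Q.g Q.M Q.\<xi>" by (rule Q.ruled_M)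
    show "{L. leaf Q.M (W_perp Q.g Q.M Q.\<xi>) L} =
       {chart k ` proj ` {f \<theta> s w | \<theta> w. (\<theta>, s, w) \<in> U} | s. \<exists>\<theta> w. (\<theta>, s, w) \<in> U}" by (rule leaves)
    show "\<forall>s. (\<exists>\<theta> w. (\<theta>, s, w) \<in> U) \<longrightarrow>
        (\<exists>P. perp_line h (\<epsilon> * \<epsilon>' * r\<^sup>2) V (\<delta> s) P \<and>
             proj ` {f \<theta> s w | \<theta> w. (\<theta>, s, w) \<in> U} \<subseteq> proj ` (P - {0}))" using perp by blast
  qed (use main in auto)
qed

end
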